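(* With $K, s, t, b, W, \Delta, U$ as in the context, the Kodaira dimension of the compact complex manifold $Y=U/W$ is $-\infty$.
   Context: Number field. Let $K$ be a number field of degree $n=s+2t$ with $s>0$ real embeddings $\sigma_1,\dots,\sigma_s$ and $2t>0$ non-real embeddings $\sigma_{s+1},\dots,\sigma_n$ into $\mathbb{C}$, ordered so that $\sigma_{s+i}=\overline{\sigma_{s+t+i}}$ for $1\le i\le t$. Let $\mathcal{O}_K$ be its ring of integers, $\mathcal{O}_K^*$ the unit group and $\mathcal{O}_K^{*,+}$ the group of units $\eta$ with $\sigma_i(\eta)>0$ for $i=1,\dots,s$. For a unit $\eta$ put $\eta_i=\sigma_i(\eta)$ if $i\le s$ and $\eta_i=|\sigma_i(\eta)|$ if $s<i\le s+t$. Let $\sigma_K=(\sigma_1,\dots,\sigma_n):K\to\mathbb{R}^s\times\mathbb{C}^{2t}\subset\mathbb{C}^n$, let $\Lambda=\sigma_K(\mathcal{O}_K)$ (a lattice of rank $n$), and let $E\subset\mathbb{C}^n$ be the real span of $\Lambda$ ($\dim_{\mathbb{R}}E=n$). Units act on $\mathbb{C}^n$ by $\eta\cdot(z_i)=(\sigma_i(\eta)z_i)$; this preserves $\Lambda$ and $E$. Groups. Fix a $\mathbb{Z}$-basis $\mathcal{B}_K$ of $\Lambda$ (it is a $\mathbb{C}$-basis of $\mathbb{C}^n$); coordinates in $\mathcal{B}_K$ followed by $x\mapsto \exp(2i\pi x)$ identify $\mathbb{C}^n/\Lambda$ with $(\mathbb{C}^* )^n$, whose maximal compact subgroup is $(\mathbb{S}^1)^n=E/\Lambda$.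 Let $H=\{(0,\dots,0,z_{s+t+1},\dots,z_{s+2t})\}\cong\mathbb{C}^t\subset\mathbb{C}^n$; it embeds as a closed subgroup, still denoted $H$, of $(\mathbb{C}^* )^n$. Put $C_0=(\mathbb{C}^* )^n/H$. Let $\operatorname{ord}:(\mathbb{C}^* )^n\to E$ be $(z_1,\dots,z_n)\mapsto(-\ln|z_1|,\dots,-\ln|z_n|)$ (coordinates of $E$ in the basis $\mathcal{B}_K$). Let $\widetilde{H}=\operatorname{ord}(H)=\{x\in E: \text{the first } s \text{ coordinates of } x \text{ in } \mathbb{C}^n \text{ vanish}\}$, and let $\pi_{\widetilde H}:E\to E/\widetilde H\cong\mathbb{R}^s$ be the quotient map (the first $s$ coordinates). The group $W$. Fix $b\in\{1,\dots,s-1\}$ and a subgroup $W$ of $\mathcal{O}_K^{*,+}$ of rank $b$ satisfying Assumption C: for every $\eta\ne 1$ in $W$, either there is $i\le b$ with $\eta_i>\eta_j$ for every $j>b$, or there is $i\le b$ with $\eta_i<\eta_j$ for every $j>b$. $W$ acts on $\mathbb{R}^s$ by $\eta(x)=(\sigma_1(\eta)x_1,\dots,\sigma_s(\eta)x_s)$. The fan. Let $\Omega=\{x\in\mathbb{R}^s: x_1,\dots,x_b>0\}$ and $L_+=\{x\in\Omega: x_{b+1}=\dots=x_s=0\}$. Let $\Delta'$ be an infinite fan in $\mathbb{R}^s$, stable under $W$, with support $(\Omega\setminus L_+)\cup\{0\}$, all of whose cones are generated by elements of $\pi_{\widetilde H}(\Lambda)$, with $\Delta'/W$ finite, and such that the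 $W$-action on it is free ($g(\sigma)\neq\sigma$ for $g\ne1$ and $\{0\}\neq\sigma\in\Delta'$) and properly discontinuous (for each $\sigma\in\Delta'$ the set $\{g\in W: (g(\sigma)\cap\sigma)\setminus\{0\}\ne\emptyset\}$ is finite). Let $\Delta$ be the lift of $\Delta'$ to $E$: a $W$-stable fan in $E$, rational with respect to $\Lambda$ and nonsingular, such that $\pi_{\widetilde H}$ is injective on the support $|\Delta|$ and maps the cones of $\Delta$ bijectively onto those of $\Delta'$. The spaces. Let $X_\Delta\supset(\mathbb{C}^* )^n$ be the toric manifold of $\Delta$ (with lattice $\Lambda$). $W$ acts on $X_\Delta$ by the automorphisms induced by its action on $(\Lambda,\Delta)$. The group $H$ acts freely and properly on $X_\Delta$; put $X=X_\Delta/H$, which contains $C_0$ as a dense open subset; the $W$-action descends to $X$. The map $\operatorname{ord}$ induces $\overline{\operatorname{ord}}:C_0\to E/\widetilde H\cong\mathbb{R}^s$. Put $U_0=\overline{\operatorname{ord}}^{-1}(\Omega)\subset C_0$ and $U=(X\setminus C_0)\cup U_0$, an open $W$-stable subset of $X$ with $U\cap C_0=U_0$. $W$ acts freely and properly discontinuously on $U$, and $Y=U/W$ is a compact complex manifold of dimension $s+t$. *)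

theory Defs
  imports "HOL-Analysis.Analysis" "HOL-Library.Function_Algebras"
begin

section \<open>Complex manifolds given by charts\<close>

type_synonym ('a, 'd) chart = "'a set \<times> ('a \<Rightarrow> complex ^ 'd)"

text \<open>A complex manifold is a topology together with a set of holomorphic charts. In a chart
  \<open>(V, \<phi>)\<close> the values of \<open>\<phi>\<close> off \<open>V\<close> carry no information. All charts of one manifold have the
  same target, so the complex dimension is \<open>CARD('d)\<close>.\<close>

type_synonym ('a, 'd) cmfd = "'a topology \<times> ('a, 'd) chart set"

definition holomorphic_map :: "(complex ^ 'm \<Rightarrow> complex ^ 'd) \<Rightarrow> (complex ^ 'm) set \<Rightarrow> bool" where
  "holomorphic_map f S \<longleftrightarrow>
     (\<forall>z\<in>S. \<exists>f'. (f has_derivative f') (at z) \<and> Vector_Spaces.linear (*s) (*s) f')"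

definition holomorphic_fun :: "(complex ^ 'm \<Rightarrow> complex) \<Rightarrow> (complex ^ 'm) set \<Rightarrow> bool" where
  "holomorphic_fun f S \<longleftrightarrow>
     (\<forall>z\<in>S. \<exists>f'. (f has_derivative f') (at z) \<and> Vector_Spaces.linear (*s) (*) f')"

definition holomorphic_submersion :: "(complex ^ 'm \<Rightarrow> complex ^ 'd) \<Rightarrow> (complex ^ 'm) set \<Rightarrow> bool"
  where "holomorphic_submersion f S \<longleftrightarrow>
     holomorphic_map f S \<and> (\<forall>z\<in>S. surj (frechet_derivative f (at z)))"

definition atlas_topology :: "('a, 'd::finite) chart set \<Rightarrow> 'a topology" where
  "atlas_topology A = topology_generated_by {{p \<in> V. \<phi> p \<in> G} | V \<phi> G. (V, \<phi>) \<in> A \<and> open G}"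

definition quotient_topology :: "'a topology \<Rightarrow> ('a \<Rightarrow> 'b) \<Rightarrow> 'b topology" where
  "quotient_topology T q =
     topology (\<lambda>V. V \<subseteq> q ` topspace T \<and> openin T {p \<in> topspace T. q p \<in> V})"

lemma openin_quotient_topology:
  "openin (quotient_topology T q) V \<longleftrightarrow>
     V \<subseteq> q ` topspace T \<and> openin T {p \<in> topspace T. q p \<in> V}"
proof -
  define P where "P V = {p \<in> topspace T. q p \<in> V}" for V
  have int: "P (V \<inter> V') = P V \<inter> P V'" for V V'
    unfolding P_def by blast
  have un: "P (\<Union> \<V>) = \<Union> (P ` \<V>)" for \<V>
    unfolding P_def by blast
  have "istopology (\<lambda>V. V \<subseteq> q ` topspace T \<and> openin T (P V))"
    unfolding istopology_def
  proof (intro conjI allI impI)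
    fix V V' assume V: "V \<subseteq> q ` topspace T \<and> openin T (P V)"
      and V': "V' \<subseteq> q ` topspace T \<and> openin T (P V')"
    show "V \<inter> V' \<subseteq> q ` topspace T" using V by (meson le_infI1)
    show "openin T (P (V \<inter> V'))"
      unfolding int by (rule openin_Int) (use V V' in simp_all)
  next
    fix \<V> assume \<V>: "\<forall>V\<in>\<V>. V \<subseteq> q ` topspace T \<and> openin T (P V)"
    show "\<Union> \<V> \<subseteq> q ` topspace T" by (rule Union_least) (use \<V> in simp)
    show "openin T (P (\<Union> \<V>))"
      unfolding un by (rule openin_Union) (use \<V> in auto)
  qed
  then show ?thesis
    unfolding quotient_topology_def P_def by (subst topology_inverse') simp_all
qed

text \<open>The complex structure on the image of \<open>q\<close> is the maximal one for which \<open>q\<close> is a holomorphic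
  submersion: a chart is a homeomorphism \<open>\<phi>\<close> from an open set of the quotient onto an open set of
  \<open>\<complex>\<^sup>d\<close> such that \<open>\<phi> \<circ> q\<close> is a holomorphic submersion. When source and target have the same
  dimension this says that \<open>\<phi> \<circ> q\<close> is locally biholomorphic. For orbit maps of free and proper
  holomorphic actions such charts cover the quotient.\<close>

definition quotient_cmfd :: "('a, 'e::finite) cmfd \<Rightarrow> ('a \<Rightarrow> 'b) \<Rightarrow> ('b, 'd::finite) cmfd" where
  "quotient_cmfd M q =
     (quotient_topology (fst M) q,
      {(V, \<phi>). openin (quotient_topology (fst M) q) V \<and> open (\<phi> ` V) \<and>
         homeomorphic_map (subtopology (quotient_topology (fst M) q) V) (top_of_set (\<phi> ` V)) \<phi> \<and>
         (\<forall>(P, \<psi>) \<in> snd M.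
            holomorphic_submersion (\<phi> \<circ> q \<circ> inv_into P \<psi>)
              (\<psi> ` (P \<inter> {p \<in> topspace (fst M). q p \<in> V})))})"

definition open_subcmfd :: "('a, 'd::finite) cmfd \<Rightarrow> 'a set \<Rightarrow> ('a, 'd::finite) cmfd" where
  "open_subcmfd M U =
     (subtopology (fst M) U, (\<lambda>(V, \<phi>). (V \<inter> U, \<phi>)) ` snd M)"

section \<open>Kodaira dimension\<close>

text \<open>A section \<open>\<omega>\<close> of the \<open>m\<close>-th power of the canonical bundle is given by its local coefficients:
  on a chart \<open>c = (V, \<phi>)\<close> it is \<open>s c \<cdot> (d\<phi>\<^sub>1 \<and> \<dots> \<and> d\<phi>\<^sub>d)\<^sup>m\<close>. Coefficients are extended by zero off \<open>V\<close>
  so that distinct families are distinct sections.\<close>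

definition pluricanonical_sections ::
  "('a, 'd::finite) cmfd \<Rightarrow> nat \<Rightarrow> (('a, 'd::finite) chart \<Rightarrow> 'a \<Rightarrow> complex) set" where
  "pluricanonical_sections M m =
     {s. (\<forall>c p. c \<notin> snd M \<or> p \<notin> fst c \<longrightarrow> s c p = 0) \<and>
         (\<forall>(V, \<phi>) \<in> snd M. holomorphic_fun (s (V, \<phi>) \<circ> inv_into V \<phi>) (\<phi> ` V)) \<and>
         (\<forall>(V, \<phi>) \<in> snd M. \<forall>(V', \<phi>') \<in> snd M. \<forall>p \<in> V \<inter> V'.
            s (V, \<phi>) p = s (V', \<phi>') p *
              det (matrix (frechet_derivative (\<phi>' \<circ> inv_into V \<phi>) (at (\<phi> p)))) ^ m)}"

text \<open>The dimension of the space of \<open>m\<close>-canonical sections, as an extended natural number because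
  \<open>vector_space.dim\<close> is \<open>0\<close> on infinite-dimensional spaces.\<close>

definition plurigenus :: "('a, 'd::finite) cmfd \<Rightarrow> nat \<Rightarrow> enat" where
  "plurigenus M m =
     (SUP B \<in> {B. finite B \<and> B \<subseteq> pluricanonical_sections M m \<and>
                 \<not> module.dependent (\<lambda>(a::complex) s c p. a * s c p) B}. enat (card B))"

definition kodaira_dimension :: "('a, 'd::finite) cmfd \<Rightarrow> ereal" where
  "kodaira_dimension M =
     (if \<forall>m>0. plurigenus M m = 0 then - \<infinity>
      else Inf {ereal (real k) | k. \<exists>C::nat. \<forall>m>0. plurigenus M m \<le> enat (C * m ^ k)})"

section \<open>Lattices and fans\<close>

definition zbasis :: "('i::finite \<Rightarrow> 'v::real_vector) \<Rightarrow> 'v set \<Rightarrow> bool" where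
  "zbasis v L \<longleftrightarrow> bij_betw (\<lambda>k::'i \<Rightarrow> int. \<Sum>i\<in>UNIV. of_int (k i) *\<^sub>R v i) UNIV L"

text \<open>Fans may be infinite. Nonempty convex faces of a polyhedral cone are the same as its faces
  cut out by supporting linear forms.\<close>

definition is_fan :: "'v::euclidean_space set set \<Rightarrow> bool" where
  "is_fan F \<longleftrightarrow>
     (\<forall>\<sigma>\<in>F. (\<exists>S. finite S \<and> \<sigma> = convex_cone hull S) \<and> \<sigma> \<inter> uminus ` \<sigma> = {0}) \<and>
     (\<forall>\<sigma>\<in>F. \<forall>\<tau>. \<tau> face_of \<sigma> \<and> \<tau> \<noteq> {} \<longrightarrow> \<tau> \<in> F) \<and>
     (\<forall>\<sigma>\<in>F. \<forall>\<tau>\<in>F. (\<sigma> \<inter> \<tau>) face_of \<sigma> \<and> (\<sigma> \<inter> \<tau>) face_of \<tau>)"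

definition cones_generated_by :: "'v::euclidean_space set set \<Rightarrow> 'v set \<Rightarrow> bool" where
  "cones_generated_by F L \<longleftrightarrow> (\<forall>\<sigma>\<in>F. \<exists>S. finite S \<and> S \<subseteq> L \<and> \<sigma> = convex_cone hull S)"

definition nonsingular_fan :: "'i::finite itself \<Rightarrow> 'v::euclidean_space set set \<Rightarrow> 'v set \<Rightarrow> bool" where
  "nonsingular_fan _ F L \<longleftrightarrow>
     (\<forall>\<sigma>\<in>F. \<exists>(v :: 'i \<Rightarrow> 'v) J. zbasis v L \<and> \<sigma> = convex_cone hull (v ` J))"

section \<open>The toric manifold of a nonsingular fan in \<open>\<real>\<^sup>n\<close> with lattice \<open>\<int>\<^sup>n\<close>\<close>

definition int_lattice :: "(real ^ 'n) set" where
  "int_lattice = {v. \<forall>i. v $ i \<in> \<int>}"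

definition orth_chars :: "(real ^ 'n) set \<Rightarrow> (real ^ 'n) set" where
  "orth_chars \<tau> = {m \<in> int_lattice. \<forall>v\<in>\<tau>. m \<bullet> v = 0}"

text \<open>The manifold is the disjoint union of the torus orbits \<open>Hom (\<tau>\<^sup>\<bottom> \<inter> \<int>\<^sup>n, \<complex>\<^sup>*)\<close>, \<open>\<tau>\<close> a cone of the
  fan. A point \<open>(\<tau>, x)\<close> stands for the monoid homomorphism that equals \<open>x\<close> on the face
  \<open>\<tau>\<^sup>\<bottom> \<inter> \<int>\<^sup>n\<close> of \<open>\<tau>\<^sup>\<or> \<inter> \<int>\<^sup>n\<close> and vanishes on the rest of it. The affine piece
  \<open>Hom (\<sigma>\<^sup>\<or> \<inter> \<int>\<^sup>n, \<complex>)\<close> of a cone \<open>\<sigma>\<close> consists of the points \<open>(\<tau>, x)\<close> with \<open>\<tau>\<close> a face of \<open>\<sigma>\<close>.\<close>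

type_synonym 'n tpoint = "(real ^ 'n) set \<times> (real ^ 'n \<Rightarrow> complex)"

definition toric_points :: "(real ^ 'n) set set \<Rightarrow> 'n::finite tpoint set" where
  "toric_points F =
     {(\<tau>, x). \<tau> \<in> F \<and> (\<forall>m. x m \<noteq> 0 \<longleftrightarrow> m \<in> orth_chars \<tau>) \<and>
        (\<forall>m \<in> orth_chars \<tau>. \<forall>m' \<in> orth_chars \<tau>. x (m + m') = x m * x m')}"

text \<open>If \<open>\<sigma>\<close> is generated by part of the \<open>\<int>\<close>-basis \<open>v\<close>, with dual basis \<open>m\<close>, the characters \<open>m j\<close> are
  coordinates on the affine piece of \<open>\<sigma>\<close>, with image
  \<open>{z. \<forall>j. j \<notin> J \<longrightarrow> z\<^sub>j \<noteq> 0}\<close>. The extension of \<open>x\<close> by zero makes this formula valid on all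
  orbits of the piece.\<close>

definition toric_charts :: "(real ^ 'n) set set \<Rightarrow> ('n tpoint, 'n) chart set" where
  "toric_charts F =
     {({p \<in> toric_points F. fst p face_of \<sigma>}, \<lambda>p. \<chi> j. snd p (m j)) | \<sigma> v m J.
        \<sigma> \<in> F \<and> zbasis v int_lattice \<and> \<sigma> = convex_cone hull (v ` J) \<and>
        range m \<subseteq> int_lattice \<and> (\<forall>i j. m j \<bullet> v i = (if i = j then 1 else 0))}"

definition toric_manifold :: "(real ^ 'n) set set \<Rightarrow> ('n tpoint, 'n) cmfd" where
  "toric_manifold F = (atlas_topology (toric_charts F), toric_charts F)"

definition monomial :: "complex ^ 'n \<Rightarrow> real ^ 'n \<Rightarrow> complex" where
  "monomial z m = (\<Prod>j\<in>UNIV. z $ j powi \<lfloor>m $ j\<rfloor>)"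

definition ctorus :: "(complex ^ 'n) set" where
  "ctorus = {z. \<forall>j. z $ j \<noteq> 0}"

definition torus_point :: "complex ^ 'n \<Rightarrow> 'n tpoint" where
  "torus_point z = ({0}, \<lambda>m. if m \<in> int_lattice then monomial z m else 0)"

definition torus_act :: "complex ^ 'n \<Rightarrow> 'n tpoint \<Rightarrow> 'n tpoint" where
  "torus_act z = (\<lambda>(\<tau>, x). (\<tau>, \<lambda>m. monomial z m * x m))"

text \<open>The automorphism induced by a lattice automorphism \<open>A \<in> GL\<^sub>n(\<int>)\<close> preserving the fan; on the
  torus it is \<open>z\<^sub>i \<mapsto> \<Prod>\<^sub>j z\<^sub>j ^ A\<^sub>i\<^sub>j\<close>.\<close>

definition toric_map :: "real ^ 'n ^ 'n \<Rightarrow> 'n tpoint \<Rightarrow> 'n tpoint" where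
  "toric_map A = (\<lambda>(\<tau>, x). ((*v) A ` \<tau>, \<lambda>m. x (transpose A *v m)))"

section \<open>Number fields and units\<close>

definition number_field :: "'k::field_char_0 itself \<Rightarrow> bool" where
  "number_field _ \<longleftrightarrow> (\<exists>S :: 'k set. finite S \<and> module.span (\<lambda>(q::rat) x. of_rat q * x) S = UNIV)"

definition field_embedding :: "('k::field_char_0 \<Rightarrow> complex) \<Rightarrow> bool" where
  "field_embedding f \<longleftrightarrow>
     f 1 = 1 \<and> (\<forall>x y. f (x + y) = f x + f y) \<and> (\<forall>x y. f (x * y) = f x * f y)"

text \<open>The index type is \<open>'r + 'c + 'c\<close> with \<open>CARD('r) = s\<close> and \<open>CARD('c) = t\<close>: \<open>Inl i\<close> are the real
  embeddings \<open>\<sigma>\<^sub>1, \<dots>, \<sigma>\<^sub>s\<close>, \<open>Inr (Inl k)\<close> are \<open>\<sigma>\<^sub>s\<^sub>+\<^sub>1, \<dots>, \<sigma>\<^sub>s\<^sub>+\<^sub>t\<close>, and \<open>Inr (Inr k)\<close> their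
  conjugates. In particular \<open>s, t > 0\<close>, and \<open>s + 2t\<close> is the number of embeddings, i.e. the degree.\<close>

definition embedding_enumeration :: "('r + 'c + 'c \<Rightarrow> 'k::field_char_0 \<Rightarrow> complex) \<Rightarrow> bool" where
  "embedding_enumeration \<sigma> \<longleftrightarrow>
     bij_betw \<sigma> UNIV {f. field_embedding f} \<and>
     (\<forall>i. range (\<sigma> (Inl i)) \<subseteq> \<real>) \<and> (\<forall>k. \<not> range (\<sigma> (Inr k)) \<subseteq> \<real>) \<and>
     (\<forall>k x. \<sigma> (Inr (Inl k)) x = cnj (\<sigma> (Inr (Inr k)) x))"

text \<open>Position in \<open>{1, \<dots>, s + t}\<close>.\<close>

fun emb_index :: "'r::{finite,linorder} + 'c::{finite,linorder} \<Rightarrow> nat" where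
  "emb_index (Inl i) = card {..i}"
| "emb_index (Inr k) = CARD('r) + card {..k}"

definition ring_of_integers :: "'k::field_char_0 set" where
  "ring_of_integers = {x. algebraic_int x}"

definition positive_units :: "('r + 'c + 'c \<Rightarrow> 'k::field_char_0 \<Rightarrow> complex) \<Rightarrow> 'k set" where
  "positive_units \<sigma> =
     {u \<in> ring_of_integers. (\<exists>w \<in> ring_of_integers. u * w = 1) \<and> (\<forall>i. Re (\<sigma> (Inl i) u) > 0)}"

definition unit_size :: "('r + 'c + 'c \<Rightarrow> 'k \<Rightarrow> complex) \<Rightarrow> 'k \<Rightarrow> 'r + 'c \<Rightarrow> real" where
  "unit_size \<sigma> u j =
     (case j of Inl i \<Rightarrow> Re (\<sigma> (Inl i) u) | Inr k \<Rightarrow> cmod (\<sigma> (Inr (Inl k)) u))"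

definition mult_subgroup :: "'k::field set \<Rightarrow> 'k set \<Rightarrow> bool" where
  "mult_subgroup W G \<longleftrightarrow>
     W \<subseteq> G \<and> 1 \<in> W \<and> (\<forall>u\<in>W. \<forall>w\<in>W. u * w \<in> W) \<and> (\<forall>u\<in>W. inverse u \<in> W)"

definition mult_rank :: "'k::field set \<Rightarrow> enat" where
  "mult_rank W =
     (SUP S \<in> {S. finite S \<and> S \<subseteq> W \<and>
                 (\<forall>k::'k \<Rightarrow> int. (\<Prod>u\<in>S. u powi k u) = 1 \<longrightarrow> (\<forall>u\<in>S. k u = 0))}. enat (card S))"

definition assumption_C ::
  "('r::{finite,linorder} + 'c::{finite,linorder} + 'c \<Rightarrow> 'k::field \<Rightarrow> complex) \<Rightarrow> nat \<Rightarrow> 'k set \<Rightarrow> bool"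
  where "assumption_C \<sigma> b W \<longleftrightarrow>
     (\<forall>u\<in>W. u \<noteq> 1 \<longrightarrow>
        (\<exists>i. emb_index i \<le> b \<and> (\<forall>j. emb_index j > b \<longrightarrow> unit_size \<sigma> u i > unit_size \<sigma> u j)) \<or>
        (\<exists>i. emb_index i \<le> b \<and> (\<forall>j. emb_index j > b \<longrightarrow> unit_size \<sigma> u i < unit_size \<sigma> u j)))"

definition canonical_embedding ::
  "('r::finite + 'c::finite + 'c \<Rightarrow> 'k \<Rightarrow> complex) \<Rightarrow> 'k \<Rightarrow> complex ^ ('r + 'c + 'c)" where
  "canonical_embedding \<sigma> x = (\<chi> i. \<sigma> i x)"

definition int_ring_lattice ::
  "('r::finite + 'c::finite + 'c \<Rightarrow> 'k::field_char_0 \<Rightarrow> complex) \<Rightarrow> (complex ^ ('r + 'c + 'c)) set" where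
  "int_ring_lattice \<sigma> = canonical_embedding \<sigma> ` ring_of_integers"

definition unit_act ::
  "('r::finite + 'c::finite + 'c \<Rightarrow> 'k \<Rightarrow> complex) \<Rightarrow> 'k \<Rightarrow>
     complex ^ ('r + 'c + 'c) \<Rightarrow> complex ^ ('r + 'c + 'c)" where
  "unit_act \<sigma> u z = (\<chi> i. \<sigma> i u * z $ i)"

definition real_unit_act ::
  "('r::finite + 'c + 'c \<Rightarrow> 'k \<Rightarrow> complex) \<Rightarrow> 'k \<Rightarrow> real ^ 'r \<Rightarrow> real ^ 'r" where
  "real_unit_act \<sigma> u x = (\<chi> i. Re (\<sigma> (Inl i) u) * x $ i)"

text \<open>The quotient map \<open>E \<rightarrow> E / H\<^sup>~ \<cong> \<real>\<^sup>s\<close>; the first \<open>s\<close> coordinates of a point of \<open>E\<close> are real.\<close>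

definition proj_real :: "complex ^ ('r::finite + 'c::finite + 'c) \<Rightarrow> real ^ 'r" where
  "proj_real z = (\<chi> i. Re (z $ Inl i))"

section \<open>Fans in \<open>\<real>\<^sup>s\<close> and their lifts\<close>

definition Omega :: "'c::{finite,linorder} itself \<Rightarrow> nat \<Rightarrow> (real ^ 'r::{finite,linorder}) set" where
  "Omega _ b = {x. \<forall>i. emb_index (Inl i :: 'r + 'c) \<le> b \<longrightarrow> x $ i > 0}"

definition L_plus :: "'c::{finite,linorder} itself \<Rightarrow> nat \<Rightarrow> (real ^ 'r::{finite,linorder}) set" where
  "L_plus c b = {x \<in> Omega c b. \<forall>i. emb_index (Inl i :: 'r + 'c) > b \<longrightarrow> x $ i = 0}"

definition fan_stable :: "('k \<Rightarrow> 'v \<Rightarrow> 'v) \<Rightarrow> 'k set \<Rightarrow> 'v set set \<Rightarrow> bool" where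
  "fan_stable act W F \<longleftrightarrow> (\<forall>u\<in>W. \<forall>\<sigma>\<in>F. act u ` \<sigma> \<in> F)"

definition fan_cofinite :: "('k \<Rightarrow> 'v \<Rightarrow> 'v) \<Rightarrow> 'k set \<Rightarrow> 'v set set \<Rightarrow> bool" where
  "fan_cofinite act W F \<longleftrightarrow> finite ((\<lambda>\<sigma>. {act u ` \<sigma> | u. u \<in> W}) ` F)"

definition fan_action_free :: "('k::one \<Rightarrow> 'v::zero \<Rightarrow> 'v) \<Rightarrow> 'k set \<Rightarrow> 'v set set \<Rightarrow> bool" where
  "fan_action_free act W F \<longleftrightarrow> (\<forall>u\<in>W. \<forall>\<sigma>\<in>F. u \<noteq> 1 \<and> \<sigma> \<noteq> {0} \<longrightarrow> act u ` \<sigma> \<noteq> \<sigma>)"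

definition fan_action_properly_discontinuous ::
  "('k \<Rightarrow> 'v::zero \<Rightarrow> 'v) \<Rightarrow> 'k set \<Rightarrow> 'v set set \<Rightarrow> bool" where
  "fan_action_properly_discontinuous act W F \<longleftrightarrow>
     (\<forall>\<sigma>\<in>F. finite {u \<in> W. (act u ` \<sigma> \<inter> \<sigma>) - {0} \<noteq> {}})"

definition base_fan ::
  "('r::{finite,linorder} + 'c::{finite,linorder} + 'c \<Rightarrow> 'k::field_char_0 \<Rightarrow> complex) \<Rightarrow>
     nat \<Rightarrow> 'k set \<Rightarrow> (real ^ 'r::{finite,linorder}) set set \<Rightarrow> bool" where
  "base_fan \<sigma> b W F' \<longleftrightarrow>
     is_fan F' \<and> infinite F' \<and>
     fan_stable (real_unit_act \<sigma>) W F' \<and>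
     \<Union> F' = (Omega TYPE('c) b - L_plus TYPE('c) b) \<union> {0} \<and>
     cones_generated_by F' (proj_real ` int_ring_lattice \<sigma>) \<and>
     fan_cofinite (real_unit_act \<sigma>) W F' \<and>
     fan_action_free (real_unit_act \<sigma>) W F' \<and>
     fan_action_properly_discontinuous (real_unit_act \<sigma>) W F'"

definition lifted_fan ::
  "('r::finite + 'c::finite + 'c \<Rightarrow> 'k::field_char_0 \<Rightarrow> complex) \<Rightarrow> 'k set \<Rightarrow>
     (real ^ 'r) set set \<Rightarrow> (complex ^ ('r + 'c + 'c)) set set \<Rightarrow> bool" where
  "lifted_fan \<sigma> W F' F \<longleftrightarrow>
     is_fan F \<and> (\<forall>\<rho>\<in>F. \<rho> \<subseteq> span (int_ring_lattice \<sigma>)) \<and>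
     fan_stable (unit_act \<sigma>) W F \<and>
     cones_generated_by F (int_ring_lattice \<sigma>) \<and>
     nonsingular_fan TYPE('r + 'c + 'c) F (int_ring_lattice \<sigma>) \<and>
     inj_on proj_real (\<Union> F) \<and>
     bij_betw (image proj_real) F F'"

section \<open>The manifolds \<open>X\<close>, \<open>U\<close> and \<open>Y\<close>\<close>

text \<open>Below, \<open>\<beta>\<close> is a \<open>\<int>\<close>-basis of the lattice; it is also a \<open>\<complex>\<close>-basis of \<open>\<complex>\<^sup>n\<close>.\<close>

definition basis_coords :: "('n::finite \<Rightarrow> complex ^ 'n) \<Rightarrow> complex ^ 'n \<Rightarrow> complex ^ 'n" where
  "basis_coords \<beta> z = (THE c. z = (\<Sum>j\<in>UNIV. c $ j *s \<beta> j))"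

text \<open>Coordinates of points of \<open>E\<close>, identifying \<open>(E, \<Lambda>)\<close> with \<open>(\<real>\<^sup>n, \<int>\<^sup>n)\<close>.\<close>

definition real_coords :: "('n::finite \<Rightarrow> complex ^ 'n) \<Rightarrow> complex ^ 'n \<Rightarrow> real ^ 'n" where
  "real_coords \<beta> z = (\<chi> j. Re (basis_coords \<beta> z $ j))"

definition torus_exp :: "('n::finite \<Rightarrow> complex ^ 'n) \<Rightarrow> complex ^ 'n \<Rightarrow> complex ^ 'n" where
  "torus_exp \<beta> z = (\<chi> j. exp (2 * \<i> * complex_of_real pi * basis_coords \<beta> z $ j))"

definition torus_ord :: "('n::finite \<Rightarrow> complex ^ 'n) \<Rightarrow> complex ^ 'n \<Rightarrow> complex ^ 'n" where
  "torus_ord \<beta> z = (\<Sum>j\<in>UNIV. (- ln (cmod (z $ j))) *\<^sub>R \<beta> j)"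

definition unit_matrix ::
  "('r::finite + 'c::finite + 'c \<Rightarrow> 'k \<Rightarrow> complex) \<Rightarrow>
     ('r + 'c + 'c \<Rightarrow> complex ^ ('r + 'c + 'c)) \<Rightarrow> 'k \<Rightarrow> real ^ ('r + 'c + 'c) ^ ('r + 'c + 'c)" where
  "unit_matrix \<sigma> \<beta> u =
     matrix (\<lambda>x. real_coords \<beta> (unit_act \<sigma> u (\<Sum>j\<in>UNIV. x $ j *\<^sub>R \<beta> j)))"

definition H_space :: "(complex ^ ('r::finite + 'c::finite + 'c)) set" where
  "H_space = {z. (\<forall>i. z $ Inl i = 0) \<and> (\<forall>k. z $ Inr (Inl k) = 0)}"

definition H_orbit ::
  "('r::finite + 'c::finite + 'c \<Rightarrow> complex ^ ('r + 'c + 'c)) \<Rightarrow>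
     ('r + 'c + 'c) tpoint \<Rightarrow> ('r + 'c + 'c) tpoint set" where
  "H_orbit \<beta> p = {torus_act (torus_exp \<beta> h) p | h. h \<in> H_space}"

definition X_Delta ::
  "('r::finite + 'c::finite + 'c \<Rightarrow> complex ^ ('r + 'c + 'c)) \<Rightarrow>
     (complex ^ ('r + 'c + 'c)) set set \<Rightarrow> (('r + 'c + 'c) tpoint, 'r + 'c + 'c) cmfd" where
  "X_Delta \<beta> F = toric_manifold (image (real_coords \<beta>) ` F)"

definition X_quot ::
  "('r::finite + 'c::finite + 'c \<Rightarrow> complex ^ ('r + 'c + 'c)) \<Rightarrow>
     (complex ^ ('r + 'c + 'c)) set set \<Rightarrow> (('r + 'c + 'c) tpoint set, 'r + 'c) cmfd" where
  "X_quot \<beta> F = quotient_cmfd (X_Delta \<beta> F) (H_orbit \<beta>)"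

definition C0_set ::
  "('r::finite + 'c::finite + 'c \<Rightarrow> complex ^ ('r + 'c + 'c)) \<Rightarrow> ('r + 'c + 'c) tpoint set set" where
  "C0_set \<beta> = H_orbit \<beta> ` torus_point ` ctorus"

text \<open>Well defined because \<open>proj_real \<circ> torus_ord \<beta>\<close> is constant on \<open>H\<close>-orbits in the torus.\<close>

definition ord_bar ::
  "('r::finite + 'c::finite + 'c \<Rightarrow> complex ^ ('r + 'c + 'c)) \<Rightarrow>
     ('r + 'c + 'c) tpoint set \<Rightarrow> real ^ 'r" where
  "ord_bar \<beta> P =
     (THE y. \<exists>z\<in>ctorus. torus_point z \<in> P \<and> y = proj_real (torus_ord \<beta> z))"

definition U0_set ::
  "('r::{finite,linorder} + 'c::{finite,linorder} + 'c \<Rightarrow> complex ^ ('r + 'c + 'c)) \<Rightarrow> nat \<Rightarrow>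
     ('r + 'c + 'c) tpoint set set" where
  "U0_set \<beta> b = {P \<in> C0_set \<beta>. ord_bar \<beta> P \<in> Omega TYPE('c) b}"

definition U_set ::
  "('r::{finite,linorder} + 'c::{finite,linorder} + 'c \<Rightarrow> complex ^ ('r + 'c + 'c)) \<Rightarrow>
     (complex ^ ('r + 'c + 'c)) set set \<Rightarrow> nat \<Rightarrow> ('r + 'c + 'c) tpoint set set" where
  "U_set \<beta> F b = (topspace (fst (X_quot \<beta> F)) - C0_set \<beta>) \<union> U0_set \<beta> b"

definition W_orbit ::
  "('r::finite + 'c::finite + 'c \<Rightarrow> 'k \<Rightarrow> complex) \<Rightarrow>
     ('r + 'c + 'c \<Rightarrow> complex ^ ('r + 'c + 'c)) \<Rightarrow> 'k set \<Rightarrow>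
     ('r + 'c + 'c) tpoint set \<Rightarrow> ('r + 'c + 'c) tpoint set set" where
  "W_orbit \<sigma> \<beta> W P = {toric_map (unit_matrix \<sigma> \<beta> u) ` P | u. u \<in> W}"

definition Y_manifold ::
  "('r::{finite,linorder} + 'c::{finite,linorder} + 'c \<Rightarrow> 'k \<Rightarrow> complex) \<Rightarrow>
     ('r + 'c + 'c \<Rightarrow> complex ^ ('r + 'c + 'c)) \<Rightarrow>
     (complex ^ ('r + 'c + 'c)) set set \<Rightarrow> nat \<Rightarrow> 'k set \<Rightarrow>
     (('r + 'c + 'c) tpoint set set, 'r + 'c) cmfd" where
  "Y_manifold \<sigma> \<beta> F b W =
     quotient_cmfd (open_subcmfd (X_quot \<beta> F) (U_set \<beta> F b)) (W_orbit \<sigma> \<beta> W)"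

end

theory Submission
  imports Defs "HOL-Complex_Analysis.Cauchy_Integral_Formula"
begin

text \<open>On the universal cover of \<open>U\<^sub>0\<close>, an open subset of \<open>\<complex>\<^sup>s\<^sup>+\<^sup>t\<close> on which the lattice acts by translations, an
  \<open>n\<close>-canonical section is \<open>F(z) (dz\<^sub>1 \<and> \<dots> \<and> dz\<^sub>s\<^sub>+\<^sub>t)\<^sup>n\<close> with \<open>F\<close> holomorphic and periodic. Two facts make it
  vanish.

  First, \<open>F\<close> is constant (\<open>periodic_constant\<close>). Up to periods, translations by \<open>\<real>\<^sup>s \<times> \<complex>\<^sup>t\<close> move a point in a
  compact set only, so by Liouville's theorem \<open>F\<close> does not depend on the \<open>t\<close> complex coordinates; then its
  periods project to a dense subgroup of \<open>\<real>\<^sup>s\<close>.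

  Second, the invariant form \<open>dz\<^sub>1 \<and> \<dots> \<and> dz\<^sub>s\<^sub>+\<^sub>t\<close> has a pole along every boundary divisor of \<open>X\<close>: if \<open>w\<close> is a
  coordinate that vanishes on the divisor, then some \<open>dz\<^sub>i\<close> is a constant multiple of \<open>dw / w\<close>. The coefficient
  \<open>f\<close> of the section in holomorphic coordinates satisfies \<open>f w\<^sup>n = F\<close> up to a constant factor. It is bounded
  near the divisor, so for \<open>n > 0\<close> the constant \<open>F\<close> is zero (\<open>loc_coef_torus_0\<close>). As the torus is dense
  (\<open>torus_dense\<close>), the section is zero, and so are all plurigenera.

  The action of \<open>W\<close> enters through the charts of \<open>Y\<close>, which have to be constructed as they are given only by
  a maximality condition. One parametrization \<open>Psi\<close> serves the torus and one boundary divisor at the same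
  time, and it induces a chart of \<open>Y\<close> on every open set over \<open>U\<close> on which the induced map to \<open>Y\<close> is
  injective (\<open>parametrization_chart\<close>). Injectivity comes from the discreteness of the lattice (\<open>Psi_inj\<close>) and from sets
  in \<open>\<real>\<^sup>s\<close> that all units of \<open>W\<close> but \<open>1\<close> move off themselves. Around a point of \<open>\<Omega>\<close> they exist by Assumption C, since only finitely many algebraic integers have bounded
  embeddings (\<open>wandering_neighbourhood\<close>). For a point of the boundary, the interior of a full-dimensional cone is
  such a set (\<open>Delta'_interior_wandering\<close>), and the fan has full-dimensional cones because it is countable and
  covers an open set (\<open>big_cone\<close>).

  The arithmetic behind this is that a lattice basis is a basis of \<open>\<complex>\<^sup>n\<close> (\<open>invertible_base_change\<close>), that
  algebraic integers of the number field are closed under multiplication, so that units act on the lattice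
  (\<open>algebraic_int_mult_of_zbasis\<close>), and that there are nonzero algebraic integers all of whose real embeddings are
  arbitrarily small (\<open>small_integer\<close>).\<close>

section \<open>Algebraic integers\<close>

definition integral_poly :: "'a::field poly \<Rightarrow> bool" where
  "integral_poly p \<longleftrightarrow> (\<forall>i. coeff p i \<in> \<int>)"

lemma integral_poly_arith:
  assumes "integral_poly p" "integral_poly q"
  shows "integral_poly (p + q)" "integral_poly (p - q)" "integral_poly (- p)"
    "integral_poly (p * q)"
  using assms by (auto simp: integral_poly_def coeff_mult)

lemma integral_poly_simps [simp]:
  "integral_poly (pCons a p) \<longleftrightarrow> a \<in> \<int> \<and> integral_poly p"
  "integral_poly 0" "integral_poly (monom 1 n)"
  by (auto simp: integral_poly_def coeff_pCons split: nat.splits)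

lemma integral_poly_pcompose:
  "integral_poly p \<Longrightarrow> integral_poly q \<Longrightarrow> integral_poly (pcompose p q)"
  by (induction p) (auto simp: pcompose_pCons intro!: integral_poly_arith)

lemma algebraic_int_iff_integral_poly:
  "algebraic_int x \<longleftrightarrow> (\<exists>p. lead_coeff p = 1 \<and> integral_poly p \<and> poly p x = 0)"
  by (auto simp: algebraic_int.simps integral_poly_def)

lemma even_odd_parts:
  fixes p :: "'a::field poly"
  assumes "integral_poly p"
  shows "\<exists>e d. integral_poly e \<and> integral_poly d \<and>
           p = pcompose e (monom 1 2) + [:0, 1:] * pcompose d (monom 1 2)"
  using assms
proof (induction p)
  case 0
  show ?case by (rule exI[of _ 0], rule exI[of _ 0]) simp
next
  case (pCons a p)
  then obtain e d where "integral_poly e" "integral_poly d"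
    "p = pcompose e (monom 1 2) + [:0, 1:] * pcompose d (monom 1 2)" by auto
  moreover have "monom 1 2 = [:0, 1:] * [:0, 1 :: 'a:]"
    by (simp add: numeral_2_eq_2 monom_Suc)
  ultimately show ?case using pCons.prems
    by (intro exI[of _ "pCons a d"] exI[of _ e])
       (auto simp: pcompose_pCons algebra_simps pCons_one)
qed

text \<open>If \<open>p = e(X\<^sup>2) + X d(X\<^sup>2)\<close> vanishes at \<open>x\<close>, then \<open>e\<^sup>2 - X d\<^sup>2\<close> vanishes at \<open>x\<^sup>2\<close>. The degrees of
  \<open>e\<^sup>2\<close> and \<open>X d\<^sup>2\<close> have different parity, so the leading coefficient is, up to sign, the one of \<open>p\<close>.\<close>

lemma algebraic_int_square:
  fixes x :: "'a::field"
  assumes "algebraic_int x"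
  shows "algebraic_int (x ^ 2)"
proof -
  obtain p where p: "lead_coeff p = 1" "integral_poly p" "poly p x = 0"
    using assms by (auto simp: algebraic_int_iff_integral_poly)
  obtain e d where ed: "integral_poly e" "integral_poly d"
    "p = pcompose e (monom 1 2) + [:0, 1:] * pcompose d (monom 1 2)"
    using even_odd_parts[OF p(2)] by blast
  define E D where "E = pcompose e (monom 1 2)" and "D = [:0, 1:] * pcompose d (monom 1 2)"
  have pED: "p = E + D" using ed(3) by (simp add: E_def D_def)
  have degm: "degree (monom (1::'a) 2) = 2" by (simp add: degree_monom_eq)
  have E: "degree E = 2 * degree e" "lead_coeff E = lead_coeff e"
    unfolding E_def using degm lead_coeff_comp[of "monom 1 2" e] by (simp_all add: degree_pcompose)
  have dz: "pcompose d (monom 1 2) = 0 \<longleftrightarrow> d = 0"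
    using degm by (simp add: pcompose_eq_0_iff)
  have D: "d \<noteq> 0 \<Longrightarrow> degree D = 2 * degree d + 1" "lead_coeff D = lead_coeff d"
    unfolding D_def using degm dz lead_coeff_comp[of "monom 1 2" d] by (auto simp: degree_mult_eq degree_pcompose lead_coeff_mult lead_coeff_comp)
  define r where "r = e * e - [:0, 1:] * (d * d)"
  have X: "degree ([:0, 1:] * (d * d)) = 2 * degree d + 1" if "d \<noteq> 0"
    using that by (simp add: degree_mult_eq)
  have e2: "degree (e * e) = 2 * degree e"
    by (cases "e = 0") (simp_all add: degree_mult_eq)
  have rx: "poly r (x ^ 2) = 0"
  proof -
    have "poly e (x ^ 2) + x * poly d (x ^ 2) = 0"
      using p(3) ed(3) by (simp add: poly_pcompose poly_monom)
    then have "poly e (x ^ 2) = - (x * poly d (x ^ 2))" by (simp add: add_eq_0_iff)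
    then show ?thesis by (simp add: r_def power2_eq_square algebra_simps)
  qed
  have ir: "integral_poly r" "integral_poly (- r)"
    unfolding r_def using ed by (auto intro!: integral_poly_arith)
  show ?thesis
  proof (cases "d = 0 \<or> degree D < degree E")
    case True
    have "lead_coeff r = lead_coeff (e * e)"
    proof (cases "d = 0")
      case False
      then have "degree ([:0, 1:] * (d * d)) < degree (e * e)"
        using True E D X e2 by auto
      then have "lead_coeff (- ([:0, 1:] * (d * d)) + e * e) = lead_coeff (e * e)"
        by (intro lead_coeff_add_le) (simp only: degree_minus)
      moreover have "r = - ([:0, 1:] * (d * d)) + e * e" by (simp add: r_def)
      ultimately show ?thesis by simp
    qed (simp add: r_def)
    moreover have "lead_coeff p = lead_coeff e"
    proof (cases "d = 0")
      case False
      then have "lead_coeff (D + E) = lead_coeff E"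
        using True by (intro lead_coeff_add_le) simp
      then show ?thesis unfolding pED E(2)[symmetric] by (simp only: add.commute)
    qed (simp only: pED E(2)[symmetric] D_def pcompose_0 mult_zero_right add_0_right)
    ultimately have "lead_coeff r = 1" using p(1) by (simp add: lead_coeff_mult)
    then show ?thesis using rx ir by (auto simp: algebraic_int_iff_integral_poly)
  next
    case False
    then have d: "d \<noteq> 0" and lt: "degree E < degree D"
      using E D by (auto simp: not_less) presburger
    have "lead_coeff p = lead_coeff d"
      using lt D(2) pED lead_coeff_add_le[of E D] by (simp only:)
    moreover have "lead_coeff (- r) = lead_coeff ([:0, 1:] * (d * d))"
    proof -
      have "degree (e * e) < degree ([:0, 1:] * (d * d))"
        using lt E D X e2 d by auto
      moreover have "- r = [:0, 1:] * (d * d) + - (e * e)" by (simp add: r_def)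
      moreover have "lead_coeff (- (e * e) + [:0, 1:] * (d * d)) = lead_coeff ([:0, 1:] * (d * d))"
        using calculation(1) by (intro lead_coeff_add_le) (simp only: degree_minus)
      ultimately show ?thesis by (simp only: add.commute)
    qed
    ultimately have "lead_coeff (- r) = 1" using p(1) d by (simp add: lead_coeff_mult)
    moreover have "poly (- r) (x ^ 2) = 0" using rx by simp
    ultimately show ?thesis using ir(2) unfolding algebraic_int_iff_integral_poly by blast
  qed
qed

lemma algebraic_int_power2_power:
  fixes x :: "'a::field"
  shows "algebraic_int x \<Longrightarrow> algebraic_int (x ^ (2 ^ n))"
  by (induction n) (auto simp: power_mult[symmetric] mult.commute dest: algebraic_int_square)

lemma zbasisD:
  assumes "zbasis v L"
  shows "(\<Sum>i\<in>UNIV. of_int (k i) *\<^sub>R v i) \<in> L"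
    and "x \<in> L \<Longrightarrow> \<exists>k. x = (\<Sum>i\<in>UNIV. of_int (k i) *\<^sub>R v i)"
    and "(\<Sum>i\<in>UNIV. of_int (k i) *\<^sub>R v i) = (\<Sum>i\<in>UNIV. of_int (k' i) *\<^sub>R v i) \<Longrightarrow> k = k'"
  using assms unfolding zbasis_def bij_betw_def by (auto dest: injD)

lemma zbasis_add:
  assumes "zbasis v L" "x \<in> L" "y \<in> L" shows "x + y \<in> L"
proof -
  obtain k k' where "x = (\<Sum>i\<in>UNIV. of_int (k i) *\<^sub>R v i)" "y = (\<Sum>i\<in>UNIV. of_int (k' i) *\<^sub>R v i)"
    using zbasisD(2)[OF assms(1)] assms(2,3) by meson
  then have "x + y = (\<Sum>i\<in>UNIV. of_int (k i + k' i) *\<^sub>R v i)"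
    by (simp add: sum.distrib scaleR_add_left)
  then show ?thesis using zbasisD(1)[OF assms(1)] by metis
qed

lemma zbasis_diff:
  assumes "zbasis v L" "x \<in> L" "y \<in> L" shows "x - y \<in> L"
proof -
  obtain k k' where "x = (\<Sum>i\<in>UNIV. of_int (k i) *\<^sub>R v i)" "y = (\<Sum>i\<in>UNIV. of_int (k' i) *\<^sub>R v i)"
    using zbasisD(2)[OF assms(1)] assms(2,3) by meson
  then have "x - y = (\<Sum>i\<in>UNIV. of_int (k i - k' i) *\<^sub>R v i)"
    by (simp add: sum_subtractf scaleR_diff_left)
  then show ?thesis using zbasisD(1)[OF assms(1)] by metis
qed

text \<open>Because \<open>2ab = (a + b)\<^sup>2 - a\<^sup>2 - b\<^sup>2\<close>, sums and squares give \<open>2xy\<close> at once. To remove the factor, apply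
  this to \<open>x\<close> and \<open>y\<close> raised to the power \<open>2\<^sup>n\<close>: all numbers \<open>t ^ 2 ^ n\<close> with \<open>t = xy\<close> lie in one half of
  the ring of integers. As this ring is finitely generated, two of them differ by some algebraic
  integer \<open>s\<close>, and \<open>t\<close> is a root of the monic polynomial \<open>p(X ^ 2 ^ b - X ^ 2 ^ a)\<close> if \<open>p(s) = 0\<close>.\<close>

lemma algebraic_int_mult_of_zbasis:
  fixes f :: "'k::field_char_0 \<Rightarrow> 'v::real_vector" and v :: "'i::finite \<Rightarrow> 'v" and x y :: 'k
  assumes zb: "zbasis v (f ` ring_of_integers)" and inj: "inj f"
    and add: "\<And>x y. f (x + y) = f x + f y"
    and x: "algebraic_int x" and y: "algebraic_int y"
  shows "algebraic_int (x * y)"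
proof -
  have f0: "f 0 = 0" using add[of 0 0] by simp
  have diff: "f (a - b) = f a - f b" for a b using add[of "a - b" b] by simp
  have im: "f a \<in> f ` ring_of_integers \<longleftrightarrow> algebraic_int a" for a
    using inj by (auto simp: ring_of_integers_def dest: injD)
  have plus: "algebraic_int (a + b)" if "algebraic_int a" "algebraic_int b" for a b :: 'k
    using zbasis_add[OF zb, of "f a" "f b"] that by (simp add: im add[symmetric])
  have minus: "algebraic_int (a - b)" if "algebraic_int a" "algebraic_int b" for a b :: 'k
    using zbasis_diff[OF zb, of "f a" "f b"] that by (simp add: im diff[symmetric])
  define t where "t = x * y"
  have half: "algebraic_int (2 * t ^ (2 ^ n))" for n
  proof -
    let ?a = "x ^ (2 ^ n)" and ?b = "y ^ (2 ^ n)"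
    have a: "algebraic_int ?a" and b: "algebraic_int ?b"
      using x y by (auto intro: algebraic_int_power2_power)
    have "algebraic_int ((?a + ?b) ^ 2 - ?a ^ 2 - ?b ^ 2)"
      by (intro minus plus algebraic_int_square a b)
    also have "(?a + ?b) ^ 2 - ?a ^ 2 - ?b ^ 2 = 2 * t ^ (2 ^ n)"
      by (simp add: t_def power2_eq_square algebra_simps power_mult_distrib)
    finally show ?thesis .
  qed
  have "\<exists>k. f (2 * t ^ (2 ^ n)) = (\<Sum>i\<in>UNIV. of_int (k i) *\<^sub>R v i)" for n
    using zbasisD(2)[OF zb] half im by blast
  then obtain k where k: "\<And>n. f (2 * t ^ (2 ^ n)) = (\<Sum>i\<in>UNIV. of_int (k n i) *\<^sub>R v i)" by metis
  \<comment> \<open>Two of the numbers \<open>t ^ 2 ^ n\<close> agree modulo the ring of integers, because all of them lie in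
    one half of it.\<close>
  have "\<not> inj (\<lambda>n::nat. \<lambda>i. even (k n i))"
  proof
    assume "inj (\<lambda>n::nat. \<lambda>i. even (k n i))"
    moreover have "finite (UNIV :: ('i \<Rightarrow> bool) set)" by simp
    ultimately show False
      by (metis finite_imageD finite_subset infinite_UNIV_nat subset_UNIV)
  qed
  then obtain a b where ab: "a < b" "\<And>i. even (k a i) = even (k b i)"
    by (auto simp: inj_def fun_eq_iff) (metis linorder_neqE_nat)
  define q where "q = (\<lambda>i. (k b i - k a i) div 2)"
  have q: "k b i - k a i = 2 * q i" for i
    unfolding q_def using ab(2)[of i] by simp
  obtain s where s: "algebraic_int s" "f s = (\<Sum>i\<in>UNIV. of_int (q i) *\<^sub>R v i)"
    using zbasisD(1)[OF zb, of q] by (auto simp: ring_of_integers_def)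
  have "f (2 * t ^ (2 ^ b) - 2 * t ^ (2 ^ a)) = (\<Sum>i\<in>UNIV. of_int (k b i - k a i) *\<^sub>R v i)"
    by (simp add: diff k sum_subtractf scaleR_diff_left)
  also have "\<dots> = f s + f s"
    unfolding s(2) q by (simp add: sum.distrib[symmetric] scaleR_add_left[symmetric] del: scaleR_add_left)
  also have "\<dots> = f (2 * s)" by (metis add mult_2)
  finally have "2 * t ^ (2 ^ b) - 2 * t ^ (2 ^ a) = 2 * s" using inj by (simp add: inj_eq)
  then have "2 * (t ^ (2 ^ b) - t ^ (2 ^ a)) = 2 * s" by (simp add: algebra_simps)
  then have ts: "t ^ (2 ^ b) - t ^ (2 ^ a) = s" by (simp only: mult_cancel_left) simp
  obtain p where p: "lead_coeff p = 1" "integral_poly p" "poly p s = 0"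
    using s(1) by (auto simp: algebraic_int_iff_integral_poly)
  define g :: "'k poly" where "g = monom 1 (2 ^ b) - monom 1 (2 ^ a)"
  have lt: "(2::nat) ^ a < 2 ^ b" using ab(1) by simp
  have dg: "degree g = 2 ^ b" "lead_coeff g = 1"
  proof -
    have "degree (monom (1::'k) (2 ^ b) + - monom 1 (2 ^ a)) = degree (monom (1::'k) (2 ^ b))"
      by (rule degree_add_eq_left) (use lt in \<open>simp add: degree_monom_eq\<close>)
    then show "degree g = 2 ^ b" by (simp add: g_def degree_monom_eq)
    then show "lead_coeff g = 1" using lt by (simp add: g_def)
  qed
  have "lead_coeff (pcompose p g) = 1" using p(1) dg by (simp add: lead_coeff_comp)
  moreover have "integral_poly (pcompose p g)"
    using p(2) by (intro integral_poly_pcompose) (simp_all add: g_def integral_poly_arith)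
  moreover have "poly (pcompose p g) t = 0"
    using p(3) ts by (simp add: poly_pcompose g_def poly_monom)
  ultimately show ?thesis unfolding t_def algebraic_int_iff_integral_poly by blast
qed

text \<open>The leading coefficient \<open>a\<close> of \<open>p\<close> is a denominator: \<open>a ^ (n - 1) p(X / a)\<close> is monic and integral, and
  vanishes at \<open>a x\<close>.\<close>

lemma algebraic_imp_multiple_algebraic_int:
  fixes x :: "'a::field_char_0"
  assumes "algebraic x"
  shows "\<exists>d. d \<noteq> 0 \<and> algebraic_int (of_int d * x)"
proof -
  obtain p :: "int poly" where p: "poly (map_poly of_int p) x = 0" "p \<noteq> 0"
    using assms by (auto elim: algebraicE')
  define n where "n = degree p"
  define a where "a = lead_coeff p"
  have a: "a \<noteq> 0" using p by (simp add: a_def)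
  have sum0: "(\<Sum>i\<le>n. of_int (coeff p i) * x ^ i) = 0"
    using p(1) by (simp add: poly_altdef n_def degree_map_poly coeff_map_poly)
  have n: "n > 0"
  proof (rule ccontr)
    assume "\<not> n > 0"
    then have "of_int (coeff p n) = (0::'a)" using sum0 by simp
    then show False using a \<open>\<not> n > 0\<close> unfolding a_def n_def by simp
  qed
  define c where "c i = (if i = n then 1 else coeff p i * a ^ (n - 1 - i))" for i
  define q :: "'a poly" where "q = (\<Sum>i\<le>n. monom (of_int (c i)) i)"
  have cq: "coeff q j = (if j \<le> n then of_int (c j) else 0)" for j
    unfolding q_def by (simp add: coeff_sum)
  have dq: "degree q = n"
    by (rule antisym, rule degree_le) (auto simp: cq c_def intro!: le_degree)
  have "poly q (of_int a * x) = (\<Sum>i\<le>n. of_int (c i) * (of_int a * x) ^ i)"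
    by (simp add: q_def poly_sum poly_monom)
  also have "\<dots> = (\<Sum>i\<le>n. of_int (a ^ (n - 1)) * (of_int (coeff p i) * x ^ i))"
  proof (rule sum.cong[OF refl])
    fix i assume i: "i \<in> {..n}"
    have "c i * a ^ i = a ^ (n - 1) * coeff p i"
    proof (cases "i = n")
      case True
      then show ?thesis using n by (simp add: c_def a_def n_def power_eq_if)
    next
      case False
      then have "n - 1 = (n - 1 - i) + i" using i by auto
      then have "a ^ (n - 1) = a ^ (n - 1 - i) * a ^ i" by (metis power_add)
      then show ?thesis using False by (simp add: c_def)
    qed
    then have "of_int (c i) * (of_int a) ^ i = (of_int (a ^ (n - 1)) * of_int (coeff p i) :: 'a)"
      by (metis of_int_mult of_int_power)
    then show "of_int (c i) * (of_int a * x) ^ i = of_int (a ^ (n - 1)) * (of_int (coeff p i) * x ^ i)"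
      by (simp add: power_mult_distrib mult.assoc[symmetric])
  qed
  also have "\<dots> = 0" by (simp only: sum_distrib_left[symmetric] sum0 mult_zero_right)
  finally have "algebraic_int (of_int a * x)"
    unfolding algebraic_int_iff_integral_poly
    by (intro exI[of _ q]) (auto simp: dq cq c_def integral_poly_def)
  then show ?thesis using a by blast
qed

lemma number_field_algebraic:
  assumes "number_field TYPE('k::field_char_0)"
  shows "algebraic (x :: 'k)"
proof -
  interpret Q: vector_space "\<lambda>(q::rat) (y::'k). of_rat q * y"
    by unfold_locales (simp_all add: algebra_simps of_rat_add of_rat_mult)
  obtain S :: "'k set" where S: "finite S" "Q.span S = UNIV"
    using assms by (auto simp: number_field_def)
  define n where "n = Suc (card S)"
  have root: "\<exists>p. (\<forall>i. coeff p i \<in> \<rat>) \<and> p \<noteq> 0 \<and> poly p x = 0"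
  proof (cases "inj_on (\<lambda>i. x ^ i) {..<n}")
    case True
    define P where "P = (\<lambda>i. x ^ i) ` {..<n}"
    have fP: "finite P" "card P = n" using True by (auto simp: P_def card_image)
    have "Q.dependent P"
    proof (rule ccontr)
      assume "\<not> Q.dependent P"
      then have "card P \<le> card S"
        using Q.independent_span_bound[OF S(1)] S(2) by auto
      then show False using fP by (simp add: n_def)
    qed
    then obtain u where u: "(\<Sum>y\<in>P. of_rat (u y) * y) = 0" "\<exists>y\<in>P. u y \<noteq> 0"
      using Q.dependent_finite[OF fP(1)] by auto
    define p :: "'k poly" where "p = (\<Sum>i<n. monom (of_rat (u (x ^ i))) i)"
    have cp: "coeff p j = (if j < n then of_rat (u (x ^ j)) else 0)" for j
      by (simp add: p_def coeff_sum)
    have "poly p x = (\<Sum>i<n. of_rat (u (x ^ i)) * x ^ i)"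
      by (simp add: p_def poly_sum poly_monom)
    also have "\<dots> = (\<Sum>y\<in>P. of_rat (u y) * y)"
      unfolding P_def by (simp add: sum.reindex[OF True] o_def)
    finally have "poly p x = 0" using u(1) by simp
    moreover obtain i where "i < n" "u (x ^ i) \<noteq> 0" using u(2) by (auto simp: P_def)
    then have "coeff p i \<noteq> 0" by (simp add: cp)
    then have "p \<noteq> 0" by auto
    ultimately show ?thesis by (intro exI[of _ p]) (auto simp: cp)
  next
    case False
    then obtain i j where ij: "i < j" "x ^ i = x ^ j"
      by (auto simp: inj_on_def) (metis linorder_neqE_nat)
    define p :: "'k poly" where "p = monom 1 j - monom 1 i"
    have "coeff p j = 1" using ij by (simp add: p_def)
    then have "p \<noteq> 0" by auto
    then show ?thesis using ij by (intro exI[of _ p]) (auto simp: p_def poly_monom)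
  qed
  then show ?thesis by (auto simp: algebraic_altdef)
qed

text \<open>Dedekind's lemma on the linear independence of characters.\<close>

lemma multiplicative_maps_independent:
  fixes c :: "('k::monoid_mult \<Rightarrow> complex) \<Rightarrow> complex"
  assumes "finite S" "\<And>f. f \<in> S \<Longrightarrow> f 1 = 1 \<and> (\<forall>x y. f (x * y) = f x * f y)"
    and "\<And>x. (\<Sum>f\<in>S. c f * f x) = 0"
  shows "\<forall>f\<in>S. c f = 0"
  using assms
proof (induction S arbitrary: c rule: finite_induct)
  case empty
  then show ?case by simp
next
  case (insert g S)
  have "\<forall>f\<in>S. c f * (f y - g y) = 0" for y
  proof (rule insert.IH)
    fix x
    have "(\<Sum>f\<in>S. c f * f (y * x)) + c g * g (y * x) = 0"
      using insert.prems(2)[of "y * x"] insert.hyps by (simp add: add.commute)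
    moreover have "(\<Sum>f\<in>S. c f * f (y * x)) = (\<Sum>f\<in>S. c f * f y * f x)"
      by (intro sum.cong) (auto simp: insert.prems(1))
    moreover have "(\<Sum>f\<in>S. c f * f x) = - (c g * g x)"
      using insert.prems(2)[of x] insert.hyps by (simp add: add_eq_0_iff)
    then have "g y * (\<Sum>f\<in>S. c f * f x) = - (c g * g y * g x)" by simp
    then have "(\<Sum>f\<in>S. c f * g y * f x) = - (c g * g y * g x)"
      by (simp add: sum_distrib_left mult_ac)
    ultimately show "(\<Sum>f\<in>S. c f * (f y - g y) * f x) = 0"
      using insert.prems(1)[of g] by (simp add: algebra_simps sum_subtractf)
  qed (use insert.prems in auto)
  then have S: "\<forall>f\<in>S. c f = 0"
    using insert.hyps by (metis eq_iff_diff_eq_0 ext mult_eq_0_iff)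
  then have "c g * g 1 = 0"
    using insert.prems(2)[of 1] insert.hyps by simp
  then show ?case using S insert.prems(1)[of g] by simp
qed

section \<open>The lattice of the ring of integers\<close>

locale unit_fan_data =
  fixes \<sigma> :: "'r::{finite,linorder} + 'c::{finite,linorder} + 'c \<Rightarrow> 'k::field_char_0 \<Rightarrow> complex"
    and \<beta> :: "'r + 'c + 'c \<Rightarrow> complex ^ ('r + 'c + 'c)"
    and b :: nat
    and W :: "'k set"
    and \<Delta>' :: "(real ^ 'r::{finite,linorder}) set set"
    and \<Delta> :: "(complex ^ ('r + 'c + 'c)) set set"
  assumes number_field: "number_field TYPE('k)"
    and embeddings: "embedding_enumeration \<sigma>"
    and zbasis: "zbasis \<beta> (int_ring_lattice \<sigma>)"
    and b1: "1 \<le> b" and bs: "b \<le> CARD('r) - 1"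
    and W_sub: "mult_subgroup W (positive_units \<sigma>)"
    and C: "assumption_C \<sigma> b W"
    and base: "base_fan \<sigma> b W \<Delta>'"
    and lift: "lifted_fan \<sigma> W \<Delta>' \<Delta>"
begin

abbreviation lat :: "(complex ^ ('r + 'c + 'c)) set" where "lat \<equiv> int_ring_lattice \<sigma>"
abbreviation ce :: "'k \<Rightarrow> complex ^ ('r + 'c + 'c)" where "ce \<equiv> canonical_embedding \<sigma>"

lemma emb_field: "field_embedding (\<sigma> i)"
  using embeddings unfolding embedding_enumeration_def bij_betw_def by auto

lemma emb_add [simp]: "\<sigma> i (x + y) = \<sigma> i x + \<sigma> i y"
  and emb_mult [simp]: "\<sigma> i (x * y) = \<sigma> i x * \<sigma> i y"
  and emb_1 [simp]: "\<sigma> i 1 = 1"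
  using emb_field[of i] unfolding field_embedding_def by auto

lemma emb_0 [simp]: "\<sigma> i 0 = 0"
  using emb_add[of i 0 0] by simp

lemma emb_diff [simp]: "\<sigma> i (x - y) = \<sigma> i x - \<sigma> i y"
  using emb_add[of i "x - y" y] by simp

lemma emb_eq_0 [simp]: "\<sigma> i x = 0 \<longleftrightarrow> x = 0"
proof
  assume "\<sigma> i x = 0"
  then have "\<sigma> i (x * inverse x) = 0" by simp
  then show "x = 0" by (metis emb_1 right_inverse zero_neq_one)
qed simp

lemma emb_inverse: "\<sigma> i (inverse x) = inverse (\<sigma> i x)"
proof (cases "x = 0")
  case False
  then have "\<sigma> i x * \<sigma> i (inverse x) = 1" by (metis emb_1 emb_mult right_inverse)
  then show ?thesis by (metis inverse_unique)
qed simp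

lemma emb_eq_iff [simp]: "\<sigma> i x = \<sigma> i y \<longleftrightarrow> x = y"
  by (metis emb_diff emb_eq_0 eq_iff_diff_eq_0)

lemma emb_real: "\<sigma> (Inl i) x \<in> \<real>" and emb_conj: "\<sigma> (Inr (Inl k)) x = cnj (\<sigma> (Inr (Inr k)) x)"
  using embeddings unfolding embedding_enumeration_def by auto

lemma emb_Im [simp]: "Im (\<sigma> (Inl i) x) = 0"
  using emb_real[of i x] by (simp add: complex_is_Real_iff)

lemma ce_add: "ce (x + y) = ce x + ce y"
  by (simp add: canonical_embedding_def vec_eq_iff)

lemma inj_ce: "inj ce"
  by (auto simp: inj_def canonical_embedding_def vec_eq_iff)

lemma lat_iff: "ce x \<in> lat \<longleftrightarrow> algebraic_int x"
  using inj_ce by (auto simp: int_ring_lattice_def ring_of_integers_def dest: injD)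

lemma lat_cases: "z \<in> lat \<Longrightarrow> \<exists>x. z = ce x \<and> algebraic_int x"
  by (auto simp: int_ring_lattice_def ring_of_integers_def)

lemma algebraic_int_mult: "algebraic_int x \<Longrightarrow> algebraic_int (y::'k) \<Longrightarrow> algebraic_int (x * y)"
  using algebraic_int_mult_of_zbasis[OF zbasis[unfolded int_ring_lattice_def] inj_ce ce_add] .

definition base_change :: "complex ^ ('r + 'c + 'c) ^ ('r + 'c + 'c)" where
  "base_change = (\<chi> i j. \<beta> j $ i)"

definition from_coords :: "complex ^ ('r + 'c + 'c) \<Rightarrow> complex ^ ('r + 'c + 'c)" where
  "from_coords c = (\<Sum>j\<in>UNIV. c $ j *s \<beta> j)"

lemma from_coords_eq: "from_coords c = base_change *v c"
  by (simp add: from_coords_def base_change_def matrix_vector_mult_def vec_eq_iff mult.commute)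

text \<open>The lattice basis is a basis of the complex vector space: a linear relation between the embeddings
  on the ring of integers holds on its fraction field, which Dedekind's lemma excludes.\<close>

lemma invertible_base_change: "invertible base_change"
proof -
  have "\<exists>B. base_change ** B = mat 1"
  proof (subst matrix_right_invertible_independent_rows, intro allI impI)
    fix c :: "'r + 'c + 'c \<Rightarrow> complex" and i0
    assume c: "(\<Sum>i\<in>UNIV. c i *s row i base_change) = 0"
    have basis: "(\<Sum>i\<in>UNIV. c i * \<beta> j $ i) = 0" for j
    proof -
      have "(\<Sum>i\<in>UNIV. c i *s row i base_change) $ j = 0" using c by simp
      then show ?thesis by (simp add: row_def base_change_def)
    qed
    have lat: "(\<Sum>i\<in>UNIV. c i * z $ i) = 0" if z: "z \<in> lat" for z
    proof -
      obtain k where k: "z = (\<Sum>j\<in>UNIV. of_int (k j) *\<^sub>R \<beta> j)"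
        using zbasisD(2)[OF zbasis z] by blast
      have "(\<Sum>i\<in>UNIV. c i * z $ i) = (\<Sum>i\<in>UNIV. \<Sum>j\<in>UNIV. c i * (of_int (k j) *\<^sub>R \<beta> j $ i))"
        by (simp add: k sum_distrib_left)
      also have "\<dots> = (\<Sum>j\<in>UNIV. of_int (k j) *\<^sub>R (\<Sum>i\<in>UNIV. c i * \<beta> j $ i))"
        by (subst sum.swap) (simp add: scaleR_sum_right)
      finally show ?thesis by (simp add: basis)
    qed
    have all: "(\<Sum>i\<in>UNIV. c i * \<sigma> i x) = 0" for x
    proof -
      obtain d where d: "d \<noteq> 0" "algebraic_int (of_int d * x)"
        using algebraic_imp_multiple_algebraic_int[OF number_field_algebraic[OF number_field]] by blast
      have "(\<Sum>i\<in>UNIV. c i * \<sigma> i (of_int d * x)) = 0"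
        using lat[of "ce (of_int d * x)"] d(2) by (simp add: lat_iff) (simp add: canonical_embedding_def)
      moreover have \<sigma>n: "\<sigma> i (of_nat n) = of_nat n" for i n
        by (induction n) simp_all
      have "\<sigma> i (of_int d) = of_int d" for i
      proof (cases "d \<ge> 0")
        case True
        then show ?thesis using \<sigma>n[of i "nat d"] by simp
      next
        case False
        then show ?thesis using \<sigma>n[of i "nat (- d)"] emb_diff[of i 0 "of_int d"] by simp
      qed
      ultimately have "of_int d * (\<Sum>i\<in>UNIV. c i * \<sigma> i x) = 0"
        by (simp add: sum_distrib_left mult_ac)
      then show ?thesis using d(1) by simp
    qed
    have inj: "inj \<sigma>" using embeddings by (auto simp: embedding_enumeration_def bij_betw_def)
    have "\<forall>f\<in>range \<sigma>. c (inv \<sigma> f) = 0"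
    proof (rule multiplicative_maps_independent)
      show "(\<Sum>f\<in>range \<sigma>. c (inv \<sigma> f) * f x) = 0" for x
        using all[of x] inj by (simp add: sum.reindex)
    qed auto
    then show "c i0 = 0" using inj by simp
  qed
  then show ?thesis
    by (auto simp: invertible_def matrix_left_right_inverse)
qed

lemma basis_coords_from_coords [simp]: "basis_coords \<beta> (from_coords c) = c"
  and from_coords_basis_coords [simp]: "from_coords (basis_coords \<beta> z) = z"
proof -
  have inj: "from_coords c = from_coords c' \<Longrightarrow> c = c'" for c c'
    using invertible_base_change unfolding from_coords_eq
    by (metis invertible_def matrix_vector_mul_assoc matrix_vector_mul_lid)
  then show *: "basis_coords \<beta> (from_coords c) = c" for c
    unfolding basis_coords_def from_coords_def[symmetric] by (intro the_equality) auto
  obtain B where "base_change ** B = mat 1"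
    using invertible_base_change by (auto simp: invertible_def)
  then have "z = from_coords (B *v z)"
    by (simp add: from_coords_eq matrix_vector_mul_assoc)
  then show "from_coords (basis_coords \<beta> z) = z" by (metis *)
qed

lemma from_coords_add: "from_coords (c + c') = from_coords c + from_coords c'"
  and from_coords_scale: "from_coords (a *s c) = a *s from_coords c"
  by (simp_all add: from_coords_eq matrix_vector_right_distrib vector_scalar_commute)

lemma basis_coords_add: "basis_coords \<beta> (z + w) = basis_coords \<beta> z + basis_coords \<beta> w"
  and basis_coords_scale: "basis_coords \<beta> (a *s z) = a *s basis_coords \<beta> z"
  by (metis from_coords_basis_coords basis_coords_from_coords from_coords_add)
     (metis from_coords_basis_coords basis_coords_from_coords from_coords_scale)

lemma scaleR_eq_scalar: "r *\<^sub>R (z :: complex ^ 'n) = of_real r *s z"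
  by (simp add: vec_eq_iff) (simp add: scaleR_conv_of_real)

lemma linear_basis_coords: "linear (basis_coords \<beta>)"
  by (intro linearI) (simp_all add: basis_coords_add basis_coords_scale scaleR_eq_scalar)

lemma linear_from_coords: "linear from_coords"
  by (intro linearI) (simp_all add: from_coords_add from_coords_scale scaleR_eq_scalar)

definition cvec :: "real ^ 'n \<Rightarrow> complex ^ 'n" where
  "cvec x = (\<chi> i. of_real (x $ i))"

lemma linear_cvec: "linear cvec"
  by (intro linearI) (simp_all add: cvec_def vec_eq_iff scaleR_eq_scalar)

definition real_point :: "real ^ ('r + 'c + 'c) \<Rightarrow> complex ^ ('r + 'c + 'c)" where
  "real_point x = from_coords (cvec x)"

lemma real_point_alt: "real_point x = (\<Sum>j\<in>UNIV. x $ j *\<^sub>R \<beta> j)"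
  by (simp add: real_point_def from_coords_def cvec_def scaleR_eq_scalar)

lemma linear_real_point: "linear real_point"
  unfolding real_point_def using linear_compose[OF linear_cvec linear_from_coords] by (simp add: o_def)

lemma real_coords_real_point [simp]: "real_coords \<beta> (real_point x) = x"
  by (simp add: real_coords_def real_point_def cvec_def vec_eq_iff)

lemma inj_real_point: "inj real_point"
  by (metis injI real_coords_real_point)

lemma linear_real_coords: "linear (real_coords \<beta>)"
  by (intro linearI)
     (simp_all add: real_coords_def basis_coords_add basis_coords_scale scaleR_eq_scalar vec_eq_iff)

lemma lat_eq: "lat = real_point ` int_lattice"
proof (intro equalityI subsetI)
  fix z assume "z \<in> lat"
  then obtain k where "z = (\<Sum>j\<in>UNIV. of_int (k j) *\<^sub>R \<beta> j)"
    using zbasisD(2)[OF zbasis] by blast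
  then have "z = real_point (\<chi> j. of_int (k j))" by (simp add: real_point_alt)
  then show "z \<in> real_point ` int_lattice" by (auto simp: int_lattice_def)
next
  fix z assume "z \<in> real_point ` int_lattice"
  then obtain x where x: "z = real_point x" "\<And>i. x $ i \<in> \<int>" by (auto simp: int_lattice_def)
  have "x $ i = of_int \<lfloor>x $ i\<rfloor>" for i using x(2) by (metis Ints_cases floor_of_int)
  then have "z = (\<Sum>j\<in>UNIV. of_int \<lfloor>x $ j\<rfloor> *\<^sub>R \<beta> j)" unfolding x(1) real_point_alt by metis
  then show "z \<in> lat" using zbasisD(1)[OF zbasis] by metis
qed

lemma basis_in_lat: "\<beta> j \<in> lat"
proof -
  have "\<beta> j = real_point (axis j 1)"
    by (simp add: real_point_alt axis_def if_distrib[of "\<lambda>t. t *\<^sub>R _"] cong: if_cong)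
  then show ?thesis by (auto simp: lat_eq int_lattice_def axis_def)
qed

lemma lat_real: "z \<in> lat \<Longrightarrow> Im (z $ Inl i) = 0"
  and lat_conj: "z \<in> lat \<Longrightarrow> z $ Inr (Inl k) = cnj (z $ Inr (Inr k))"
  by (auto dest!: lat_cases simp: canonical_embedding_def emb_conj)

lemma real_point_real: "Im (real_point x $ Inl i) = 0"
  and real_point_conj: "real_point x $ Inr (Inl k) = cnj (real_point x $ Inr (Inr k))"
  using basis_in_lat by (simp_all add: real_point_alt lat_real lat_conj)

lemma span_lat: "span lat = range real_point"
proof
  show "span lat \<subseteq> range real_point"
    unfolding lat_eq by (rule span_minimal) (auto simp: linear_real_point intro: linear_subspace_image)
  show "range real_point \<subseteq> span lat"
    by (auto simp: real_point_alt intro!: span_sum span_scale span_base[OF basis_in_lat])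
qed

lemma real_point_real_coords: "z \<in> span lat \<Longrightarrow> real_point (real_coords \<beta> z) = z"
  unfolding span_lat by auto

subsection \<open>The action of units\<close>

lemma W_1: "1 \<in> W" and W_mult: "u \<in> W \<Longrightarrow> w \<in> W \<Longrightarrow> u * w \<in> W" and W_inv: "u \<in> W \<Longrightarrow> inverse u \<in> W"
  using W_sub by (auto simp: mult_subgroup_def)

lemma W_pos: "u \<in> W \<Longrightarrow> Re (\<sigma> (Inl i) u) > 0"
  using W_sub by (auto simp: mult_subgroup_def positive_units_def)

lemma W_nz: "u \<in> W \<Longrightarrow> u \<noteq> 0"
  using W_pos[of u undefined] by auto

lemma W_int: "u \<in> W \<Longrightarrow> algebraic_int u"
  using W_sub by (auto simp: mult_subgroup_def positive_units_def ring_of_integers_def)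

lemma unit_act_lat: "u \<in> W \<Longrightarrow> z \<in> lat \<Longrightarrow> unit_act \<sigma> u z \<in> lat"
proof -
  assume u: "u \<in> W" and "z \<in> lat"
  then obtain x where x: "z = ce x" "algebraic_int x" using lat_cases by blast
  have "unit_act \<sigma> u z = ce (u * x)" by (simp add: x unit_act_def canonical_embedding_def vec_eq_iff)
  then show ?thesis using lat_iff algebraic_int_mult W_int u x(2) by metis
qed

lemma unit_act_add: "unit_act \<sigma> u (z + w) = unit_act \<sigma> u z + unit_act \<sigma> u w"
  and unit_act_scale: "unit_act \<sigma> u (a *s z) = a *s unit_act \<sigma> u z"
  and unit_act_1: "unit_act \<sigma> 1 z = z"
  by (simp_all add: unit_act_def vec_eq_iff algebra_simps)

lemma unit_act_mult: "unit_act \<sigma> u (unit_act \<sigma> v z) = unit_act \<sigma> (u * v) z"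
  by (simp add: unit_act_def vec_eq_iff algebra_simps)

lemma linear_unit_act: "linear (unit_act \<sigma> u)"
  by (intro linearI) (simp_all add: unit_act_add unit_act_scale scaleR_eq_scalar)

abbreviation um :: "'k \<Rightarrow> real ^ ('r + 'c + 'c) ^ ('r + 'c + 'c)" where "um \<equiv> unit_matrix \<sigma> \<beta>"

lemma real_point_um:
  assumes "u \<in> W"
  shows "real_point (um u *v x) = unit_act \<sigma> u (real_point x)"
proof -
  have "linear (\<lambda>x. real_coords \<beta> (unit_act \<sigma> u (real_point x)))"
    using linear_compose[OF linear_real_point linear_compose[OF linear_unit_act linear_real_coords]]
    by (simp add: o_def)
  then have "um u *v x = real_coords \<beta> (unit_act \<sigma> u (real_point x))"
    unfolding unit_matrix_def real_point_alt[symmetric]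
    by (simp only: matrix_works linear_matrix_vector_mul_eq)
  moreover have "unit_act \<sigma> u (real_point x) \<in> span lat"
  proof -
    have "real_point x \<in> span lat" by (simp add: span_lat)
    then have "unit_act \<sigma> u (real_point x) \<in> unit_act \<sigma> u ` span lat" by blast
    also have "\<dots> = span (unit_act \<sigma> u ` lat)"
      by (simp add: linear_span_image linear_unit_act)
    also have "\<dots> \<subseteq> span lat"
      using unit_act_lat[OF assms] by (intro span_mono) auto
    finally show ?thesis .
  qed
  ultimately show ?thesis by (simp add: real_point_real_coords)
qed

lemma um_1: "um 1 = mat 1"
  by (simp add: unit_matrix_def unit_act_1 real_point_alt[symmetric] matrix_id_mat_1[unfolded id_def])

lemma um_mult: "u \<in> W \<Longrightarrow> w \<in> W \<Longrightarrow> um (u * w) = um u ** um w"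
  by (subst matrix_eq) (metis W_mult injD inj_real_point matrix_vector_mul_assoc real_point_um unit_act_mult)

lemma um_inverse: "u \<in> W \<Longrightarrow> um u ** um (inverse u) = mat 1" "u \<in> W \<Longrightarrow> um (inverse u) ** um u = mat 1"
  using um_mult[of u "inverse u"] um_mult[of "inverse u" u] W_inv W_nz by (simp_all add: um_1)

lemma um_int: "u \<in> W \<Longrightarrow> x \<in> int_lattice \<Longrightarrow> um u *v x \<in> int_lattice"
  using real_point_um[of u x] unit_act_lat[of u "real_point x"] lat_eq inj_real_point
  by (metis image_eqI image_iff injD)

definition cmat :: "real ^ 'n ^ 'm \<Rightarrow> complex ^ 'n ^ 'm" where
  "cmat A = (\<chi> i j. of_real (A $ i $ j))"

lemma cmat_cvec: "cmat A *v cvec x = cvec (A *v x)"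
  by (simp add: cmat_def cvec_def matrix_vector_mult_def vec_eq_iff)

lemma from_coords_cmat:
  assumes "u \<in> W"
  shows "from_coords (cmat (um u) *v c) = unit_act \<sigma> u (from_coords c)"
proof -
  have decomp: "c = cvec (\<chi> i. Re (c $ i)) + \<i> *s cvec (\<chi> i. Im (c $ i))"
    by (simp add: vec_eq_iff cvec_def complex_eq[symmetric])
  have real: "from_coords (cmat (um u) *v cvec x) = unit_act \<sigma> u (from_coords (cvec x))" for x
    using real_point_um[OF assms, of x] by (simp add: cmat_cvec real_point_def)
  show ?thesis
    by (subst (1 2) decomp)
       (simp add: matrix_vector_right_distrib vector_scalar_commute from_coords_add from_coords_scale
          real unit_act_add unit_act_scale)
qed

lemma basis_coords_unit_act:
  "u \<in> W \<Longrightarrow> basis_coords \<beta> (unit_act \<sigma> u z) = cmat (um u) *v basis_coords \<beta> z"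
  by (metis basis_coords_from_coords from_coords_basis_coords from_coords_cmat)


subsection \<open>Wandering neighbourhoods for the action on \<open>\<Omega>\<close>\<close>

lemma small_index: "\<exists>i::'r. emb_index (Inl i :: 'r + 'c) \<le> b"
proof -
  have "{..Min (UNIV :: 'r set)} = {Min UNIV}"
    by (auto intro: antisym)
  then show ?thesis using b1 by (intro exI[of _ "Min UNIV"]) simp
qed

lemma b_less: "b < CARD('r)"
  using bs zero_less_card_finite[where 'a = 'r] by linarith

lemma large_index: "\<exists>i::'r. emb_index (Inl i :: 'r + 'c) > b"
proof -
  have "{..Max (UNIV :: 'r set)} = UNIV" by auto
  then show ?thesis using b_less by (intro exI[of _ "Max UNIV"]) simp
qed

lemma complex_index: "emb_index (Inr k :: 'r + 'c) > b"
  using b_less by simp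

lemma norm_le_sum_cmod: "norm (z :: complex ^ 'n) \<le> (\<Sum>i\<in>UNIV. cmod (z $ i))"
  unfolding norm_vec_def by (rule L2_set_le_sum) simp

lemma finite_bounded_integers: "finite {x::'k. algebraic_int x \<and> (\<forall>i. cmod (\<sigma> i x) \<le> M)}" (is "finite ?S")
proof -
  obtain B where B: "B > 0" "\<And>z. norm (real_coords \<beta> z) \<le> B * norm z"
    using linear_bounded_pos[OF linear_real_coords] by blast
  define R where "R = \<lceil>B * (\<Sum>i\<in>(UNIV::('r + 'c + 'c) set). M)\<rceil>"
  define g where "g x = (\<lambda>j. \<lfloor>real_coords \<beta> (ce x) $ j\<rfloor>)" for x
  have int: "real_coords \<beta> (ce x) $ j = of_int (g x j)" if x: "x \<in> ?S" for x j
  proof -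
    have "ce x \<in> lat" using x lat_iff by simp
    then obtain y where y: "ce x = real_point y" "y \<in> int_lattice" by (auto simp: lat_eq)
    then have "y $ j \<in> \<int>" by (simp add: int_lattice_def)
    then show ?thesis unfolding g_def y(1) by (auto elim: Ints_cases)
  qed
  have "g x j \<in> {-R..R}" if x: "x \<in> ?S" for x j
  proof -
    have "\<bar>of_int (g x j)\<bar> \<le> norm (real_coords \<beta> (ce x))"
      using component_le_norm_cart[of "real_coords \<beta> (ce x)" j] int[OF x] by simp
    also have "\<dots> \<le> B * (\<Sum>i\<in>UNIV. cmod (ce x $ i))"
      using B norm_le_sum_cmod[of "ce x"] by (meson mult_left_mono less_imp_le order_trans)
    also have "\<dots> \<le> B * (\<Sum>i\<in>(UNIV::('r + 'c + 'c) set). M)"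
      using x B(1) by (intro mult_left_mono sum_mono) (auto simp: canonical_embedding_def)
    finally show ?thesis unfolding R_def by (simp add: abs_le_iff) linarith
  qed
  then have "g ` ?S \<subseteq> PiE UNIV (\<lambda>_. {-R..R})" by auto
  then have "finite (g ` ?S)" by (rule finite_subset) (simp add: finite_PiE)
  moreover have "inj_on g ?S"
  proof (rule inj_onI)
    fix x y assume xy: "x \<in> ?S" "y \<in> ?S" "g x = g y"
    then have "real_coords \<beta> (ce x) = real_coords \<beta> (ce y)"
      by (simp add: vec_eq_iff int del: mem_Collect_eq)
    moreover have "ce x \<in> span lat" "ce y \<in> span lat"
      using xy lat_iff by (auto intro: span_base)
    ultimately have "ce x = ce y" by (metis real_point_real_coords)
    then show "x = y" using inj_ce by (simp add: inj_eq)
  qed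
  ultimately show ?thesis by (rule finite_imageD)
qed

lemma unit_size_bounds_embeddings:
  assumes "u \<in> W" "\<And>j. unit_size \<sigma> u j \<le> M"
  shows "cmod (\<sigma> i u) \<le> M"
proof -
  have "cmod (\<sigma> (Inl i) u) \<le> M" for i
    using assms(2)[of "Inl i"] W_pos[OF assms(1), of i]
    by (simp add: unit_size_def cmod_def)
  moreover have "cmod (\<sigma> (Inr (Inl k)) u) \<le> M" for k
    using assms(2)[of "Inr k"] by (simp add: unit_size_def)
  moreover from this have "cmod (\<sigma> (Inr (Inr k)) u) \<le> M" for k
    by (metis complex_mod_cnj emb_conj)
  ultimately show ?thesis by (metis sumE)
qed

lemma unit_size_inverse: "u \<in> W \<Longrightarrow> unit_size \<sigma> (inverse u) j = inverse (unit_size \<sigma> u j)"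
  using W_pos[of u] W_nz[of u]
  by (cases j, simp_all add: unit_size_def emb_inverse norm_inverse power2_eq_square divide_inverse)
    (metis right_inverse)

text \<open>Assumption C bounds either all sizes of \<open>u\<close> or all sizes of \<open>1 / u\<close> by their values at the first \<open>b\<close>
  places, so that one of these integers is among the finitely many with bounded embeddings.\<close>

lemma finite_units_near_1:
  "finite {u \<in> W. \<forall>i::'r. emb_index (Inl i :: 'r + 'c) \<le> b \<longrightarrow> Re (\<sigma> (Inl i) u) \<in> {1/4<..<4}}"
    (is "finite ?F")
proof -
  let ?S = "{x::'k. algebraic_int x \<and> (\<forall>i. cmod (\<sigma> i x) \<le> 4)}"
  have "u \<in> insert 1 (?S \<union> inverse ` ?S)" if u: "u \<in> ?F" for u
  proof (cases "u = 1")
    case False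
    have uW: "u \<in> W" using u by simp
    have small: "unit_size \<sigma> u i \<in> {1/4<..<4}" if i: "emb_index i \<le> b" for i
    proof (cases i)
      case (Inl a)
      then show ?thesis using u i by (simp add: unit_size_def)
    next
      case (Inr a)
      then show ?thesis using complex_index[of a] i by simp
    qed
    consider i where "emb_index i \<le> b" "\<And>j. emb_index j > b \<Longrightarrow> unit_size \<sigma> u i > unit_size \<sigma> u j"
      | i where "emb_index i \<le> b" "\<And>j. emb_index j > b \<Longrightarrow> unit_size \<sigma> u i < unit_size \<sigma> u j"
      using C False uW unfolding assumption_C_def by blast
    then show ?thesis
    proof cases
      case 1
      have "unit_size \<sigma> u j \<le> 4" for j
        using small[of j] small[OF 1(1)] 1(2)[of j] by (cases "emb_index j \<le> b") auto
      then have "cmod (\<sigma> i u) \<le> 4" for i by (rule unit_size_bounds_embeddings[OF uW])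
      then show ?thesis using W_int[OF uW] by blast
    next
      case 2
      have "unit_size \<sigma> u j \<ge> 1/4" for j
        using small[of j] small[OF 2(1)] 2(2)[of j] by (cases "emb_index j \<le> b") auto
      then have "unit_size \<sigma> (inverse u) j \<le> 4" for j
        using le_imp_inverse_le[of "1/4" "unit_size \<sigma> u j"] unit_size_inverse[OF uW, of j] by simp
      then have "cmod (\<sigma> i (inverse u)) \<le> 4" for i
        by (rule unit_size_bounds_embeddings[OF W_inv[OF uW]])
      then have "inverse u \<in> ?S" using W_int[OF W_inv[OF uW]] by blast
      then have "inverse (inverse u) \<in> inverse ` ?S" by (rule imageI)
      then show ?thesis by simp
    qed
  qed simp
  then have "?F \<subseteq> insert 1 (?S \<union> inverse ` ?S)" by blast
  then show ?thesis by (rule finite_subset) (simp add: finite_bounded_integers)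
qed

lemma unit_ne_1: "u \<in> W \<Longrightarrow> u \<noteq> 1 \<Longrightarrow> Re (\<sigma> (Inl i) u) \<noteq> 1"
  using emb_eq_iff[of "Inl i" u 1] emb_Im[of i u] by (auto simp: complex_eq_iff simp del: emb_eq_iff)

text \<open>If \<open>u\<close> does not move a small box around \<open>x\<close> off itself, then \<open>u\<close> is near \<open>1\<close> at the first \<open>b\<close> places,
  which leaves finitely many \<open>u\<close>. None of them but \<open>1\<close> has \<open>\<sigma>\<^sub>i u = 1\<close>, so it suffices to make the box
  short in one such coordinate.\<close>

lemma wandering_neighbourhood:
  fixes x :: "real ^ 'r::{finite,linorder}"
  assumes x: "x \<in> Omega TYPE('c) b"
  shows "\<exists>N. open N \<and> x \<in> N \<and> N \<subseteq> Omega TYPE('c) b \<and>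
           (\<forall>u\<in>W. u \<noteq> 1 \<longrightarrow> real_unit_act \<sigma> u ` N \<inter> N = {})"
proof -
  let ?F = "{u \<in> W. \<forall>i::'r. emb_index (Inl i :: 'r + 'c) \<le> b \<longrightarrow> Re (\<sigma> (Inl i) u) \<in> {1/4<..<4}} - {1}"
  obtain i1 :: 'r where i1: "emb_index (Inl i1 :: 'r + 'c) \<le> b" using small_index by blast
  have pos: "x $ i > 0" if "emb_index (Inl i :: 'r + 'c) \<le> b" for i
    using x that by (simp add: Omega_def)
  have "\<exists>\<mu>>0. \<forall>u\<in>?F. \<mu> \<le> \<bar>ln (Re (\<sigma> (Inl i1) u))\<bar>"
  proof (cases "?F = {}")
    case True
    then show ?thesis by (intro exI[of _ 1]) (simp only: ball_empty, simp)
  next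
    case False
    let ?A = "(\<lambda>u. \<bar>ln (Re (\<sigma> (Inl i1) u))\<bar>) ` ?F"
    have fin: "finite ?A" using finite_units_near_1 by blast
    have "Min ?A > 0"
      using fin False unit_ne_1 W_pos by (subst Min_gr_iff) auto
    then show ?thesis using fin by (intro exI[of _ "Min ?A"]) auto
  qed
  then obtain \<mu> where \<mu>: "\<mu> > 0" "\<And>u. u \<in> ?F \<Longrightarrow> \<mu> \<le> \<bar>ln (Re (\<sigma> (Inl i1) u))\<bar>" by blast
  \<comment> \<open>The factors \<open>1/2\<close> and \<open>2\<close> force \<open>u\<close> into the finite set \<open>?F\<close>; the shorter side \<open>i1\<close> then excludes it.\<close>
  define lo hi :: "real ^ 'r::{finite,linorder}"
    where "lo = (\<chi> i. if i = i1 then max (x $ i / 2) (x $ i * exp (- \<mu> / 2))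
                     else if emb_index (Inl i :: 'r + 'c) \<le> b then x $ i / 2 else x $ i - 1)"
      and "hi = (\<chi> i. if i = i1 then min (2 * x $ i) (x $ i * exp (\<mu> / 2))
                     else if emb_index (Inl i :: 'r + 'c) \<le> b then 2 * x $ i else x $ i + 1)"
  define N where "N = box lo hi"
  have N: "y \<in> N \<longleftrightarrow> (\<forall>i. lo $ i < y $ i \<and> y $ i < hi $ i)" for y
    by (simp add: N_def mem_box_cart)
  have Nb: "x $ i / 2 < y $ i \<and> y $ i < 2 * x $ i" if "y \<in> N" "emb_index (Inl i :: 'r + 'c) \<le> b" for y i
    using that N[of y] by (auto simp: lo_def hi_def split: if_splits dest: spec[of _ i])
  have N1: "x $ i1 * exp (- \<mu> / 2) < y $ i1 \<and> y $ i1 < x $ i1 * exp (\<mu> / 2)" if "y \<in> N" for y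
    using that N[of y] by (auto simp: lo_def hi_def dest: spec[of _ i1])
  have "x \<in> N"
    unfolding N using pos pos[OF i1] \<mu>(1) by (auto simp: lo_def hi_def)
  moreover have "N \<subseteq> Omega TYPE('c) b"
    using Nb pos by (fastforce simp: Omega_def)
  moreover have False if u: "u \<in> W" "u \<noteq> 1" and y: "y \<in> N" "real_unit_act \<sigma> u y \<in> N" for u y
  proof -
    let ?u = "\<lambda>i. Re (\<sigma> (Inl i) u)"
    have act: "real_unit_act \<sigma> u y $ i = ?u i * y $ i" for i by (simp add: real_unit_act_def)
    have "?u i \<in> {1/4<..<4}" if i: "emb_index (Inl i :: 'r + 'c) \<le> b" for i
    proof -
      have xi: "x $ i > 0" "y $ i > 0" using pos[OF i] Nb[OF y(1) i] by auto
      have a: "x $ i / 2 < ?u i * y $ i" "?u i * y $ i < 2 * x $ i"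
        using Nb[OF y(2) i] act by auto
      have "1/4 * y $ i < ?u i * y $ i" "?u i * y $ i < 4 * y $ i"
        using a Nb[OF y(1) i] by linarith+
      then show ?thesis using xi(2) by (simp only: mult_less_cancel_right_pos greaterThanLessThan_iff)
    qed
    then have "u \<in> ?F" using u by simp
    then have "\<mu> \<le> \<bar>ln (?u i1)\<bar>" by (rule \<mu>(2))
    moreover have "\<bar>ln (?u i1)\<bar> < \<mu>"
    proof -
      have y1: "y $ i1 > 0" "x $ i1 > 0" "?u i1 > 0" using Nb[OF y(1) i1] pos[OF i1] W_pos u by auto
      have "ln (x $ i1 * exp (- \<mu> / 2)) < ln (y $ i1)" "ln (y $ i1) < ln (x $ i1 * exp (\<mu> / 2))"
        "ln (x $ i1 * exp (- \<mu> / 2)) < ln (?u i1 * y $ i1)"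
        "ln (?u i1 * y $ i1) < ln (x $ i1 * exp (\<mu> / 2))"
        using N1[OF y(1)] N1[OF y(2)] y1 unfolding act by simp_all
      then show ?thesis using y1 by (simp add: ln_mult)
    qed
    ultimately show False by simp
  qed
  ultimately show ?thesis
    by (intro exI[of _ N]) (auto simp: N_def)
qed

subsection \<open>Density of the projected lattice\<close>

lemma proj_real_add: "proj_real ((z :: complex ^ ('r + 'c + 'c)) + w) = proj_real z + proj_real w"
  and proj_real_scaleR: "proj_real (r *\<^sub>R (z :: complex ^ ('r + 'c + 'c))) = r *\<^sub>R proj_real z"
  by (simp_all add: proj_real_def vec_eq_iff)

lemma linear_proj_real: "linear (proj_real :: complex ^ ('r + 'c + 'c) \<Rightarrow> _)"
  by (intro linearI proj_real_add proj_real_scaleR)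

text \<open>The projection to \<open>\<real>\<^sup>s\<close> has a nonzero kernel in the real span of the lattice. Lattice points near the kernel
  are infinite in number and have bounded projections, so that some of these projections are
  arbitrarily close to each other.\<close>

lemma small_integer:
  assumes "e > 0"
  shows "\<exists>x::'k. algebraic_int x \<and> x \<noteq> 0 \<and> (\<forall>i. cmod (\<sigma> (Inl i) x) < e)"
proof -
  define f where "f = (\<lambda>x. proj_real (real_point x))"
  have lin: "linear f" unfolding f_def using linear_compose[OF linear_real_point linear_proj_real] by (simp add: o_def)
  have "\<not> inj f"
  proof
    assume "inj f"
    then have "dim (range f) = dim (UNIV :: (real ^ ('r + 'c + 'c)) set)"
      using lin by (intro dim_image_eq) (auto simp: inj_on_def)
    moreover have "dim (range f) \<le> CARD('r)" using dim_subset_UNIV[of "range f"] by simp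
    moreover have "CARD('c) > 0" by simp
    ultimately show False by simp
  qed
  then obtain y0 where y0: "f y0 = 0" "y0 \<noteq> 0"
    using linear_injective_0[OF lin] by blast
  then obtain j where j: "y0 $ j \<noteq> 0" by (auto simp: vec_eq_iff)
  \<comment> \<open>Normalized so that the roundings of distinct multiples of \<open>y\<close> are distinct.\<close>
  define y where "y = (1 / y0 $ j) *\<^sub>R y0"
  have y: "f y = 0" "y $ j = 1" using y0 j by (simp_all add: y_def linear_scale[OF lin])
  define l :: "nat \<Rightarrow> real ^ ('r + 'c + 'c)" where "l N = (\<chi> i. of_int \<lfloor>of_nat N * y $ i\<rfloor>)" for N
  obtain B where B: "B > 0" "\<And>z. norm (f z) \<le> B * norm z"
    using linear_bounded_pos[OF lin] by blast
  have "norm (f (l N)) \<le> B * CARD('r + 'c + 'c)" for N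
  proof -
    have "f (l N) = f (l N - of_nat N *\<^sub>R y)"
      by (simp add: linear_diff[OF lin] linear_scale[OF lin] y(1))
    also have "norm \<dots> \<le> B * norm (l N - of_nat N *\<^sub>R y)" by (rule B(2))
    also have "norm (l N - of_nat N *\<^sub>R y) \<le> (\<Sum>i\<in>UNIV. \<bar>(l N - of_nat N *\<^sub>R y) $ i\<bar>)"
      by (rule norm_le_l1_cart)
    also have "\<dots> \<le> (\<Sum>i\<in>(UNIV::('r + 'c + 'c) set). 1)"
    proof (rule sum_mono)
      fix i
      show "\<bar>(l N - of_nat N *\<^sub>R y) $ i\<bar> \<le> 1"
        unfolding l_def using floor_correct[of "of_nat N * y $ i"] by (simp add: abs_le_iff) linarith
    qed
    finally show ?thesis using B(1) by (simp add: mult_left_mono)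
  qed
  then have "bounded (range (\<lambda>N. f (l N)))" by (auto simp: bounded_iff)
  then obtain a r where r: "strict_mono r" "((\<lambda>N. f (l N)) \<circ> r) \<longlonglongrightarrow> a"
    using bounded_imp_convergent_subsequence by blast
  then have "Cauchy ((\<lambda>N. f (l N)) \<circ> r)" by (intro LIMSEQ_imp_Cauchy)
  then obtain M where M: "\<And>m n. m \<ge> M \<Longrightarrow> n \<ge> M \<Longrightarrow> norm (f (l (r m)) - f (l (r n))) < e"
    using assms unfolding Cauchy_iff o_def by blast
  define d where "d = l (r (Suc M)) - l (r M)"
  have "r M < r (Suc M)" using r(1) by (simp add: strict_mono_def)
  then have "d $ j \<noteq> 0" by (simp add: d_def l_def y(2))
  then have d0: "d \<noteq> 0" by auto
  have "d \<in> int_lattice" by (simp add: d_def l_def int_lattice_def)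
  then obtain x where x: "real_point d = ce x" "algebraic_int x"
    using lat_cases lat_eq by blast
  have "x \<noteq> 0"
  proof
    assume "x = 0"
    then have "real_point d = real_point 0"
      using x(1) by (simp add: canonical_embedding_def vec_eq_iff linear_0[OF linear_real_point])
    then show False using d0 inj_real_point by (simp add: inj_eq)
  qed
  moreover have "cmod (\<sigma> (Inl i) x) < e" for i
  proof -
    have "\<bar>f d $ i\<bar> \<le> norm (f d)" by (rule component_le_norm_cart)
    also have "\<dots> < e" using M[of "Suc M" M] by (simp add: d_def linear_diff[OF lin])
    finally have "\<bar>f d $ i\<bar> < e" .
    moreover have "f d $ i = Re (\<sigma> (Inl i) x)"
      by (simp add: f_def x(1) proj_real_def canonical_embedding_def)
    ultimately show ?thesis by (simp add: cmod_def)
  qed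
  ultimately show ?thesis using x(2) by blast
qed

text \<open>The multiples of the lattice basis by a small integer \<open>x\<close> are small and span \<open>\<real>\<^sup>s\<close>: round the
  coefficients of \<open>r\<close> with respect to them.\<close>

lemma proj_real_lattice_dense:
  assumes "e > 0"
  shows "\<exists>z\<in>lat. norm (proj_real z - r) < e"
proof -
  define M where "M = (\<Sum>i\<in>(UNIV::'r set). \<Sum>j\<in>UNIV. cmod (\<beta> j $ Inl i)) + 1"
  have M: "M > 0" by (auto simp: M_def intro!: add_nonneg_pos sum_nonneg)
  then obtain x where x: "algebraic_int x" "x \<noteq> 0" "\<And>i. cmod (\<sigma> (Inl i) x) < e / M"
    using small_integer[of "e / M"] assms by auto
  let ?x = "\<lambda>i. Re (\<sigma> (Inl i) x)"
  have x0: "?x i \<noteq> 0" for i using x(2) emb_eq_0[of "Inl i" x] emb_Im[of i x] by (metis complex_eq_0 complex_eq_iff zero_complex.simps)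
  have xe: "\<bar>?x i\<bar> < e / M" for i using x(3)[of i] by (simp add: cmod_def)
  define z0 :: "complex ^ ('r + 'c + 'c)"
    where "z0 = (\<chi> i. case i of Inl i \<Rightarrow> of_real (r $ i / ?x i) | Inr _ \<Rightarrow> 0)"
  define c where "c j = Re (basis_coords \<beta> z0 $ j)" for j
  have c: "r $ i = ?x i * (\<Sum>j\<in>UNIV. c j * Re (\<beta> j $ Inl i))" for i
  proof -
    have "from_coords (basis_coords \<beta> z0) $ Inl i = of_real (r $ i / ?x i)" by (simp add: z0_def)
    then have "Re (\<Sum>j\<in>UNIV. basis_coords \<beta> z0 $ j * \<beta> j $ Inl i) = r $ i / ?x i"
      by (simp add: from_coords_def)
    then have "(\<Sum>j\<in>UNIV. c j * Re (\<beta> j $ Inl i)) = r $ i / ?x i"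
      using lat_real[OF basis_in_lat] by (simp add: c_def)
    then show ?thesis using x0 by simp
  qed
  define l where "l = (\<Sum>j\<in>UNIV. of_int \<lfloor>c j\<rfloor> *\<^sub>R \<beta> j)"
  have "l \<in> lat" unfolding l_def by (rule zbasisD(1)[OF zbasis])
  then obtain w where w: "l = ce w" "algebraic_int w" using lat_cases by blast
  define z where "z = ce (x * w)"
  have "z \<in> lat" unfolding z_def using x(1) w(2) algebraic_int_mult lat_iff by blast
  have z: "proj_real z $ i = ?x i * (\<Sum>j\<in>UNIV. of_int \<lfloor>c j\<rfloor> * Re (\<beta> j $ Inl i))" for i
  proof -
    have "proj_real z $ i = ?x i * Re (l $ Inl i)"
      by (simp add: z_def proj_real_def w(1) canonical_embedding_def)
    then show ?thesis by (simp add: l_def)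
  qed
  have "\<bar>(proj_real z - r) $ i\<bar> \<le> e / M * (\<Sum>j\<in>UNIV. cmod (\<beta> j $ Inl i))" for i
  proof -
    have "(proj_real z - r) $ i = ?x i * (\<Sum>j\<in>UNIV. (of_int \<lfloor>c j\<rfloor> - c j) * Re (\<beta> j $ Inl i))"
      by (simp add: z c[of i] sum_subtractf algebra_simps)
    also have "\<bar>\<dots>\<bar> = \<bar>?x i\<bar> * \<bar>\<Sum>j\<in>UNIV. (of_int \<lfloor>c j\<rfloor> - c j) * Re (\<beta> j $ Inl i)\<bar>"
      by (rule abs_mult)
    also have "\<dots> \<le> e / M * (\<Sum>j\<in>UNIV. \<bar>(of_int \<lfloor>c j\<rfloor> - c j) * Re (\<beta> j $ Inl i)\<bar>)"
      using xe[of i] by (intro mult_mono sum_abs) (auto simp: less_imp_le)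
    also have "\<dots> \<le> e / M * (\<Sum>j\<in>UNIV. cmod (\<beta> j $ Inl i))"
    proof (intro mult_left_mono sum_mono)
      fix j
      have "\<bar>of_int \<lfloor>c j\<rfloor> - c j\<bar> \<le> 1" using floor_correct[of "c j"] by linarith
      then have "\<bar>of_int \<lfloor>c j\<rfloor> - c j\<bar> * \<bar>Re (\<beta> j $ Inl i)\<bar> \<le> 1 * cmod (\<beta> j $ Inl i)"
        by (intro mult_mono abs_Re_le_cmod) auto
      then show "\<bar>(of_int \<lfloor>c j\<rfloor> - c j) * Re (\<beta> j $ Inl i)\<bar> \<le> cmod (\<beta> j $ Inl i)"
        by (simp add: abs_mult)
    qed (use assms M in auto)
    finally show ?thesis .
  qed
  then have "norm (proj_real z - r) \<le> (\<Sum>i\<in>UNIV. e / M * (\<Sum>j\<in>UNIV. cmod (\<beta> j $ Inl i)))"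
    by (intro order_trans[OF norm_le_l1_cart] sum_mono)
  also have "\<dots> = e / M * (M - 1)" by (simp add: M_def sum_distrib_left)
  also have "\<dots> < e" using assms M by (simp add: field_simps)
  finally show ?thesis using \<open>z \<in> lat\<close> by blast
qed

end

section \<open>Nonsingular cones and toric charts\<close>

lemma int_lattice_inner: "m \<in> int_lattice \<Longrightarrow> x \<in> int_lattice \<Longrightarrow> m \<bullet> x \<in> \<int>"
  by (auto simp: int_lattice_def inner_vec_def intro!: Ints_sum)

lemma int_lattice_simps [simp]: "0 \<in> int_lattice" "axis i 1 \<in> int_lattice"
  by (auto simp: int_lattice_def axis_def)

lemma int_lattice_arith:
  "x \<in> int_lattice \<Longrightarrow> y \<in> int_lattice \<Longrightarrow> x + y \<in> int_lattice"
  "k \<in> \<int> \<Longrightarrow> x \<in> int_lattice \<Longrightarrow> k *\<^sub>R x \<in> int_lattice"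
  by (auto simp: int_lattice_def)

lemma int_lattice_sum: "(\<And>j. j \<in> S \<Longrightarrow> f j \<in> int_lattice) \<Longrightarrow> sum f S \<in> int_lattice"
  by (induction S rule: infinite_finite_induct) (auto intro: int_lattice_arith)

definition dual_bases :: "('n \<Rightarrow> real ^ 'n) \<Rightarrow> ('n \<Rightarrow> real ^ 'n) \<Rightarrow> bool" where
  "dual_bases v m \<longleftrightarrow> range v \<subseteq> int_lattice \<and> range m \<subseteq> int_lattice \<and>
     (\<forall>i j. m j \<bullet> v i = (if i = j then 1 else 0))"

lemma dual_basesD:
  assumes "dual_bases v m"
  shows "v j \<in> int_lattice" "m j \<in> int_lattice" "m j \<bullet> v i = (if i = j then 1 else 0)"
  using assms by (auto simp: dual_bases_def)

lemma dual_bases_iff: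
  fixes v m :: "'n::finite \<Rightarrow> real ^ 'n"
  defines "V \<equiv> (\<chi> i j. v j $ i)" and "M \<equiv> (\<chi> j i. m j $ i)"
  shows "(\<forall>i j. m j \<bullet> v i = (if i = j then 1 else 0)) \<longleftrightarrow> M ** V = mat 1"
  by (auto simp: matrix_matrix_mult_def mat_def vec_eq_iff V_def M_def inner_vec_def)

lemma dual_expand:
  assumes "dual_bases v m"
  shows "x = (\<Sum>j\<in>UNIV. (m j \<bullet> x) *\<^sub>R v j)" and "y = (\<Sum>j\<in>UNIV. (y \<bullet> v j) *\<^sub>R m j)"
proof -
  define V M where "V = (\<chi> i j. v j $ i)" and "M = (\<chi> j i. m j $ i)"
  have "M ** V = mat 1"
    using assms dual_bases_iff[where v = v and m = m] unfolding V_def M_def dual_bases_def by blast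
  then have VM: "V ** M = mat 1" by (simp add: matrix_left_right_inverse)
  have "V *v (M *v x) = x" by (simp add: matrix_vector_mul_assoc VM)
  then show "x = (\<Sum>j\<in>UNIV. (m j \<bullet> x) *\<^sub>R v j)"
    by (simp add: V_def M_def matrix_vector_mult_def inner_vec_def vec_eq_iff mult.commute)
  have "(y v* V) v* M = y" by (simp add: vector_matrix_mul_assoc VM)
  then show "y = (\<Sum>j\<in>UNIV. (y \<bullet> v j) *\<^sub>R m j)"
    by (simp add: V_def M_def vector_matrix_mult_def inner_vec_def vec_eq_iff mult.commute)
qed

lemma zbasis_int_lattice_iff: "zbasis v int_lattice \<longleftrightarrow> (\<exists>m. dual_bases v m)" for v :: "'n::finite \<Rightarrow> real ^ 'n"
proof
  assume z: "zbasis v int_lattice"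
  then have "\<exists>k. axis i 1 = (\<Sum>j\<in>UNIV. of_int (k j) *\<^sub>R v j)" for i
    using zbasisD(2)[OF z] by simp
  then obtain k where k: "\<And>i. axis i 1 = (\<Sum>j\<in>UNIV. of_int (k i j) *\<^sub>R v j)" by metis
  define m :: "'n \<Rightarrow> real ^ 'n" where "m j = (\<chi> i. of_int (k i j))" for j
  have "(\<chi> i j. v j $ i) ** (\<chi> j i. m j $ i) = (mat 1 :: real ^ 'n ^ 'n)"
  proof -
    have "(\<Sum>j\<in>UNIV. v j $ a * of_int (k c j)) = (axis c 1 :: real ^ 'n) $ a" for a c
      by (subst k) (simp add: mult.commute)
    then show ?thesis
      by (simp add: matrix_matrix_mult_def mat_def vec_eq_iff m_def axis_def)
  qed
  then have "\<forall>i j. m j \<bullet> v i = (if i = j then 1 else 0)"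
    using dual_bases_iff[where v = v and m = m] by (simp add: matrix_left_right_inverse)
  moreover have "v j \<in> int_lattice" for j
  proof -
    have "v j = (\<Sum>i\<in>UNIV. of_int (if i = j then 1 else 0) *\<^sub>R v i)"
      by (simp add: if_distrib[of of_int] if_distrib[of "\<lambda>t. t *\<^sub>R _"] cong: if_cong)
    then show ?thesis using zbasisD(1)[OF z] by metis
  qed
  ultimately show "\<exists>m. dual_bases v m"
    by (intro exI[of _ m]) (auto simp: dual_bases_def m_def int_lattice_def)
next
  assume "\<exists>m. dual_bases v m"
  then obtain m where d: "dual_bases v m" by blast
  show "zbasis v int_lattice"
    unfolding zbasis_def bij_betw_def
  proof
    have "m i \<bullet> (\<Sum>j\<in>UNIV. of_int (k j) *\<^sub>R v j) = of_int (k i)" for k :: "'n \<Rightarrow> int" and i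
      by (simp add: inner_sum_right dual_basesD(3)[OF d] if_distrib[of "\<lambda>t. _ * t"] cong: if_cong)
    note coeff = this
    show "inj (\<lambda>k::'n \<Rightarrow> int. \<Sum>i\<in>UNIV. of_int (k i) *\<^sub>R v i)"
    proof (rule injI, rule ext)
      fix k k' :: "'n \<Rightarrow> int" and i
      assume "(\<Sum>i\<in>UNIV. of_int (k i) *\<^sub>R v i) = (\<Sum>i\<in>UNIV. of_int (k' i) *\<^sub>R v i)"
      then have "real_of_int (k i) = of_int (k' i)" using coeff[of i k] coeff[of i k'] by simp
      then show "k i = k' i" by simp
    qed
    show "range (\<lambda>k::'n \<Rightarrow> int. \<Sum>i\<in>UNIV. of_int (k i) *\<^sub>R v i) = int_lattice"
    proof (intro equalityI subsetI)
      fix x :: "real ^ 'n" assume x: "x \<in> int_lattice"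
      have "\<forall>j. \<exists>k. m j \<bullet> x = of_int k"
        using int_lattice_inner[OF dual_basesD(2)[OF d] x] by (meson Ints_cases)
      then obtain k where "\<And>j. m j \<bullet> x = of_int (k j)" by metis
      then have "x = (\<Sum>j\<in>UNIV. of_int (k j) *\<^sub>R v j)" using dual_expand(1)[OF d, of x] by simp
      then show "x \<in> range (\<lambda>k::'n \<Rightarrow> int. \<Sum>i\<in>UNIV. of_int (k i) *\<^sub>R v i)" by blast
    qed (auto intro!: int_lattice_sum int_lattice_arith dual_basesD(1)[OF d])
  qed
qed

lemma cone_hull_dual:
  assumes d: "dual_bases v m"
  shows "convex_cone hull (v ` J) = {x. \<forall>j. if j \<in> J then m j \<bullet> x \<ge> 0 else m j \<bullet> x = 0}"
    (is "?L = ?R")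
proof
  have "convex_cone ?R"
    unfolding convex_cone_def
  proof (intro conjI)
    show "?R \<noteq> {}" by (auto intro: exI[of _ 0])
    show "convex ?R" unfolding convex_def by (auto simp: inner_add_right)
    show "conic ?R" unfolding conic_def by auto
  qed
  moreover have "v ` J \<subseteq> ?R" by (auto simp: dual_basesD(3)[OF d])
  ultimately show "?L \<subseteq> ?R" by (rule hull_minimal[rotated])
  show "?R \<subseteq> ?L"
  proof
    fix x assume x: "x \<in> ?R"
    have part: "(\<Sum>j\<in>S. (m j \<bullet> x) *\<^sub>R v j) \<in> ?L" for S
    proof (induction S rule: infinite_finite_induct)
      case (insert j S)
      have "(m j \<bullet> x) *\<^sub>R v j \<in> ?L"
      proof (cases "j \<in> J")
        case True
        then have "m j \<bullet> x \<ge> 0" using x by (auto dest: spec[of _ j])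
        then show ?thesis using True by (intro convex_cone_hull_mul hull_inc) auto
      next
        case False
        then have "m j \<bullet> x = 0" using x by (auto dest: spec[of _ j])
        then show ?thesis by (simp add: convex_cone_hull_contains_0)
      qed
      then show ?case using insert by (simp add: convex_cone_hull_add)
    qed (simp_all add: convex_cone_hull_contains_0)
    show "x \<in> ?L" using part[of UNIV] dual_expand(1)[OF d, of x] by simp
  qed
qed

lemma cone_hull_face:
  assumes d: "dual_bases v m" and "I \<subseteq> J"
  shows "(convex_cone hull (v ` I)) face_of (convex_cone hull (v ` J))"
  unfolding face_of_def
proof (intro conjI ballI impI)
  show "convex_cone hull (v ` I) \<subseteq> convex_cone hull (v ` J)"
    using assms(2) by (intro hull_mono) auto
  show "convex (convex_cone hull (v ` I))" by (rule convex_convex_cone_hull)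
  fix a c x assume a: "a \<in> convex_cone hull (v ` J)" and c: "c \<in> convex_cone hull (v ` J)"
    and x: "x \<in> convex_cone hull (v ` I)" "x \<in> open_segment a c"
  obtain t where t: "0 < t" "t < 1" "x = (1 - t) *\<^sub>R a + t *\<^sub>R c"
    using x(2) by (auto simp: in_segment)
  have "m j \<bullet> a = 0 \<and> m j \<bullet> c = 0" if "j \<notin> I" for j
  proof -
    have nn: "m j \<bullet> a \<ge> 0" "m j \<bullet> c \<ge> 0"
      using a c unfolding cone_hull_dual[OF d] by (auto dest!: spec[of _ j] split: if_splits)
    moreover have "(1 - t) * (m j \<bullet> a) + t * (m j \<bullet> c) = 0"
      using x(1) that unfolding cone_hull_dual[OF d] t(3)
      by (auto dest!: spec[of _ j] simp: inner_add_right)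
    moreover have "(1 - t) * (m j \<bullet> a) \<ge> 0" "t * (m j \<bullet> c) \<ge> 0" using nn t(1,2) by auto
    ultimately have "(1 - t) * (m j \<bullet> a) = 0" "t * (m j \<bullet> c) = 0" by linarith+
    then show ?thesis using t(1,2) by simp
  qed
  moreover have "m j \<bullet> a \<ge> 0 \<and> m j \<bullet> c \<ge> 0" if "j \<in> I" for j
    using a c \<open>I \<subseteq> J\<close> that unfolding cone_hull_dual[OF d] mem_Collect_eq by (metis subsetD)
  ultimately show "a \<in> convex_cone hull (v ` I)" "c \<in> convex_cone hull (v ` I)"
    unfolding cone_hull_dual[OF d] by auto
qed

lemma toric_points_simps:
  assumes "(\<tau>, x) \<in> toric_points F"
  shows "\<tau> \<in> F" "x m \<noteq> 0 \<longleftrightarrow> m \<in> orth_chars \<tau>"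
    "m \<in> orth_chars \<tau> \<Longrightarrow> m' \<in> orth_chars \<tau> \<Longrightarrow> x (m + m') = x m * x m'"
  using assms by (auto simp: toric_points_def)

lemma orth_chars_arith:
  "0 \<in> orth_chars \<tau>"
  "m \<in> orth_chars \<tau> \<Longrightarrow> m' \<in> orth_chars \<tau> \<Longrightarrow> m + m' \<in> orth_chars \<tau>"
  "m \<in> orth_chars \<tau> \<Longrightarrow> of_int k *\<^sub>R m \<in> orth_chars \<tau>"
  by (auto simp: orth_chars_def int_lattice_arith inner_add_left)

lemma toric_point_0: "(\<tau>, x) \<in> toric_points F \<Longrightarrow> x 0 = 1"
  using toric_points_simps(2)[of \<tau> x F 0] toric_points_simps(3)[of \<tau> x F 0 0] orth_chars_arith(1)
  by fastforce

lemma toric_point_scale: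
  assumes p: "(\<tau>, x) \<in> toric_points F" and m: "m \<in> orth_chars \<tau>"
  shows "x (of_int k *\<^sub>R m) = x m powi k"
proof -
  have nat: "x (of_nat n *\<^sub>R m) = x m ^ n" for n
  proof (induction n)
    case 0
    then show ?case using toric_point_0[OF p] by simp
  next
    case (Suc n)
    have "x (m + of_nat n *\<^sub>R m) = x m * x (of_nat n *\<^sub>R m)"
      using toric_points_simps(3)[OF p m, of "of_nat n *\<^sub>R m"] orth_chars_arith(3)[OF m, of "int n"] by simp
    then show ?case using Suc by (simp add: scaleR_add_left)
  qed
  show ?thesis
  proof (cases "k \<ge> 0")
    case True
    then show ?thesis using nat[of "nat k"] by (simp add: power_int_def)
  next
    case False
    have "x (of_int k *\<^sub>R m + of_int (- k) *\<^sub>R m) = x (of_int k *\<^sub>R m) * x (of_int (- k) *\<^sub>R m)"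
      using toric_points_simps(3)[OF p] orth_chars_arith(3)[OF m] by blast
    then have "1 = x (of_int k *\<^sub>R m) * x m ^ nat (- k)"
      using False nat[of "nat (- k)"] toric_point_0[OF p] by simp
    moreover have "x m \<noteq> 0" using toric_points_simps(2)[OF p] m by blast
    ultimately show ?thesis using False by (simp add: power_int_def field_simps)
  qed
qed

lemma toric_point_sum:
  assumes p: "(\<tau>, x) \<in> toric_points F" and S: "\<And>j. j \<in> S \<Longrightarrow> m j \<in> orth_chars \<tau>"
  shows "x (\<Sum>j\<in>S. of_int (k j) *\<^sub>R m j) = (\<Prod>j\<in>S. x (m j) powi k j)"
proof -
  have "(\<Sum>j\<in>S. of_int (k j) *\<^sub>R m j) \<in> orth_chars \<tau> \<and>
     x (\<Sum>j\<in>S. of_int (k j) *\<^sub>R m j) = (\<Prod>j\<in>S. x (m j) powi k j)"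
    using S
  proof (induction S rule: infinite_finite_induct)
    case (insert j S)
    have "of_int (k j) *\<^sub>R m j \<in> orth_chars \<tau>" using insert.prems by (intro orth_chars_arith(3)) simp
    moreover have "x (of_int (k j) *\<^sub>R m j) = x (m j) powi k j"
      using insert.prems by (intro toric_point_scale[OF p]) simp
    moreover have "(\<Sum>j\<in>S. of_int (k j) *\<^sub>R m j) \<in> orth_chars \<tau>"
      "x (\<Sum>j\<in>S. of_int (k j) *\<^sub>R m j) = (\<Prod>j\<in>S. x (m j) powi k j)"
      using insert.IH insert.prems by auto
    ultimately show ?case
      unfolding sum.insert[OF insert.hyps] prod.insert[OF insert.hyps]
      by (simp only: toric_points_simps(3)[OF p] orth_chars_arith(2) simp_thms)
  qed (simp_all add: orth_chars_arith toric_point_0[OF p])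
  then show ?thesis ..
qed

lemma toric_point_expand:
  assumes p: "(\<tau>, x) \<in> toric_points F" and d: "dual_bases v m"
    and y: "y \<in> orth_chars \<tau>" and S: "\<And>j. j \<notin> S \<Longrightarrow> y \<bullet> v j = 0" "\<And>j. j \<in> S \<Longrightarrow> m j \<in> orth_chars \<tau>"
  shows "x y = (\<Prod>j\<in>S. x (m j) powi \<lfloor>y \<bullet> v j\<rfloor>)"
proof -
  have int: "y \<bullet> v j = of_int \<lfloor>y \<bullet> v j\<rfloor>" for j
  proof -
    have "y \<bullet> v j \<in> \<int>"
      using y dual_basesD(1)[OF d, of j] by (auto simp: orth_chars_def intro: int_lattice_inner)
    then show ?thesis by (metis Ints_cases floor_of_int)
  qed
  have "y = (\<Sum>j\<in>UNIV. (y \<bullet> v j) *\<^sub>R m j)" by (rule dual_expand(2)[OF d])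
  also have "\<dots> = (\<Sum>j\<in>S. (y \<bullet> v j) *\<^sub>R m j)"
    by (rule sum.mono_neutral_right) (auto simp: S(1))
  also have "\<dots> = (\<Sum>j\<in>S. of_int \<lfloor>y \<bullet> v j\<rfloor> *\<^sub>R m j)" by (intro sum.cong refl) (metis int)
  finally show ?thesis using toric_point_sum[OF p, of S m "\<lambda>j. \<lfloor>y \<bullet> v j\<rfloor>"] S(2) by simp
qed

abbreviation ray_cone :: "('a::real_vector) \<Rightarrow> 'a set" where "ray_cone w \<equiv> convex_cone hull {w}"

lemma ray_cone_eq: "ray_cone w = {r *\<^sub>R w | r. r \<ge> 0}"
proof
  have cc: "convex_cone {r *\<^sub>R w | r. r \<ge> 0}"
    unfolding convex_cone_def
  proof (intro conjI)
    show "{r *\<^sub>R w | r. r \<ge> 0} \<noteq> {}" by auto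
    show "conic {r *\<^sub>R w | r. r \<ge> 0}" unfolding conic_def by (auto intro!: exI[of _ "_ * _"])
    have "\<exists>r\<ge>0. u *\<^sub>R p *\<^sub>R w + v *\<^sub>R q *\<^sub>R w = r *\<^sub>R w"
      if "u \<ge> 0" "v \<ge> 0" "p \<ge> 0" "q \<ge> 0" for u v p q :: real
      using that by (intro exI[of _ "u * p + v * q"]) (auto simp: scaleR_add_left)
    then show "convex {r *\<^sub>R w | r. r \<ge> 0}" by (intro convexI) blast
  qed
  have "w \<in> {r *\<^sub>R w | r. r \<ge> 0}"
    by (rule CollectI, rule exI[of _ 1]) simp
  then show "ray_cone w \<subseteq> {r *\<^sub>R w | r. r \<ge> 0}"
    by (intro hull_minimal[where S = convex_cone, OF _ cc]) blast
  show "{r *\<^sub>R w | r. r \<ge> 0} \<subseteq> ray_cone w"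
    by (auto intro!: convex_cone_hull_mul simp: hull_inc)
qed

text \<open>The coordinate \<open>j1\<close> vanishes exactly on the divisor of the ray and so determines the orbit; the values
  of a point on its orthogonal characters are products of coordinates.\<close>

lemma ray_chart_inj:
  assumes d: "dual_bases v m"
    and F: "\<And>\<tau>. \<tau> \<in> F \<Longrightarrow> convex_cone \<tau>"
    and p: "p \<in> toric_points F" "fst p face_of ray_cone (v j1)"
    and q: "q \<in> toric_points F" "fst q face_of ray_cone (v j1)"
    and eq: "\<And>j. snd p (m j) = snd q (m j)"
  shows "p = q"
proof -
  obtain \<tau> x \<tau>' x' where pq: "p = (\<tau>, x)" "q = (\<tau>', x')" by (cases p, cases q)
  note p' = p[unfolded pq fst_conv] and q' = q[unfolded pq fst_conv]
  have face: "\<tau> = (if x (m j1) = 0 then ray_cone (v j1) else {0})"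
    if p: "(\<tau>, x) \<in> toric_points F" "\<tau> face_of ray_cone (v j1)" for \<tau> x
  proof -
    have sub: "\<tau> \<subseteq> {r *\<^sub>R v j1 | r. r \<ge> 0}"
      using face_of_imp_subset[OF p(2)] by (simp add: ray_cone_eq)
    have cone: "convex_cone \<tau>" using F toric_points_simps(1)[OF p(1)] by blast
    have z: "0 \<in> \<tau>" using cone by (simp add: convex_cone_contains_0)
    show ?thesis
    proof (cases "x (m j1) = 0")
      case True
      then have "m j1 \<notin> orth_chars \<tau>" using toric_points_simps(2)[OF p(1)] by blast
      then obtain y where y: "y \<in> \<tau>" "m j1 \<bullet> y \<noteq> 0"
        using dual_basesD(2)[OF d] by (auto simp: orth_chars_def)
      then obtain r where r: "y = r *\<^sub>R v j1" "r \<ge> 0" using sub by blast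
      then have r0: "r > 0" using y(2) by (cases "r = 0") auto
      have "s *\<^sub>R v j1 \<in> \<tau>" if "s \<ge> 0" for s
      proof -
        have "(s / r) *\<^sub>R y \<in> \<tau>"
          using cone y(1) that r0 unfolding convex_cone_def conic_def by auto
        then show ?thesis using r r0 by simp
      qed
      then have "ray_cone (v j1) \<subseteq> \<tau>" by (auto simp: ray_cone_eq)
      then show ?thesis using True sub by (auto simp: ray_cone_eq)
    next
      case False
      then have "m j1 \<in> orth_chars \<tau>" using toric_points_simps(2)[OF p(1)] by blast
      then have "r *\<^sub>R v j1 \<in> \<tau> \<Longrightarrow> r = 0" for r
        using dual_basesD(3)[OF d, of j1 j1] by (auto simp: orth_chars_def)
      then have "\<tau> \<subseteq> {0}" using sub by fastforce
      then show ?thesis using z False by auto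
    qed
  qed
  have "x (m j1) = x' (m j1)" using eq[of j1] by (simp add: pq)
  then have \<tau>: "\<tau> = \<tau>'" using face[OF p'] face[OF q'] by simp
  have "x y = x' y" for y
  proof (cases "y \<in> orth_chars \<tau>")
    case True
    define S where "S = {j. m j \<in> orth_chars \<tau>}"
    have S: "y \<bullet> v j = 0" if "j \<notin> S" for j
    proof -
      have "m j \<notin> orth_chars \<tau>" using that by (simp add: S_def)
      then obtain z where z: "z \<in> \<tau>" "m j \<bullet> z \<noteq> 0"
        using dual_basesD(2)[OF d] by (auto simp: orth_chars_def)
      then obtain r where r: "z = r *\<^sub>R v j1"
        using face_of_imp_subset[OF p'(2)] by (auto simp: ray_cone_eq)
      then have "j = j1" "r \<noteq> 0" using z(2) dual_basesD(3)[OF d, of j j1] by (auto split: if_splits)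
      moreover have "y \<bullet> z = 0" using True z(1) by (simp add: orth_chars_def)
      ultimately show ?thesis using r by simp
    qed
    have "x y = (\<Prod>j\<in>S. x (m j) powi \<lfloor>y \<bullet> v j\<rfloor>)"
      by (rule toric_point_expand[OF p'(1) d True S]) (simp_all add: S_def)
    moreover have "x' y = (\<Prod>j\<in>S. x' (m j) powi \<lfloor>y \<bullet> v j\<rfloor>)"
      by (rule toric_point_expand[OF q'(1) d True[unfolded \<tau>] S]) (simp_all add: S_def \<tau>[symmetric])
    moreover have "x (m j) = x' (m j)" for j using eq by (simp add: pq)
    ultimately show ?thesis by simp
  next
    case False
    then show ?thesis using toric_points_simps(2)[OF p'(1)] toric_points_simps(2)[OF q'(1)] \<tau> by metis
  qed
  then show ?thesis by (simp add: pq \<tau> ext)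
qed

lemma toric_chartI:
  assumes "\<sigma> \<in> F" "dual_bases v m" "\<sigma> = convex_cone hull (v ` J)"
  shows "({p \<in> toric_points F. fst p face_of \<sigma>}, \<lambda>p. \<chi> j. snd p (m j)) \<in> toric_charts F"
proof -
  have "zbasis v int_lattice" using assms(2) zbasis_int_lattice_iff by blast
  moreover have "range m \<subseteq> int_lattice" "\<forall>i j. m j \<bullet> v i = (if i = j then 1 else 0)"
    using assms(2) by (auto simp: dual_bases_def)
  ultimately show ?thesis
    unfolding toric_charts_def using assms(1,3)
    by (intro CollectI exI[of _ \<sigma>] exI[of _ v] exI[of _ m] exI[of _ J] conjI refl) assumption+
qed

lemma toric_chartE:
  assumes "c \<in> toric_charts F"
  obtains \<sigma> v m J where "\<sigma> \<in> F" "dual_bases v m" "\<sigma> = convex_cone hull (v ` J)"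
    "c = ({p \<in> toric_points F. fst p face_of \<sigma>}, \<lambda>p. \<chi> j. snd p (m j))"
proof -
  obtain \<sigma> v m J where c: "\<sigma> \<in> F" "zbasis v int_lattice" "\<sigma> = convex_cone hull (v ` J)"
    "range m \<subseteq> int_lattice" "\<forall>i j. m j \<bullet> v i = (if i = j then 1 else 0)"
    "c = ({p \<in> toric_points F. fst p face_of \<sigma>}, \<lambda>p. \<chi> j. snd p (m j))"
    using assms unfolding toric_charts_def by (elim CollectE exE conjE) (rule that)
  have "range v \<subseteq> int_lattice" using c(2) dual_basesD(1) by (auto simp: zbasis_int_lattice_iff)
  then have "dual_bases v m" using c by (simp add: dual_bases_def)
  then show ?thesis using that[of \<sigma> v m J] c by simp
qed

section \<open>The toric manifold and its unit automorphisms\<close>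

definition pairing :: "real ^ 'n \<Rightarrow> complex ^ 'n \<Rightarrow> complex" where
  "pairing m c = (\<Sum>i\<in>UNIV. of_real (m $ i) * c $ i)"

lemma pairing_simps:
  "pairing m (c + c') = pairing m c + pairing m c'"
  "pairing m (c - c') = pairing m c - pairing m c'"
  "pairing (m + m') c = pairing m c + pairing m' c"
  "pairing m (a *s c) = a * pairing m c"
  "pairing 0 c = 0" "pairing m 0 = 0"
  by (simp_all add: pairing_def algebra_simps sum.distrib sum_subtractf sum_distrib_left)

lemma exp_powi: "exp (x::complex) powi k = exp (of_int k * x)"
proof (cases "k \<ge> 0")
  case True
  then show ?thesis by (simp add: power_int_def exp_of_nat_mult[symmetric])
next
  case False
  then have "exp x powi k = inverse (exp (of_nat (nat (- k)) * x))"
    by (simp add: power_int_def exp_of_nat_mult[symmetric] power_inverse)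
  also have "of_nat (nat (- k)) * x = - (of_int k * x)" using False by simp
  finally show ?thesis by (simp add: exp_minus)
qed

lemma is_fan_pointed: "is_fan F \<Longrightarrow> \<tau> \<in> F \<Longrightarrow> \<tau> \<inter> uminus ` \<tau> = {0}"
  unfolding is_fan_def by (elim conjE) (drule (1) bspec, elim conjE)

lemma orth_chars_0: "orth_chars {0} = int_lattice"
  by (simp add: orth_chars_def)

context unit_fan_data
begin

declare transpose_matrix_vector [simp del]

lemma pairing_cvec: "pairing m (cvec x) = of_real (m \<bullet> x)"
  by (simp add: pairing_def cvec_def inner_vec_def)

lemma pairing_cmat: "pairing m (cmat A *v c) = pairing (transpose A *v m) c"
proof -
  have "pairing m (cmat A *v c) = (\<Sum>i\<in>UNIV. \<Sum>j\<in>UNIV. of_real (m $ i) * of_real (A $ i $ j) * c $ j)"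
    by (simp add: pairing_def cmat_def matrix_vector_mult_def sum_distrib_left mult.assoc)
  also have "\<dots> = (\<Sum>j\<in>UNIV. \<Sum>i\<in>UNIV. of_real (m $ i) * of_real (A $ i $ j) * c $ j)"
    by (rule sum.swap)
  also have "\<dots> = pairing (transpose A *v m) c"
    by (simp add: pairing_def transpose_def matrix_vector_mult_def sum_distrib_left mult_ac)
  finally show ?thesis .
qed

abbreviation Fan :: "(real ^ ('r + 'c + 'c)) set set" where
  "Fan \<equiv> image (real_coords \<beta>) ` \<Delta>"

lemma Delta_facts:
  "is_fan \<Delta>" "\<And>\<rho>. \<rho> \<in> \<Delta> \<Longrightarrow> \<rho> \<subseteq> span lat" "fan_stable (unit_act \<sigma>) W \<Delta>"
  "nonsingular_fan TYPE('r + 'c + 'c) \<Delta> lat" "inj_on proj_real (\<Union> \<Delta>)" "bij_betw (image proj_real) \<Delta> \<Delta>'"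
  using lift unfolding lifted_fan_def by auto

lemma Delta'_facts:
  "is_fan \<Delta>'" "infinite \<Delta>'" "fan_stable (real_unit_act \<sigma>) W \<Delta>'"
  "\<Union> \<Delta>' = (Omega TYPE('c) b - L_plus TYPE('c) b) \<union> {0}"
  "cones_generated_by \<Delta>' (proj_real ` lat)" "fan_action_free (real_unit_act \<sigma>) W \<Delta>'"
  using base unfolding base_fan_def by auto

lemma real_point_image: "\<rho> \<in> \<Delta> \<Longrightarrow> real_point ` (real_coords \<beta> ` \<rho>) = \<rho>"
proof -
  assume "\<rho> \<in> \<Delta>"
  then have "real_point (real_coords \<beta> z) = z" if "z \<in> \<rho>" for z
    using Delta_facts(2) that real_point_real_coords by blast
  then show ?thesis by (simp add: image_image)
qed

lemma Fan_iff: "\<tau> \<in> Fan \<longleftrightarrow> real_point ` \<tau> \<in> \<Delta>"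
proof
  assume "\<tau> \<in> Fan" then show "real_point ` \<tau> \<in> \<Delta>" by (auto simp: real_point_image)
next
  assume "real_point ` \<tau> \<in> \<Delta>"
  then have "real_coords \<beta> ` real_point ` \<tau> \<in> Fan" by (rule imageI)
  then show "\<tau> \<in> Fan" by (simp add: image_image)
qed

lemma Fan_cone:
  assumes "\<tau> \<in> Fan"
  obtains v m J where "dual_bases v m" "\<tau> = convex_cone hull (v ` J)"
proof -
  obtain v :: "'r + 'c + 'c \<Rightarrow> _" and J where v: "zbasis v lat" "real_point ` \<tau> = convex_cone hull (v ` J)"
    using Delta_facts(4)[unfolded nonsingular_fan_def, rule_format, OF assms[unfolded Fan_iff]]
    by (elim exE conjE) (rule that)
  define w where "w j = real_coords \<beta> (v j)" for j
  have bij: "bij_betw (real_coords \<beta>) lat int_lattice"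
    unfolding lat_eq by (intro bij_betwI[where g = real_point]) auto
  have "(\<lambda>k::'r + 'c + 'c \<Rightarrow> int. \<Sum>i\<in>UNIV. of_int (k i) *\<^sub>R w i) =
      real_coords \<beta> \<circ> (\<lambda>k. \<Sum>i\<in>UNIV. of_int (k i) *\<^sub>R v i)"
    by (simp add: w_def fun_eq_iff linear_sum[OF linear_real_coords] linear_scale[OF linear_real_coords])
  then have "zbasis w int_lattice"
    using bij_betw_trans[OF v(1)[unfolded zbasis_def] bij] by (simp add: zbasis_def)
  then obtain m where m: "dual_bases w m" by (auto simp: zbasis_int_lattice_iff)
  have "\<tau> = real_coords \<beta> ` real_point ` \<tau>" by (simp add: image_image)
  also have "\<dots> = convex_cone hull (w ` J)"
    unfolding v(2) w_def by (simp add: convex_cone_hull_linear_image[OF linear_real_coords, symmetric] image_image)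
  finally show ?thesis using that m by blast
qed

lemma Fan_convex_cone: "\<tau> \<in> Fan \<Longrightarrow> convex_cone \<tau>"
  by (erule Fan_cone) (simp add: convex_cone_convex_cone_hull)

lemma Fan_subface:
  assumes d: "dual_bases v m" and F: "convex_cone hull (v ` J) \<in> Fan" and I: "I \<subseteq> J"
  shows "convex_cone hull (v ` I) \<in> Fan"
proof -
  have "real_point ` (convex_cone hull (v ` I)) face_of real_point ` (convex_cone hull (v ` J))"
    using cone_hull_face[OF d I] face_of_linear_image[OF linear_real_point inj_real_point] by blast
  moreover have "real_point ` (convex_cone hull (v ` I)) \<noteq> {}"
    using convex_cone_hull_nonempty by blast
  ultimately show ?thesis
    using Delta_facts(1) F unfolding Fan_iff is_fan_def by blast
qed

lemma zero_cone_Fan: "{0} \<in> Fan"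
proof -
  obtain \<tau> where "\<tau> \<in> Fan"
    using Delta_facts(6) Delta'_facts(2) by (cases "\<Delta> = {}") (auto simp: bij_betw_def)
  then obtain v m J where "dual_bases v m" "\<tau> = convex_cone hull (v ` J)" by (rule Fan_cone)
  then show ?thesis using Fan_subface[of v m J "{}"] \<open>\<tau> \<in> Fan\<close> by simp
qed

lemma Fan_um: "u \<in> W \<Longrightarrow> \<tau> \<in> Fan \<Longrightarrow> (*v) (um u) ` \<tau> \<in> Fan"
proof -
  assume u: "u \<in> W" and "\<tau> \<in> Fan"
  then have "unit_act \<sigma> u ` real_point ` \<tau> \<in> \<Delta>"
    using Delta_facts(3) unfolding Fan_iff fan_stable_def by blast
  then show ?thesis unfolding Fan_iff using u by (simp add: image_image real_point_um)
qed

lemma Fan_proj: "\<tau> \<in> Fan \<Longrightarrow> proj_real ` real_point ` \<tau> \<in> \<Delta>'"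
  using Delta_facts(6) unfolding Fan_iff bij_betw_def by blast

text \<open>The support of the base fan meets the complement of \<open>\<Omega>\<close> in the origin only, and the projection is
  injective on the support of the lifted fan.\<close>

lemma Fan_Omega:
  assumes "\<tau> \<in> Fan" "x \<in> \<tau>" "x \<noteq> 0"
  shows "proj_real (real_point x) \<in> Omega TYPE('c) b"
proof -
  have "proj_real (real_point x) \<in> \<Union> \<Delta>'" using Fan_proj[OF assms(1)] assms(2) by blast
  moreover have "proj_real (real_point x) \<noteq> 0"
  proof
    assume "proj_real (real_point x) = 0"
    then have "proj_real (real_point x) = proj_real (real_point 0)"
      by (simp add: linear_0[OF linear_real_point] linear_0[OF linear_proj_real])
    moreover have "real_point x \<in> \<Union> \<Delta>" "real_point 0 \<in> \<Union> \<Delta>"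
      using assms zero_cone_Fan unfolding Fan_iff by blast+
    ultimately have "real_point x = real_point 0" using Delta_facts(5) by (meson inj_onD)
    then show False using assms(3) inj_real_point by (simp add: inj_eq)
  qed
  ultimately show ?thesis unfolding Delta'_facts(4) by blast
qed

lemma open_Omega: "open (Omega TYPE('c) b :: (real ^ 'r::{finite,linorder}) set)"
proof -
  have "Omega TYPE('c) b = (\<Inter>i\<in>{i. emb_index (Inl i :: 'r + 'c) \<le> b}. {x :: real ^ 'r::{finite,linorder}. 0 < x $ i})"
    by (auto simp: Omega_def)
  moreover have "open {x :: real ^ 'r::{finite,linorder}. 0 < x $ i}" for i
    by (intro open_Collect_less continuous_intros)
  ultimately show ?thesis by (simp only:) (intro open_INT; simp)
qed

lemma countable_Delta': "countable \<Delta>'"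
proof -
  have "countable (UNIV :: ('r + 'c + 'c \<Rightarrow> int) set)" by simp
  then have "countable ((\<lambda>k::'r + 'c + 'c \<Rightarrow> int. \<Sum>i\<in>UNIV. of_int (k i) *\<^sub>R \<beta> i) ` UNIV)"
    by (rule countable_image)
  then have "countable lat"
    by (simp only: bij_betw_imp_surj_on[OF zbasis[unfolded zbasis_def]])
  then have "countable (proj_real ` lat)" by (rule countable_image)
  then have "countable ((hull) convex_cone ` {S. finite S \<and> S \<subseteq> proj_real ` lat})"
    by (rule countable_image[OF countable_Collect_finite_subset])
  moreover have "\<Delta>' \<subseteq> (hull) convex_cone ` {S. finite S \<and> S \<subseteq> proj_real ` lat}"
    using Delta'_facts(5) unfolding cones_generated_by_def by blast
  ultimately show ?thesis by (rule countable_subset[rotated])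
qed

lemma Delta'_convex: "\<tau> \<in> \<Delta>' \<Longrightarrow> convex \<tau>"
  using Delta'_facts(5) unfolding cones_generated_by_def by (metis convex_convex_cone_hull)

text \<open>Cones without interior points are null sets. Countably many of them cannot cover an open set.\<close>

lemma big_cone:
  obtains v m J where "dual_bases v m" "convex_cone hull (v ` J) \<in> Fan"
    "interior (proj_real ` real_point ` (convex_cone hull (v ` J))) \<noteq> {}"
proof -
  obtain i2 :: 'r where i2: "emb_index (Inl i2 :: 'r + 'c) > b" using large_index by blast
  define V :: "(real ^ 'r::{finite,linorder}) set" where "V = Omega TYPE('c) b \<inter> - {x. x $ i2 = 0}"
  have "open V"
    unfolding V_def by (intro open_Int open_Omega open_Compl closed_Collect_eq continuous_intros)
  moreover have "(\<chi> i. 1) \<in> V" by (simp add: V_def Omega_def)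
  ultimately have "\<not> negligible V" using open_not_negligible by blast
  moreover have "V \<subseteq> \<Union> \<Delta>'"
    using i2 unfolding Delta'_facts(4) V_def L_plus_def by auto
  ultimately have "\<not> negligible (\<Union> \<Delta>')" by (meson negligible_subset)
  then obtain \<tau>' where \<tau>': "\<tau>' \<in> \<Delta>'" "\<not> negligible \<tau>'"
    using negligible_countable_Union[OF countable_Delta'] by blast
  then have int: "interior \<tau>' \<noteq> {}" using negligible_convex_interior Delta'_convex by blast
  obtain \<rho> where \<rho>: "\<rho> \<in> \<Delta>" "\<tau>' = proj_real ` \<rho>"
    using Delta_facts(6) \<tau>'(1) unfolding bij_betw_def by blast
  define \<tau> where "\<tau> = real_coords \<beta> ` \<rho>"
  have \<tau>: "\<tau> \<in> Fan" "proj_real ` real_point ` \<tau> = \<tau>'"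
    unfolding \<tau>_def using \<rho> real_point_image by auto
  obtain v m J where "dual_bases v m" "\<tau> = convex_cone hull (v ` J)" using Fan_cone[OF \<tau>(1)] .
  then show ?thesis using that \<tau> int by metis
qed

lemma linear_real_unit_act: "linear (real_unit_act \<sigma> u :: real ^ 'r::{finite,linorder} \<Rightarrow> _)"
  by (intro linearI) (simp_all add: real_unit_act_def vec_eq_iff algebra_simps)

lemma bij_real_unit_act: "u \<in> W \<Longrightarrow> bij (real_unit_act \<sigma> u :: real ^ 'r::{finite,linorder} \<Rightarrow> _)"
proof -
  assume "u \<in> W"
  then have "Re (\<sigma> (Inl i) u) \<noteq> 0" for i using W_pos[of u i] by simp
  then show ?thesis
    by (intro o_bij[where g = "\<lambda>x. \<chi> i. x $ i / Re (\<sigma> (Inl i) u)"])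
       (simp_all add: fun_eq_iff real_unit_act_def vec_eq_iff)
qed

text \<open>A cone and its translate meet in a common face. A face that contains an interior point is the whole
  cone, so that the translate would be equal to the cone, against freeness.\<close>

lemma Delta'_interior_wandering:
  assumes \<tau>: "\<tau> \<in> \<Delta>'" and u: "u \<in> W" "u \<noteq> 1"
  shows "real_unit_act \<sigma> u ` interior \<tau> \<inter> interior \<tau> = {}"
proof (rule ccontr)
  let ?u\<tau> = "real_unit_act \<sigma> u ` \<tau>"
  assume ne: "real_unit_act \<sigma> u ` interior \<tau> \<inter> interior \<tau> \<noteq> {}"
  have int: "interior ?u\<tau> = real_unit_act \<sigma> u ` interior \<tau>"
    by (intro interior_bijective_linear_image linear_real_unit_act bij_real_unit_act u)
  have u\<tau>: "?u\<tau> \<in> \<Delta>'" using Delta'_facts(3) \<tau> u unfolding fan_stable_def by blast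
  have face: "(\<tau> \<inter> ?u\<tau>) face_of \<tau>" "(\<tau> \<inter> ?u\<tau>) face_of ?u\<tau>"
    using Delta'_facts(1) \<tau> u\<tau> unfolding is_fan_def by blast+
  obtain x where x: "x \<in> interior \<tau>" "x \<in> interior ?u\<tau>" using ne int by blast
  then have "x \<in> \<tau> \<inter> ?u\<tau>" using interior_subset by blast
  then have "\<tau> \<inter> ?u\<tau> = \<tau>" "\<tau> \<inter> ?u\<tau> = ?u\<tau>"
    using face_of_disjoint_interior[OF face(1)] face_of_disjoint_interior[OF face(2)] x by blast+
  then have "?u\<tau> = \<tau>" by simp
  moreover have "\<tau> \<noteq> {0}" using x(1) interior_singleton by fastforce
  ultimately show False using Delta'_facts(6) \<tau> u unfolding fan_action_free_def by blast
qed

lemma Delta'_interior_Omega: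
  assumes \<tau>: "\<tau> \<in> \<Delta>'"
  shows "interior \<tau> \<subseteq> Omega TYPE('c) b"
proof
  fix x assume x: "x \<in> interior \<tau>"
  have "x \<noteq> 0"
  proof
    assume "x = 0"
    then obtain e where e: "e > 0" "cball 0 e \<subseteq> \<tau>"
      using x by (metis mem_interior_cball)
    define y :: "real ^ 'r::{finite,linorder}" where "y = e *\<^sub>R axis undefined 1"
    have y: "norm y = e" using e(1) by (simp add: y_def)
    then have "y \<in> cball 0 e" "- y \<in> cball 0 e" by simp_all
    then have "y \<in> \<tau>" "- (- y) \<in> uminus ` \<tau>" using e(2) by blast+
    then have "y \<in> \<tau> \<inter> uminus ` \<tau>" by simp
    moreover have "\<tau> \<inter> uminus ` \<tau> = {0}" by (rule is_fan_pointed[OF Delta'_facts(1) \<tau>])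
    ultimately show False using y e(1) by auto
  qed
  moreover have "x \<in> \<Union> \<Delta>'" using x interior_subset \<tau> by blast
  ultimately show "x \<in> Omega TYPE('c) b" unfolding Delta'_facts(4) by blast
qed

subsection \<open>Points of the torus\<close>

text \<open>The value of the character \<open>m\<close> at \<open>torus_exp \<beta> z\<close>, for \<open>m\<close> in the lattice. Unlike \<open>monomial\<close> it
  turns sums of arbitrary real vectors \<open>m\<close> into products.\<close>

definition echar :: "real ^ ('r + 'c + 'c) \<Rightarrow> complex ^ ('r + 'c + 'c) \<Rightarrow> complex" where
  "echar m z = exp (2 * \<i> * complex_of_real pi * pairing m (basis_coords \<beta> z))"

lemma echar_simps:
  "echar (m + m') z = echar m z * echar m' z" "echar m (z + w) = echar m z * echar m w"
  "echar m z \<noteq> 0" "echar 0 z = 1" "echar m 0 = 1"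
  using linear_0[OF linear_basis_coords]
  by (simp_all add: echar_def basis_coords_add pairing_simps distrib_left exp_add)

lemma basis_coords_real_point: "basis_coords \<beta> (real_point x) = cvec x"
  by (simp add: real_point_def)

lemma echar_eq_1_iff: "echar m z = 1 \<longleftrightarrow> (\<exists>k::int. pairing m (basis_coords \<beta> z) = of_int k)"
  unfolding echar_def exp_eq_1 by (auto simp: complex_eq_iff)

lemma echar_lat: "m \<in> int_lattice \<Longrightarrow> z \<in> lat \<Longrightarrow> echar m z = 1"
proof -
  assume m: "m \<in> int_lattice" and "z \<in> lat"
  then obtain x where x: "z = real_point x" "x \<in> int_lattice" by (auto simp: lat_eq)
  then obtain k where "m \<bullet> x = of_int k" using int_lattice_inner[OF m] by (meson Ints_cases)
  then show ?thesis unfolding echar_eq_1_iff by (simp add: x basis_coords_real_point pairing_cvec)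
qed

lemma echar_unit_act:
  "u \<in> W \<Longrightarrow> echar m (unit_act \<sigma> u z) = echar (transpose (um u) *v m) z"
  by (simp add: echar_def basis_coords_unit_act pairing_cmat)

lemma monomial_torus_exp: "m \<in> int_lattice \<Longrightarrow> monomial (torus_exp \<beta> z) m = echar m z"
proof -
  assume m: "m \<in> int_lattice"
  have "monomial (torus_exp \<beta> z) m =
      (\<Prod>j\<in>UNIV. exp (2 * \<i> * complex_of_real pi * (of_real (m $ j) * basis_coords \<beta> z $ j)))"
    unfolding monomial_def torus_exp_def
  proof (intro prod.cong refl)
    fix j
    have "m $ j \<in> \<int>" using m by (simp add: int_lattice_def)
    then have "of_int \<lfloor>m $ j\<rfloor> = complex_of_real (m $ j)" by (auto elim: Ints_cases)
    then show "(\<chi> j. exp (2 * \<i> * complex_of_real pi * basis_coords \<beta> z $ j)) $ j powi \<lfloor>m $ j\<rfloor> =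
        exp (2 * \<i> * complex_of_real pi * (of_real (m $ j) * basis_coords \<beta> z $ j))"
      by (simp add: exp_powi mult_ac)
  qed
  also have "\<dots> = echar m z"
    by (simp add: echar_def pairing_def exp_sum[symmetric] sum_distrib_left)
  finally show ?thesis .
qed

definition tor :: "complex ^ ('r + 'c + 'c) \<Rightarrow> ('r + 'c + 'c) tpoint" where
  "tor z = torus_point (torus_exp \<beta> z)"

lemma tor_eq: "tor z = ({0}, \<lambda>m. if m \<in> int_lattice then echar m z else 0)"
  by (auto simp: tor_def torus_point_def monomial_torus_exp fun_eq_iff)

lemma tor_in: "tor z \<in> toric_points Fan"
  using zero_cone_Fan by (auto simp: tor_eq toric_points_def orth_chars_0 echar_simps int_lattice_arith)

lemma torus_act_torus_exp:
  assumes "p \<in> toric_points Fan"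
  shows "torus_act (torus_exp \<beta> h) p = (fst p, \<lambda>m. echar m h * snd p m)"
proof -
  obtain \<tau> x where p: "p = (\<tau>, x)" by (cases p)
  have "x m = 0" if "m \<notin> int_lattice" for m
    using toric_points_simps(2)[of \<tau> x Fan m] assms that by (auto simp: p orth_chars_def)
  then show ?thesis by (auto simp: p torus_act_def fun_eq_iff) (metis monomial_torus_exp)
qed

lemma torus_exp_in_ctorus: "torus_exp \<beta> z \<in> ctorus"
  by (simp add: torus_exp_def ctorus_def)

lemma torus_point_eq_iff:
  fixes z w :: "complex ^ 'n"
  assumes "z \<in> ctorus" "w \<in> ctorus"
  shows "torus_point z = torus_point w \<longleftrightarrow> z = w"
proof
  assume "torus_point z = torus_point w"
  then have "snd (torus_point z) (axis j 1) = snd (torus_point w) (axis j 1)" for j by simp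
  moreover have "snd (torus_point z) (axis j 1) = z $ j" for z :: "complex ^ 'n" and j
  proof -
    have "monomial z (axis j 1) = (\<Prod>i\<in>UNIV. if i = j then z $ i else 1)"
      unfolding monomial_def by (intro prod.cong refl) (auto simp: axis_def)
    then show ?thesis by (simp add: torus_point_def)
  qed
  ultimately show "z = w" by (simp add: vec_eq_iff)
qed simp

lemma torus_ord_torus_exp: "proj_real (torus_ord \<beta> (torus_exp \<beta> z)) $ i = 2 * pi * Im (z $ Inl i)"
proof -
  have "- ln (cmod (torus_exp \<beta> z $ j)) = 2 * pi * Im (basis_coords \<beta> z $ j)" for j
    by (simp add: torus_exp_def)
  then have "proj_real (torus_ord \<beta> (torus_exp \<beta> z)) $ i =
      (\<Sum>j\<in>UNIV. 2 * pi * Im (basis_coords \<beta> z $ j) * Re (\<beta> j $ Inl i))"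
    by (simp add: torus_ord_def proj_real_def)
  also have "\<dots> = 2 * pi * Im (from_coords (basis_coords \<beta> z) $ Inl i)"
    unfolding from_coords_def using lat_real[OF basis_in_lat] by (simp add: sum_distrib_left mult_ac)
  finally show ?thesis by simp
qed

subsection \<open>The automorphisms induced by units\<close>

lemma transpose_um_int: "u \<in> W \<Longrightarrow> m \<in> int_lattice \<Longrightarrow> transpose (um u) *v m \<in> int_lattice"
proof -
  assume u: "u \<in> W" and m: "m \<in> int_lattice"
  have "(transpose (um u) *v m) $ j = m \<bullet> (um u *v axis j 1)" for j
    by (simp add: dot_lmul_matrix[symmetric] transpose_matrix_vector inner_axis)
  moreover have "m \<bullet> (um u *v axis j 1) \<in> \<int>" for j
    by (intro int_lattice_inner m um_int u) simp
  ultimately show ?thesis by (simp add: int_lattice_def)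
qed

lemma transpose_um_inverse:
  "u \<in> W \<Longrightarrow> transpose (um (inverse u)) *v (transpose (um u) *v m) = m"
  "u \<in> W \<Longrightarrow> transpose (um u) *v (transpose (um (inverse u)) *v m) = m"
  by (simp_all add: matrix_vector_mul_assoc matrix_transpose_mul[symmetric] um_inverse transpose_mat)

lemma transpose_um_int_iff: "u \<in> W \<Longrightarrow> transpose (um u) *v m \<in> int_lattice \<longleftrightarrow> m \<in> int_lattice"
  using transpose_um_int[of u m] transpose_um_int[of "inverse u" "transpose (um u) *v m"] W_inv
    transpose_um_inverse(1) by metis

lemma transpose_inner: "(transpose A *v m) \<bullet> x = m \<bullet> (A *v x)" for A :: "real ^ 'n ^ 'm"
  by (simp add: dot_lmul_matrix transpose_matrix_vector)

lemma orth_chars_um: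
  "u \<in> W \<Longrightarrow> m \<in> orth_chars ((*v) (um u) ` \<tau>) \<longleftrightarrow> transpose (um u) *v m \<in> orth_chars \<tau>"
  by (auto simp: orth_chars_def transpose_inner transpose_um_int_iff)

lemma um_um_inverse: "u \<in> W \<Longrightarrow> um u *v (um (inverse u) *v x) = x"
  "u \<in> W \<Longrightarrow> um (inverse u) *v (um u *v x) = x"
  by (simp_all add: matrix_vector_mul_assoc um_inverse)

lemma toric_map_inverse: "u \<in> W \<Longrightarrow> toric_map (um u) (toric_map (um (inverse u)) p) = p"
  by (cases p) (simp add: toric_map_def image_image um_um_inverse transpose_um_inverse)

lemma toric_map_inverse': "u \<in> W \<Longrightarrow> toric_map (um (inverse u)) (toric_map (um u) p) = p"
  by (cases p) (simp add: toric_map_def image_image um_um_inverse transpose_um_inverse)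

lemma toric_map_1: "toric_map (um 1) p = p"
  by (cases p) (simp add: toric_map_def um_1 transpose_mat)

lemma toric_map_mult: "u \<in> W \<Longrightarrow> u' \<in> W \<Longrightarrow> toric_map (um u) (toric_map (um u') p) = toric_map (um (u * u')) p"
  by (cases p) (simp add: toric_map_def um_mult image_image matrix_vector_mul_assoc matrix_transpose_mul)

lemma toric_map_in: "u \<in> W \<Longrightarrow> p \<in> toric_points Fan \<Longrightarrow> toric_map (um u) p \<in> toric_points Fan"
proof -
  assume u: "u \<in> W" and p: "p \<in> toric_points Fan"
  obtain \<tau> x where px: "p = (\<tau>, x)" by (cases p)
  note simps = toric_points_simps[OF p[unfolded px]]
  have "(*v) (um u) ` \<tau> \<in> Fan" using Fan_um[OF u simps(1)] .
  then show ?thesis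
    using simps(2,3) by (simp add: toric_map_def px toric_points_def orth_chars_um[OF u] matrix_vector_right_distrib)
qed

lemma toric_map_tor: "u \<in> W \<Longrightarrow> toric_map (um u) (tor z) = tor (unit_act \<sigma> u z)"
  by (auto simp: toric_map_def tor_eq transpose_um_int_iff echar_unit_act fun_eq_iff)

lemma toric_map_torus_act:
  assumes u: "u \<in> W" and p: "p \<in> toric_points Fan"
  shows "toric_map (um u) (torus_act (torus_exp \<beta> h) p) =
    torus_act (torus_exp \<beta> (unit_act \<sigma> u h)) (toric_map (um u) p)"
  unfolding torus_act_torus_exp[OF p] torus_act_torus_exp[OF toric_map_in[OF u p]]
  by (simp add: toric_map_def split_beta echar_unit_act[OF u])

subsection \<open>The topology\<close>

abbreviation TX :: "('r + 'c + 'c) tpoint topology" where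
  "TX \<equiv> atlas_topology (toric_charts Fan)"

lemma openin_chart: "(V, \<phi>) \<in> toric_charts Fan \<Longrightarrow> open G \<Longrightarrow> openin TX {p \<in> V. \<phi> p \<in> G}"
  unfolding atlas_topology_def by (intro topology_generated_by_Basis) blast

lemma topspace_TX: "topspace TX = toric_points Fan"
proof
  show "topspace TX \<subseteq> toric_points Fan"
    unfolding atlas_topology_def topology_generated_by_topspace by (auto elim!: toric_chartE)
  show "toric_points Fan \<subseteq> topspace TX"
  proof
    fix p assume p: "p \<in> toric_points Fan"
    then have F: "fst p \<in> Fan" by (auto simp: toric_points_def)
    obtain v m J where vm: "dual_bases v m" "fst p = convex_cone hull (v ` J)" using Fan_cone[OF F] .
    have "openin TX {q \<in> {q \<in> toric_points Fan. fst q face_of fst p}. (\<chi> j. snd q (m j)) \<in> UNIV}"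
      by (rule openin_chart[OF toric_chartI[OF F vm]]) simp
    moreover have "convex (fst p)" using Fan_convex_cone[OF F] by (simp add: convex_cone_def)
    ultimately show "p \<in> topspace TX"
      using p openin_subset face_of_refl by fastforce
  qed
qed

lemma dual_bases_um:
  assumes "u \<in> W" "dual_bases v m"
  shows "dual_bases (\<lambda>j. um u *v v j) (\<lambda>j. transpose (um (inverse u)) *v m j)"
  using assms dual_basesD[OF assms(2)] W_inv
  by (auto simp: dual_bases_def um_int transpose_um_int transpose_inner um_um_inverse)

lemma cone_hull_um: "convex_cone hull ((\<lambda>j. um u *v v j) ` J) = (*v) (um u) ` (convex_cone hull (v ` J))"
  by (simp add: convex_cone_hull_linear_image[symmetric] image_image)

lemma face_um_iff:
  assumes "u \<in> W"
  shows "((*v) (um u) ` \<tau>) face_of ((*v) (um u) ` \<tau>') \<longleftrightarrow> \<tau> face_of \<tau>'"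
proof (rule face_of_linear_image)
  show "inj ((*v) (um u))" by (metis injI um_um_inverse(2)[OF assms])
qed simp

text \<open>The preimage of the chart of a cone with coordinates \<open>m\<^sub>j\<close> is the chart of the cone moved back, with
  the transposed coordinates.\<close>

lemma continuous_toric_map:
  assumes u: "u \<in> W"
  shows "continuous_map TX TX (toric_map (um u))"
proof (subst (2) atlas_topology_def, rule continuous_on_generated_topo)
  fix S assume "S \<in> {{p \<in> V. \<phi> p \<in> G} | V \<phi> G. (V, \<phi>) \<in> toric_charts Fan \<and> open G}"
  then obtain V \<phi> G where S: "S = {p \<in> V. \<phi> p \<in> G}" "(V, \<phi>) \<in> toric_charts Fan" "open G" by blast
  obtain \<sigma>1 v m J where c: "\<sigma>1 \<in> Fan" "dual_bases v m" "\<sigma>1 = convex_cone hull (v ` J)"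
    "V = {p \<in> toric_points Fan. fst p face_of \<sigma>1}" "\<phi> = (\<lambda>p. \<chi> j. snd p (m j))"
    by (rule toric_chartE[OF S(2)]) (rule that; simp)
  let ?i = "inverse u"
  have i: "?i \<in> W" using W_inv u .
  let ?\<sigma>2 = "(*v) (um ?i) ` \<sigma>1" and ?m = "\<lambda>j. transpose (um u) *v m j"
  have c2: "?\<sigma>2 \<in> Fan" "dual_bases (\<lambda>j. um ?i *v v j) ?m" "?\<sigma>2 = convex_cone hull ((\<lambda>j. um ?i *v v j) ` J)"
    using Fan_um[OF i c(1)] dual_bases_um[OF i c(2)] by (simp_all add: cone_hull_um c(3))
  have "toric_map (um u) -` S \<inter> topspace TX =
      {p \<in> {p \<in> toric_points Fan. fst p face_of ?\<sigma>2}. (\<chi> j. snd p (?m j)) \<in> G}"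
  proof (intro equalityI subsetI)
    have face: "((*v) (um u) ` \<tau>) face_of \<sigma>1 \<longleftrightarrow> \<tau> face_of ?\<sigma>2" for \<tau>
      using face_um_iff[OF u, of \<tau> ?\<sigma>2] by (simp add: image_image um_um_inverse(1)[OF u])
    {
      fix p assume "p \<in> toric_map (um u) -` S \<inter> topspace TX"
      then show "p \<in> {p \<in> {p \<in> toric_points Fan. fst p face_of ?\<sigma>2}. (\<chi> j. snd p (?m j)) \<in> G}"
        by (cases p) (simp add: S(1) c(4,5) topspace_TX toric_map_def face)
    next
      fix p assume p: "p \<in> {p \<in> {p \<in> toric_points Fan. fst p face_of ?\<sigma>2}. (\<chi> j. snd p (?m j)) \<in> G}"
      then have "toric_map (um u) p \<in> toric_points Fan" using toric_map_in[OF u] by blast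
      then show "p \<in> toric_map (um u) -` S \<inter> topspace TX"
        using p by (cases p) (simp add: S(1) c(4,5) topspace_TX toric_map_def face)
    }
  qed
  then show "openin TX (toric_map (um u) -` S \<inter> topspace TX)"
    using openin_chart[OF toric_chartI[OF c2] S(3)] by simp
next
  show "toric_map (um u) ` topspace TX \<subseteq> \<Union> {{p \<in> V. \<phi> p \<in> G} | V \<phi> G. (V, \<phi>) \<in> toric_charts Fan \<and> open G}"
    using toric_map_in[OF u] topspace_TX
    unfolding atlas_topology_def topology_generated_by_topspace by blast
qed

lemma open_toric_map:
  assumes "u \<in> W" "openin TX S"
  shows "openin TX (toric_map (um u) ` S)"
proof -
  have S: "S \<subseteq> toric_points Fan" using assms(2) openin_subset topspace_TX by metis
  have "toric_map (um u) ` S = {p \<in> topspace TX. toric_map (um (inverse u)) p \<in> S}"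
    (is "_ = ?R")
  proof (intro equalityI subsetI)
    fix p assume "p \<in> toric_map (um u) ` S"
    then obtain q where q: "p = toric_map (um u) q" "q \<in> S" by blast
    then have "q \<in> toric_points Fan" using S by blast
    then show "p \<in> ?R"
      using q toric_map_in[OF assms(1)] by (simp add: topspace_TX toric_map_inverse'[OF assms(1)])
  next
    fix p assume "p \<in> ?R"
    then have "toric_map (um u) (toric_map (um (inverse u)) p) \<in> toric_map (um u) ` S" by blast
    then show "p \<in> toric_map (um u) ` S" by (simp only: toric_map_inverse[OF assms(1)])
  qed
  then show ?thesis
    using openin_continuous_map_preimage[OF continuous_toric_map[OF W_inv[OF assms(1)]] assms(2)] by simp
qed

lemma pairing_sum: "pairing q (sum f S) = (\<Sum>i\<in>S. pairing q (f i))"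
  by (induction S rule: infinite_finite_induct) (simp_all add: pairing_simps)

lemma exp_neg_tendsto_0: "c > 0 \<Longrightarrow> ((\<lambda>t. exp (- c * t)) \<longlongrightarrow> 0) at_top" for c :: real
  by (rule filterlim_compose[OF exp_at_bot])
     (rule filterlim_tendsto_neg_mult_at_bot[OF tendsto_const _ filterlim_ident], simp)

text \<open>Extend the point, a character of the sublattice orthogonal to its cone, to the whole lattice, and let
  it flow in the direction of a vector \<open>e\<close> in the relative interior of the cone: the characters that are
  positive on \<open>e\<close> tend to zero, and in every chart these are the coordinates that vanish at the point.
  This gives the density of the torus and shows where the approximating points lie.\<close>

lemma torus_approach:
  assumes "p \<in> toric_points Fan"
  obtains z0 e where "e \<in> fst p" "e = 0 \<Longrightarrow> p = tor z0"
    "\<And>S. openin TX S \<Longrightarrow> p \<in> S \<Longrightarrow>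
       eventually (\<lambda>t::real. tor (z0 + (\<i> * of_real t) *s real_point e) \<in> S) at_top"
proof -
  obtain \<tau> x where p: "p = (\<tau>, x)" by (cases p)
  note px = assms[unfolded p]
  note simps = toric_points_simps[OF px]
  obtain v m J where d: "dual_bases v m" and \<tau>: "\<tau> = convex_cone hull (v ` J)"
    using Fan_cone[OF simps(1)] .
  have vJ: "v j \<in> \<tau>" if "j \<in> J" for j unfolding \<tau> using that by (intro hull_inc) auto
  have mJ: "m j \<in> orth_chars \<tau>" if "j \<notin> J" for j
    using that dual_basesD(2)[OF d] unfolding orth_chars_def \<tau> cone_hull_dual[OF d] by auto
  define e where "e = (\<Sum>j\<in>J. v j)"
  define z0 where "z0 = from_coords (\<Sum>i\<in>-J. (Ln (x (m i)) / (2 * \<i> * complex_of_real pi)) *s cvec (v i))"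
  have e\<tau>: "e \<in> \<tau>"
  proof -
    have "(\<Sum>j\<in>S. v j) \<in> \<tau>" if "S \<subseteq> J" for S
      using that
    proof (induction S rule: infinite_finite_induct)
      case (insert j S)
      then show ?case using vJ unfolding \<tau> by (simp add: convex_cone_hull_add)
    qed (simp_all add: \<tau> convex_cone_hull_contains_0)
    then show ?thesis by (simp add: e_def)
  qed
  have z0: "echar y z0 = x y" if y: "y \<in> orth_chars \<tau>" for y
  proof -
    have yJ: "y \<bullet> v j = 0" if "j \<notin> - J" for j using y vJ that by (auto simp: orth_chars_def)
    have int: "complex_of_real (y \<bullet> v i) = of_int \<lfloor>y \<bullet> v i\<rfloor>" for i
    proof -
      have "y \<bullet> v i \<in> \<int>" using y dual_basesD(1)[OF d, of i] by (intro int_lattice_inner) (auto simp: orth_chars_def)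
      then show ?thesis by (auto elim: Ints_cases)
    qed
    have "echar y z0 = exp (\<Sum>i\<in>-J. of_int \<lfloor>y \<bullet> v i\<rfloor> * Ln (x (m i)))"
      by (simp add: echar_def z0_def pairing_sum pairing_simps pairing_cvec sum_distrib_left int mult.commute)
    also have "\<dots> = (\<Prod>i\<in>-J. exp (Ln (x (m i))) powi \<lfloor>y \<bullet> v i\<rfloor>)"
      by (simp add: exp_sum exp_powi)
    also have "\<dots> = (\<Prod>i\<in>-J. x (m i) powi \<lfloor>y \<bullet> v i\<rfloor>)"
    proof (intro prod.cong refl)
      fix i assume "i \<in> - J"
      then have "x (m i) \<noteq> 0" using mJ[of i] simps(2)[of "m i"] by simp
      then show "exp (Ln (x (m i))) powi \<lfloor>y \<bullet> v i\<rfloor> = x (m i) powi \<lfloor>y \<bullet> v i\<rfloor>" by simp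
    qed
    also have "\<dots> = x y"
      using toric_point_expand[OF px d y, of "- J"] yJ mJ by simp
    finally show ?thesis .
  qed
  have zt: "echar y (z0 + (\<i> * of_real t) *s real_point e) = echar y z0 * exp (of_real (- (2 * pi * (y \<bullet> e)) * t))"
    for y t
    unfolding echar_simps(2)
    by (simp add: echar_def basis_coords_scale basis_coords_real_point pairing_simps pairing_cvec mult_ac)
  have conv: "((\<lambda>t. snd (tor (z0 + (\<i> * of_real t) *s real_point e)) q) \<longlongrightarrow> x q) at_top"
    if q: "q \<in> int_lattice" "\<And>y. y \<in> \<tau> \<Longrightarrow> q \<bullet> y \<ge> 0" for q
  proof (cases "q \<in> orth_chars \<tau>")
    case True
    then have "q \<bullet> e = 0" using e\<tau> by (auto simp: orth_chars_def)
    then show ?thesis using q(1) by (simp add: tor_eq zt z0[OF True])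
  next
    case False
    have "q \<bullet> e \<noteq> 0"
    proof
      assume "q \<bullet> e = 0"
      then have "(\<Sum>j\<in>J. q \<bullet> v j) = 0" by (simp add: e_def inner_sum_right)
      then have 0: "q \<bullet> v j = 0" if "j \<in> J" for j
        using that q(2)[OF vJ] by (simp add: sum_nonneg_eq_0_iff)
      have "q \<bullet> y = 0" if y: "y \<in> \<tau>" for y
      proof -
        have "m j \<bullet> y = 0" if "j \<notin> J" for j using y that unfolding \<tau> cone_hull_dual[OF d] by auto
        then have "(m j \<bullet> y) * (q \<bullet> v j) = 0" for j using 0 by (cases "j \<in> J") auto
        then have "(\<Sum>j\<in>UNIV. (m j \<bullet> y) * (q \<bullet> v j)) = 0" by (intro sum.neutral) blast
        then have "q \<bullet> (\<Sum>j\<in>UNIV. (m j \<bullet> y) *\<^sub>R v j) = 0" by (simp add: inner_sum_right)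
        then show ?thesis using dual_expand(1)[OF d, of y] by simp
      qed
      then show False using False q(1) by (simp add: orth_chars_def)
    qed
    then have "2 * pi * (q \<bullet> e) > 0" using q(2)[OF e\<tau>] by simp
    then have "((\<lambda>t. exp (- (2 * pi * (q \<bullet> e)) * t)) \<longlongrightarrow> 0) at_top" by (rule exp_neg_tendsto_0)
    then have "((\<lambda>t. complex_of_real (exp (- (2 * pi * (q \<bullet> e)) * t))) \<longlongrightarrow> of_real 0) at_top"
      by (rule tendsto_of_real)
    then have "((\<lambda>t. echar q z0 * exp (of_real (- (2 * pi * (q \<bullet> e)) * t))) \<longlongrightarrow> echar q z0 * 0) at_top"
      by (intro tendsto_mult_left) (simp only: exp_of_real of_real_0)
    moreover have "x q = 0" using False simps(2) by blast
    ultimately show ?thesis using q(1) by (simp only: tor_eq zt snd_conv if_True mult_zero_right)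
  qed
  have "eventually (\<lambda>t::real. tor (z0 + (\<i> * of_real t) *s real_point e) \<in> S) at_top"
    if "openin TX S" "p \<in> S" for S
  proof -
    have "generate_topology_on {{p \<in> V. \<phi> p \<in> G} | V \<phi> G. (V, \<phi>) \<in> toric_charts Fan \<and> open G} S"
      using that(1) unfolding atlas_topology_def by (rule openin_topology_generated_by)
    then show ?thesis using that(2)
    proof induction
      case Empty
      then show ?case by simp
    next
      case (Int S S')
      then show ?case using eventually_conj by fastforce
    next
      case (UN K)
      then obtain k where k: "k \<in> K" "p \<in> k" by blast
      then have "eventually (\<lambda>t::real. tor (z0 + (\<i> * of_real t) *s real_point e) \<in> k) at_top" using UN by blast
      then show ?case by eventually_elim (use k in blast)
    next
      case (Basis S)
      then obtain V \<phi> G where S: "S = {p \<in> V. \<phi> p \<in> G}" "(V, \<phi>) \<in> toric_charts Fan" "open G" by blast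
      obtain \<sigma>1 v1 m1 J1 where c: "\<sigma>1 \<in> Fan" "dual_bases v1 m1" "\<sigma>1 = convex_cone hull (v1 ` J1)"
        "V = {p \<in> toric_points Fan. fst p face_of \<sigma>1}" "\<phi> = (\<lambda>p. \<chi> j. snd p (m1 j))"
        by (rule toric_chartE[OF S(2)]) (rule that; simp)
      have face: "\<tau> face_of \<sigma>1" and G: "(\<chi> j. x (m1 j)) \<in> G"
        using Basis(2) by (simp_all add: S(1) c(4,5) p)
      have "((\<lambda>t. \<chi> j. snd (tor (z0 + (\<i> * of_real t) *s real_point e)) (m1 j)) \<longlongrightarrow> (\<chi> j. x (m1 j))) at_top"
      proof (intro tendsto_vec_lambda conv)
        show "m1 j \<in> int_lattice" for j by (rule dual_basesD(2)[OF c(2)])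
        show "m1 j \<bullet> y \<ge> 0" if "y \<in> \<tau>" for j y
        proof -
          have "y \<in> \<sigma>1" using face_of_imp_subset[OF face] that by blast
          then show ?thesis unfolding c(3) cone_hull_dual[OF c(2)] by (auto dest: spec[of _ j] split: if_splits)
        qed
      qed
      then have "eventually (\<lambda>t. (\<chi> j. snd (tor (z0 + (\<i> * of_real t) *s real_point e)) (m1 j)) \<in> G) at_top"
        using S(3) G by (rule topological_tendstoD)
      moreover have "{0} face_of \<sigma>1"
        using cone_hull_face[OF c(2), of "{}" J1] by (simp add: c(3))
      then have "tor z \<in> V" for z using tor_in by (simp add: c(4) tor_eq)
      ultimately show ?case by (simp add: S(1) c(5))
    qed
  qed
  moreover have "p = tor z0" if "e = 0"
  proof -
    have "J = {}"
    proof (rule ccontr)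
      assume "J \<noteq> {}"
      then obtain j where "j \<in> J" by blast
      then have "m j \<bullet> e = 1" by (simp add: e_def inner_sum_right dual_basesD(3)[OF d])
      then show False using that by simp
    qed
    then have "\<tau> = {0}" by (simp add: \<tau>)
    then have "x = (\<lambda>m. if m \<in> int_lattice then echar m z0 else 0)"
      using z0 simps(2) by (auto simp: orth_chars_0 fun_eq_iff)
    then show ?thesis by (simp add: p tor_eq \<open>\<tau> = {0}\<close>)
  qed
  ultimately show ?thesis using that[of e z0] e\<tau> p by simp
qed

subsection \<open>Orbits of \<open>H\<close>\<close>

definition drop_conj :: "complex ^ ('r + 'c + 'c) \<Rightarrow> complex ^ ('r + 'c)" where
  "drop_conj z = (\<chi> i. case i of Inl r \<Rightarrow> z $ Inl r | Inr k \<Rightarrow> z $ Inr (Inl k))"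

definition pad :: "complex ^ ('r + 'c) \<Rightarrow> complex ^ ('r + 'c + 'c)" where
  "pad z = (\<chi> i. case i of Inl r \<Rightarrow> z $ Inl r | Inr k \<Rightarrow> (case k of Inl k \<Rightarrow> z $ Inr k | Inr k \<Rightarrow> 0))"

lemma drop_conj_simps [simp]:
  "drop_conj z $ Inl r = z $ Inl r" "drop_conj z $ Inr k = z $ Inr (Inl k)"
  by (simp_all add: drop_conj_def)

lemma pad_simps [simp]:
  "pad y $ Inl r = y $ Inl r" "pad y $ Inr (Inl k) = y $ Inr k" "pad y $ Inr (Inr k) = 0"
  by (simp_all add: pad_def)

lemma vec_sum_eq_iff: "(z :: 'a ^ ('b::finite + 'd::finite)) = w \<longleftrightarrow> (\<forall>i. z $ Inl i = w $ Inl i) \<and> (\<forall>i. z $ Inr i = w $ Inr i)"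
  unfolding vec_eq_iff by (metis sumE)

lemma drop_conj_pad [simp]: "drop_conj (pad y) = y"
  by (simp add: vec_sum_eq_iff)

lemma drop_conj_add: "drop_conj (z + w) = drop_conj z + drop_conj w"
  and drop_conj_diff: "drop_conj (z - w) = drop_conj z - drop_conj w"
  and drop_conj_scale: "drop_conj (a *s z) = a *s drop_conj z"
  by (simp_all add: vec_sum_eq_iff)

lemma pad_add: "pad (z + w) = pad z + pad w" and pad_scale: "pad (a *s z) = a *s pad z"
  by (simp_all add: pad_def vec_eq_iff split: sum.splits)

lemma linear_drop_conj: "linear drop_conj" and linear_pad: "linear pad"
  by (auto intro!: linearI simp: drop_conj_add drop_conj_scale pad_add pad_scale scaleR_eq_scalar)

lemma H_space_iff: "h \<in> H_space \<longleftrightarrow> drop_conj h = 0" for h :: "complex ^ ('r + 'c + 'c)"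
  by (simp add: H_space_def vec_sum_eq_iff)

lemma H_space_add: "h \<in> H_space \<Longrightarrow> h' \<in> H_space \<Longrightarrow> h + h' \<in> H_space"
  and H_space_minus: "h \<in> H_space \<Longrightarrow> - h \<in> H_space" and H_space_0: "0 \<in> H_space"
  for h h' :: "complex ^ ('r + 'c + 'c)"
  by (auto simp: H_space_def)

lemma torus_act_in:
  assumes p: "p \<in> toric_points Fan"
  shows "torus_act (torus_exp \<beta> h) p \<in> toric_points Fan"
proof -
  obtain \<tau> x where px: "p = (\<tau>, x)" by (cases p)
  show ?thesis
    using toric_points_simps[OF p[unfolded px]] unfolding torus_act_torus_exp[OF p]
    by (simp add: px toric_points_def echar_simps)
qed

lemma torus_act_add:
  assumes p: "p \<in> toric_points Fan"
  shows "torus_act (torus_exp \<beta> h) (torus_act (torus_exp \<beta> h') p) = torus_act (torus_exp \<beta> (h + h')) p"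
  unfolding torus_act_torus_exp[OF p] torus_act_torus_exp[OF torus_act_in[OF p, of h', unfolded torus_act_torus_exp[OF p]]]
  by (simp add: echar_simps mult.assoc)

lemma torus_act_0: "p \<in> toric_points Fan \<Longrightarrow> torus_act (torus_exp \<beta> 0) p = p"
  by (simp add: torus_act_torus_exp echar_simps)

lemma H_orbit_self:
  assumes "p \<in> toric_points Fan"
  shows "p \<in> H_orbit \<beta> p"
  unfolding H_orbit_def
  by (rule CollectI, rule exI[of _ 0]) (simp add: H_space_0 torus_act_0[OF assms])

lemma H_orbit_in: "p \<in> toric_points Fan \<Longrightarrow> q \<in> H_orbit \<beta> p \<Longrightarrow> q \<in> toric_points Fan"
  unfolding H_orbit_def using torus_act_in by blast

lemma H_orbit_eq:
  assumes p: "p \<in> toric_points Fan" and q: "q \<in> H_orbit \<beta> p"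
  shows "H_orbit \<beta> q = H_orbit \<beta> p"
proof -
  have sub: "H_orbit \<beta> q \<subseteq> H_orbit \<beta> p" if p: "p \<in> toric_points Fan" and q: "q \<in> H_orbit \<beta> p" for p q
  proof
    fix r assume "r \<in> H_orbit \<beta> q"
    then obtain h h' where "h \<in> H_space" "h' \<in> H_space"
      "r = torus_act (torus_exp \<beta> h') (torus_act (torus_exp \<beta> h) p)"
      using q unfolding H_orbit_def by blast
    then show "r \<in> H_orbit \<beta> p" unfolding H_orbit_def
      using torus_act_add[OF p] H_space_add by blast
  qed
  obtain h where h: "h \<in> H_space" "q = torus_act (torus_exp \<beta> h) p" using q unfolding H_orbit_def by blast
  have "torus_act (torus_exp \<beta> (- h)) q = torus_act (torus_exp \<beta> 0) p" by (simp add: h(2) torus_act_add[OF p])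
  also have "\<dots> = p" by (rule torus_act_0[OF p])
  finally have "p \<in> H_orbit \<beta> q" unfolding H_orbit_def using H_space_minus[OF h(1)] by blast
  then show ?thesis using sub[OF p q] sub[OF H_orbit_in[OF p q]] by blast
qed

lemma toric_map_H_orbit:
  assumes u: "u \<in> W" and p: "p \<in> toric_points Fan"
  shows "toric_map (um u) ` H_orbit \<beta> p = H_orbit \<beta> (toric_map (um u) p)"
proof -
  have H: "unit_act \<sigma> w h \<in> H_space" if "h \<in> H_space" for w h
    using that by (simp add: H_space_def unit_act_def)
  show ?thesis
  proof (intro equalityI subsetI)
    fix q assume "q \<in> toric_map (um u) ` H_orbit \<beta> p"
    then show "q \<in> H_orbit \<beta> (toric_map (um u) p)"
      unfolding H_orbit_def using toric_map_torus_act[OF u p] H by blast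
  next
    fix q assume "q \<in> H_orbit \<beta> (toric_map (um u) p)"
    then obtain h where h: "h \<in> H_space" "q = torus_act (torus_exp \<beta> h) (toric_map (um u) p)"
      unfolding H_orbit_def by blast
    have "unit_act \<sigma> u (unit_act \<sigma> (inverse u) h) = h"
      using W_nz[OF u] by (simp add: unit_act_mult unit_act_1)
    then have "q = toric_map (um u) (torus_act (torus_exp \<beta> (unit_act \<sigma> (inverse u) h)) p)"
      using h(2) toric_map_torus_act[OF u p] by metis
    then show "q \<in> toric_map (um u) ` H_orbit \<beta> p"
      unfolding H_orbit_def using H[OF h(1)] by blast
  qed
qed

lemma torus_act_tor: "torus_act (torus_exp \<beta> h) (tor z) = tor (h + z)"
  unfolding torus_act_torus_exp[OF tor_in] by (auto simp: tor_eq echar_simps fun_eq_iff)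

lemma H_orbit_tor: "H_orbit \<beta> (tor z) = {tor (h + z) | h. h \<in> H_space}"
  unfolding H_orbit_def torus_act_tor ..

lemma tor_eqD: "tor z = tor w \<Longrightarrow> Im (z $ Inl i) = Im (w $ Inl i)"
proof -
  assume "tor z = tor w"
  then have "torus_exp \<beta> z = torus_exp \<beta> w"
    unfolding tor_def using torus_point_eq_iff torus_exp_in_ctorus by blast
  then show ?thesis using torus_ord_torus_exp[of z i] torus_ord_torus_exp[of w i] by simp
qed

lemma ord_bar_tor: "ord_bar \<beta> (H_orbit \<beta> (tor z)) = (\<chi> i. 2 * pi * Im (z $ Inl i))"
  unfolding ord_bar_def
proof (rule the_equality)
  show "\<exists>w\<in>ctorus. torus_point w \<in> H_orbit \<beta> (tor z) \<and>
      (\<chi> i. 2 * pi * Im (z $ Inl i)) = proj_real (torus_ord \<beta> w)"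
    using H_orbit_self[OF tor_in, of z]
    by (intro bexI[of _ "torus_exp \<beta> z"])
       (simp_all add: torus_exp_in_ctorus tor_def vec_eq_iff torus_ord_torus_exp)
  fix y :: "real ^ 'r::{finite,linorder}"
  assume "\<exists>w\<in>ctorus. torus_point w \<in> H_orbit \<beta> (tor z) \<and> y = proj_real (torus_ord \<beta> w)"
  then obtain w where w: "w \<in> ctorus" "torus_point w \<in> H_orbit \<beta> (tor z)" "y = proj_real (torus_ord \<beta> w)" by blast
  then obtain h where h: "h \<in> H_space" "torus_point w = tor (h + z)"
    unfolding H_orbit_tor by blast
  note h(2)[unfolded tor_def]
  then have w': "w = torus_exp \<beta> (h + z)" using torus_point_eq_iff[OF w(1) torus_exp_in_ctorus] by blast
  then show "y = (\<chi> i. 2 * pi * Im (z $ Inl i))"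
    using h(1) by (simp add: w(3) w' vec_eq_iff torus_ord_torus_exp H_space_def)
qed

lemma torus_point_tor: "z \<in> ctorus \<Longrightarrow> \<exists>w. torus_point z = tor w"
proof -
  assume z: "z \<in> ctorus"
  define w where "w = from_coords (\<chi> j. Ln (z $ j) / (2 * \<i> * complex_of_real pi))"
  have "torus_exp \<beta> w = z" using z by (simp add: torus_exp_def w_def ctorus_def vec_eq_iff)
  then show ?thesis unfolding tor_def by metis
qed

lemma C0_eq: "C0_set \<beta> = range (\<lambda>z. H_orbit \<beta> (tor z))"
proof -
  have "torus_point ` ctorus = range tor"
    using torus_point_tor torus_exp_in_ctorus unfolding tor_def by (force simp: image_iff)
  then show ?thesis unfolding C0_set_def by (simp add: image_image)
qed

lemma Omega_scale: "c > 0 \<Longrightarrow> (\<chi> i. c * f i) \<in> Omega TYPE('c) b \<longleftrightarrow> (\<chi> i. f i) \<in> Omega TYPE('c) b"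
  by (simp add: Omega_def zero_less_mult_iff)

lemma U0_iff: "H_orbit \<beta> (tor z) \<in> U0_set \<beta> b \<longleftrightarrow> (\<chi> i. Im (z $ Inl i)) \<in> Omega TYPE('c) b"
proof -
  have "ord_bar \<beta> (H_orbit \<beta> (tor z)) \<in> Omega TYPE('c) b \<longleftrightarrow> (\<chi> i. Im (z $ Inl i)) \<in> Omega TYPE('c) b"
    unfolding ord_bar_tor by (rule Omega_scale) simp
  then show ?thesis unfolding U0_set_def C0_eq by blast
qed

lemma H_orbit_not_C0:
  assumes p: "p \<in> toric_points Fan" "fst p \<noteq> {0}"
  shows "H_orbit \<beta> p \<notin> C0_set \<beta>"
proof
  assume "H_orbit \<beta> p \<in> C0_set \<beta>"
  then obtain z where "H_orbit \<beta> p = H_orbit \<beta> (tor z)" unfolding C0_eq by blast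
  then have "p \<in> H_orbit \<beta> (tor z)" using H_orbit_self[OF p(1)] by simp
  then show False using p(2) unfolding H_orbit_tor by (auto simp: tor_eq)
qed

end

section \<open>Coordinates around a boundary divisor\<close>

locale unit_fan_ray = unit_fan_data \<sigma> \<beta> b W \<Delta>' \<Delta>
  for \<sigma> :: "'r::{finite,linorder} + 'c::{finite,linorder} + 'c \<Rightarrow> 'k::field_char_0 \<Rightarrow> complex"
    and \<beta> :: "'r + 'c + 'c \<Rightarrow> complex ^ ('r + 'c + 'c)"
    and b :: nat and W :: "'k set"
    and \<Delta>' :: "(real ^ 'r::{finite,linorder}) set set"
    and \<Delta> :: "(complex ^ ('r + 'c + 'c)) set set" +
  fixes v m :: "'r + 'c + 'c \<Rightarrow> real ^ ('r + 'c + 'c)" and j1 :: "'r + 'c + 'c" and i0 :: 'r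
  assumes dual: "dual_bases v m" and ray: "ray_cone (v j1) \<in> Fan"
begin

text \<open>The boundary divisor considered is the one of the ray spanned by \<open>v j1\<close>. The real embedding \<open>i0\<close> is
  used to measure how far a point has moved along the ray.\<close>

definition V1 :: "complex ^ ('r + 'c + 'c)" where "V1 = real_point (v j1)"
definition a0 :: complex where "a0 = V1 $ Inl i0"

lemma dual_rules: "m j \<bullet> v i = (if i = j then 1 else 0)" "v j \<in> int_lattice" "m j \<in> int_lattice"
  using dual_basesD[OF dual] by auto

lemma a0: "a0 \<noteq> 0" "Im a0 = 0"
proof -
  have "v j1 \<noteq> 0" using dual_rules(1)[of j1 j1] by auto
  then have "V1 \<noteq> 0" unfolding V1_def using inj_real_point linear_0[OF linear_real_point] by (metis inj_eq)
  have "V1 \<in> lat" using dual_rules(2) by (simp add: V1_def lat_eq)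
  then obtain x where x: "V1 = ce x" using lat_cases by blast
  then have "x \<noteq> 0" using \<open>V1 \<noteq> 0\<close> by (auto simp: canonical_embedding_def vec_eq_iff)
  then show "a0 \<noteq> 0" "Im a0 = 0" by (simp_all add: a0_def x canonical_embedding_def)
qed

definition hat :: "complex ^ ('r + 'c + 'c) \<Rightarrow> complex ^ ('r + 'c + 'c)" where
  "hat y = (\<chi> i. if i = Inl i0 then 0 else y $ i)"

lemma hat_simps: "hat y $ Inl i0 = 0" "i \<noteq> Inl i0 \<Longrightarrow> hat y $ i = y $ i"
  "hat (y + z) = hat y + hat z" "hat (y - z) = hat y - hat z" "hat (a *s y) = a *s hat y"
  by (simp_all add: hat_def vec_eq_iff)

text \<open>A parametrization of the torus together with the divisor of the ray. If \<open>y\<^sub>i\<^sub>0 = exp (2 \<pi> i \<zeta>)\<close>, it is the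
  point of the torus with logarithm \<open>\<zeta> V1 + hat y\<close>; written in terms of \<open>y\<^sub>i\<^sub>0\<close> instead of \<open>\<zeta>\<close> the formula
  makes sense for \<open>y\<^sub>i\<^sub>0 = 0\<close>, where it gives points of the divisor because \<open>0 powi 0 = 1\<close> and
  \<open>0 powi k = 0\<close> otherwise. All other coordinates are logarithmic, so that \<open>H\<close> acts by translations
  of the last \<open>t\<close> coordinates and \<open>X\<close> is parametrized by the remaining ones.\<close>

definition Psi :: "complex ^ ('r + 'c + 'c) \<Rightarrow> ('r + 'c + 'c) tpoint" where
  "Psi y = (if y $ Inl i0 = 0 then ray_cone (v j1) else {0},
     \<lambda>q. if q \<in> int_lattice then y $ Inl i0 powi \<lfloor>q \<bullet> v j1\<rfloor> * echar q (hat y) else 0)"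

lemma echar_V1: "q \<in> int_lattice \<Longrightarrow> echar q (\<zeta> *s V1) = exp (2 * \<i> * complex_of_real pi * \<zeta>) powi \<lfloor>q \<bullet> v j1\<rfloor>"
proof -
  assume "q \<in> int_lattice"
  then have "q \<bullet> v j1 \<in> \<int>" using dual_rules(2) by (intro int_lattice_inner)
  then have "of_int \<lfloor>q \<bullet> v j1\<rfloor> = complex_of_real (q \<bullet> v j1)" by (auto elim: Ints_cases)
  then show ?thesis
    by (simp add: echar_def V1_def basis_coords_scale basis_coords_real_point pairing_simps pairing_cvec exp_powi mult_ac)
qed

lemma Psi_torus:
  assumes "y $ Inl i0 = exp (2 * \<i> * complex_of_real pi * \<zeta>)"
  shows "Psi y = tor (\<zeta> *s V1 + hat y)"
  using assms by (auto simp: Psi_def tor_eq echar_simps echar_V1 fun_eq_iff)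

lemma Psi_torus_ex:
  assumes "y $ Inl i0 \<noteq> 0"
  shows "Psi y = tor ((Ln (y $ Inl i0) / (2 * \<i> * complex_of_real pi)) *s V1 + hat y)"
  using assms by (intro Psi_torus) simp

lemma orth_ray: "orth_chars (ray_cone (v j1)) = {q \<in> int_lattice. q \<bullet> v j1 = 0}"
  unfolding orth_chars_def ray_cone_eq by (auto intro: exI[of _ 1]) (metis scaleR_one zero_le_one)

lemma int_v1: "q \<in> int_lattice \<Longrightarrow> \<lfloor>q \<bullet> v j1\<rfloor> = 0 \<longleftrightarrow> q \<bullet> v j1 = 0"
  using int_lattice_inner[OF _ dual_rules(2), of q j1] by (auto elim: Ints_cases)

lemma Psi_in: "Psi y \<in> toric_points Fan"
proof (cases "y $ Inl i0 = 0")
  case False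
  then show ?thesis using Psi_torus_ex tor_in by metis
next
  case True
  then show ?thesis
    using ray by (auto simp: Psi_def toric_points_def orth_ray int_v1 power_int_0_left_if echar_simps
        int_lattice_arith inner_add_left)
qed

lemma Psi_face: "fst (Psi y) face_of ray_cone (v j1)"
  using cone_hull_face[OF dual, of "{}" "{j1}"] cone_hull_face[OF dual, of "{j1}" "{j1}"]
  by (auto simp: Psi_def)

lemma Psi_H: "h \<in> H_space \<Longrightarrow> torus_act (torus_exp \<beta> h) (Psi y) = Psi (h + y)"
proof -
  assume "h \<in> H_space"
  then have "h $ Inl i = 0" for i by (simp add: H_space_def)
  moreover from this have "hat h = h" by (simp add: hat_def vec_eq_iff)
  ultimately show ?thesis
    unfolding torus_act_torus_exp[OF Psi_in]
    by (auto simp: Psi_def hat_simps echar_simps fun_eq_iff)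
qed

definition X_param :: "complex ^ ('r + 'c) \<Rightarrow> ('r + 'c + 'c) tpoint set" where
  "X_param y = H_orbit \<beta> (Psi (pad y))"

lemma H_orbit_Psi: "H_orbit \<beta> (Psi z) = {Psi z' | z'. drop_conj z' = drop_conj z}"
proof (intro equalityI subsetI)
  fix p assume "p \<in> H_orbit \<beta> (Psi z)"
  then obtain h where "h \<in> H_space" "p = Psi (h + z)" unfolding H_orbit_def using Psi_H by blast
  then show "p \<in> {Psi z' | z'. drop_conj z' = drop_conj z}"
    by (auto simp: H_space_iff drop_conj_add)
next
  fix p assume "p \<in> {Psi z' | z'. drop_conj z' = drop_conj z}"
  then obtain z' where z': "p = Psi z'" "drop_conj z' = drop_conj z" by blast
  then have "z' - z \<in> H_space" by (simp add: H_space_iff drop_conj_diff)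
  then have "p = torus_act (torus_exp \<beta> (z' - z)) (Psi z)" using Psi_H[of "z' - z" z] z'(1) by simp
  then show "p \<in> H_orbit \<beta> (Psi z)" unfolding H_orbit_def using \<open>z' - z \<in> H_space\<close> by blast
qed

lemma X_param_eq: "X_param y = {Psi z | z. drop_conj z = y}"
  by (simp add: X_param_def H_orbit_Psi)

lemma H_orbit_Psi_X_param: "H_orbit \<beta> (Psi z) = X_param (drop_conj z)"
  by (simp add: X_param_eq H_orbit_Psi)

lemma cvec_expand: "c = (\<Sum>j\<in>UNIV. pairing (m j) c *s cvec (v j))"
proof -
  have decomp: "c = cvec (\<chi> i. Re (c $ i)) + \<i> *s cvec (\<chi> i. Im (c $ i))"
    by (simp add: vec_eq_iff cvec_def complex_eq[symmetric])
  have real: "cvec x = (\<Sum>j\<in>UNIV. pairing (m j) (cvec x) *s cvec (v j))" for x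
    by (subst dual_expand(1)[OF dual, of x])
       (simp add: linear_sum[OF linear_cvec] linear_scale[OF linear_cvec] scaleR_eq_scalar pairing_cvec)
  have lin: "(\<Sum>j\<in>UNIV. pairing (m j) (x + \<i> *s y) *s cvec (v j)) =
      (\<Sum>j\<in>UNIV. pairing (m j) x *s cvec (v j)) + \<i> *s (\<Sum>j\<in>UNIV. pairing (m j) y *s cvec (v j))" for x y
    by (simp add: vec_eq_iff pairing_simps sum.distrib sum_distrib_left distrib_right mult.assoc)
  define A B where "A = cvec (\<chi> i. Re (c $ i))" and "B = cvec (\<chi> i. Im (c $ i))"
  have "(\<Sum>j\<in>UNIV. pairing (m j) (A + \<i> *s B) *s cvec (v j)) = A + \<i> *s B"
    unfolding lin unfolding A_def B_def real[symmetric] ..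
  then show ?thesis using decomp unfolding A_def[symmetric] B_def[symmetric] by simp
qed

text \<open>If two parameters have the same image, their logarithmic parts differ by a lattice vector and a
  multiple of the ray. This difference has a vanishing coordinate \<open>i0\<close>, so the multiple is real and
  the difference lies in the real span of the lattice. There the last \<open>t\<close> coordinates are conjugate to
  preceding ones: if the first \<open>s + t\<close> coordinates are small, then so is the whole vector, and its integral
  coefficients vanish.\<close>

lemma Psi_inj:
  obtains \<delta> where "\<delta> > 0"
    "\<And>y y'. Psi y = Psi y' \<Longrightarrow> norm (drop_conj y - drop_conj y') < \<delta> \<Longrightarrow> y = y'"
proof -
  obtain B where B: "B > 0" "\<And>z. norm (real_coords \<beta> z) \<le> B * norm z"
    using linear_bounded_pos[OF linear_real_coords] by blast
  define n where "n = real CARD('r + 'c + 'c)"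
  define M where "M = (\<Sum>j\<in>UNIV. norm (m j)) + 1"
  have n: "n > 0" by (simp only: n_def of_nat_0_less_iff zero_less_card_finite)
  have M: "M > 0" unfolding M_def by (simp add: add_nonneg_pos sum_nonneg)
  \<comment> \<open>For this value the estimates below bound the integers \<open>k j\<close> by less than \<open>1\<close>.\<close>
  define \<delta> where "\<delta> = 1 / (M * B * n)"
  have \<delta>: "\<delta> > 0" using M B n by (simp add: \<delta>_def)
  have "y = y'" if eq: "Psi y = Psi y'" and near: "norm (drop_conj y - drop_conj y') < \<delta>" for y y'
  proof -
    define D where "D = hat y - hat y'"
    define c where "c = basis_coords \<beta> D"
    have D: "D = from_coords c" by (simp add: c_def)
    have snd: "snd (Psi y) (m j) = snd (Psi y') (m j)" for j using eq by simp
    have "\<exists>k::int. pairing (m j) c = of_int k" if "j \<noteq> j1" for j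
    proof -
      have "echar (m j) (hat y) = echar (m j) (hat y')"
        using snd[of j] that by (simp add: Psi_def dual_rules)
      moreover have "hat y = D + hat y'" by (simp add: D_def)
      ultimately have "echar (m j) D = 1" using echar_simps by simp
      then show ?thesis unfolding echar_eq_1_iff c_def .
    qed
    then obtain k where k: "\<And>j. j \<noteq> j1 \<Longrightarrow> pairing (m j) c = of_int (k j)" by metis
    define \<kappa> where "\<kappa> = pairing (m j1) c"
    define x0 where "x0 = (\<Sum>j\<in>UNIV - {j1}. of_int (k j) *\<^sub>R v j)"
    have "c = pairing (m j1) c *s cvec (v j1) + (\<Sum>j\<in>UNIV - {j1}. pairing (m j) c *s cvec (v j))"
      by (subst cvec_expand) (simp add: sum.remove[of UNIV j1])
    also have "(\<Sum>j\<in>UNIV - {j1}. pairing (m j) c *s cvec (v j)) = (\<Sum>j\<in>UNIV - {j1}. of_int (k j) *\<^sub>R cvec (v j))"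
      by (intro sum.cong refl) (simp add: k scaleR_eq_scalar)
    also have "\<dots> = cvec x0" by (simp add: x0_def linear_sum[OF linear_cvec] linear_scale[OF linear_cvec])
    finally have "c = \<kappa> *s cvec (v j1) + cvec x0" by (simp only: \<kappa>_def)
    then have "from_coords c = from_coords (\<kappa> *s cvec (v j1) + cvec x0)" by (rule arg_cong)
    then have D2: "D = \<kappa> *s V1 + real_point x0"
      by (simp only: D V1_def real_point_def from_coords_add from_coords_scale)
    have "D $ Inl i0 = 0" by (simp add: D_def hat_simps)
    then have "\<kappa> * a0 = - (real_point x0 $ Inl i0)" using D2 by (simp add: a0_def add_eq_0_iff)
    then have "Im (\<kappa> * a0) = 0" using real_point_real[of x0 i0] by simp
    then have \<kappa>: "\<kappa> = of_real (Re \<kappa>)" using a0 by (simp add: complex_eq_iff)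
    define x where "x = Re \<kappa> *\<^sub>R v j1 + x0"
    have Dx: "D = real_point x"
      using D2 \<kappa> by (simp add: x_def V1_def linear_add[OF linear_real_point] linear_scale[OF linear_real_point] scaleR_eq_scalar)
    have comp: "cmod (D $ i) \<le> norm (drop_conj y - drop_conj y')" for i
    proof -
      have L: "cmod (D $ Inl i) \<le> cmod ((drop_conj y - drop_conj y') $ Inl i)" for i
        by (cases "i = i0") (simp_all add: D_def hat_def)
      have R: "cmod (D $ Inr (Inl i)) = cmod ((drop_conj y - drop_conj y') $ Inr i)" for i
        by (simp add: D_def hat_def)
      have C: "cmod (D $ Inr (Inr i)) = cmod (D $ Inr (Inl i))" for i
        unfolding Dx real_point_conj by simp
      have N: "cmod ((drop_conj y - drop_conj y') $ l) \<le> norm (drop_conj y - drop_conj y')" for l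
        by (rule Finite_Cartesian_Product.norm_nth_le)
      show ?thesis
      proof (cases i)
        case (Inl l)
        show ?thesis unfolding Inl by (rule order_trans[OF L N])
      next
        case (Inr k)
        show ?thesis
        proof (cases k)
          case (Inl l)
          show ?thesis unfolding Inr Inl R by (rule N)
        next
          case (Inr l)
          show ?thesis unfolding \<open>i = Inr k\<close> Inr C R by (rule N)
        qed
      qed
    qed
    have "norm D \<le> (\<Sum>i\<in>UNIV. cmod (D $ i))" by (rule norm_le_sum_cmod)
    also have "\<dots> \<le> n * norm (drop_conj y - drop_conj y')"
      using sum_bounded_above[of UNIV "\<lambda>i. cmod (D $ i)", OF comp] by (simp add: n_def)
    also have "\<dots> < n * \<delta>" using near n by simp
    finally have nD: "norm D < n * \<delta>" .
    have "norm x \<le> B * norm D" using B(2)[of D] by (simp add: Dx)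
    then have nx: "norm x < B * (n * \<delta>)" using nD B(1) by (meson le_less_trans mult_less_cancel_left_pos)
    have "k j = 0" if "j \<noteq> j1" for j
    proof -
      have "m j \<bullet> x = of_int (k j)"
        using that by (simp add: x_def x0_def inner_add_right inner_sum_right dual_rules if_distrib[of "\<lambda>t. _ * t"] cong: if_cong)
      then have "\<bar>of_int (k j)\<bar> \<le> norm (m j) * norm x" using Cauchy_Schwarz_ineq2[of "m j" x] by simp
      also have "\<dots> \<le> M * norm x"
        unfolding M_def by (intro mult_right_mono) (auto intro: order_trans[OF member_le_sum[of j UNIV]])
      also have "\<dots> < M * (B * (n * \<delta>))" using nx M by simp
      also have "\<dots> = 1" using M B n by (simp add: \<delta>_def)
      finally show ?thesis by linarith
    qed
    then have "x0 = 0" by (simp add: x0_def)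
    then have "D = \<kappa> *s V1" using D2 by (simp add: linear_0[OF linear_real_point])
    moreover from this have "\<kappa> * a0 = 0" using \<open>D $ Inl i0 = 0\<close> by (simp add: a0_def)
    ultimately have "D = 0" using a0(1) by simp
    then have hat: "hat y = hat y'" by (simp add: D_def)
    then have "y $ i = y' $ i" if "i \<noteq> Inl i0" for i using that hat_simps(2) by metis
    moreover have "y $ Inl i0 = y' $ Inl i0" using snd[of j1] by (simp add: Psi_def dual_rules hat echar_simps)
    ultimately show "y = y'" unfolding vec_eq_iff by metis
  qed
  then show ?thesis using that \<delta> by blast
qed

subsection \<open>The parametrization is continuous and open\<close>

definition ell :: "real ^ ('r + 'c + 'c) \<Rightarrow> complex ^ ('r + 'c + 'c) \<Rightarrow> complex" where
  "ell q y = 2 * \<i> * complex_of_real pi * pairing q (basis_coords \<beta> (hat y))"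

lemma echar_hat: "echar q (hat y) = exp (ell q y)"
  by (simp add: echar_def ell_def)

lemma ell_simps: "ell q (y + z) = ell q y + ell q z" "ell q (a *s y) = a * ell q y"
  by (simp_all add: ell_def hat_simps basis_coords_add basis_coords_scale pairing_simps algebra_simps)

lemma bounded_linear_ell: "bounded_linear (ell q)"
  by (intro linear_conv_bounded_linear[THEN iffD1] linearI)
     (simp_all add: ell_simps scaleR_eq_scalar scaleR_conv_of_real)

lemma continuous_on_ell [continuous_intros]: "continuous_on S (ell q)"
  by (rule linear_continuous_on[OF bounded_linear_ell])

lemma continuous_Psi: "continuous_map euclidean TX Psi"
proof (subst atlas_topology_def, rule continuous_on_generated_topo)
  fix S assume "S \<in> {{p \<in> V. \<phi> p \<in> G} | V \<phi> G. (V, \<phi>) \<in> toric_charts Fan \<and> open G}"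
  then obtain V \<phi> G where S: "S = {p \<in> V. \<phi> p \<in> G}" "(V, \<phi>) \<in> toric_charts Fan" "open G" by blast
  obtain \<sigma>1 v1 m1 J1 where c: "\<sigma>1 \<in> Fan" "dual_bases v1 m1" "\<sigma>1 = convex_cone hull (v1 ` J1)"
    "V = {p \<in> toric_points Fan. fst p face_of \<sigma>1}" "\<phi> = (\<lambda>p. \<chi> j. snd p (m1 j))"
    by (rule toric_chartE[OF S(2)]) (rule that; simp)
  have m1: "m1 j \<in> int_lattice" for j by (rule dual_basesD(2)[OF c(2)])
  define f where "f = (\<lambda>y. \<chi> j. y $ Inl i0 powi \<lfloor>m1 j \<bullet> v j1\<rfloor> * exp (ell (m1 j) y))"
  have \<phi>: "\<phi> (Psi y) = f y" for y by (simp add: c(5) f_def Psi_def m1 echar_hat)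
  have z: "{0} face_of \<sigma>1"
    using cone_hull_face[OF c(2), of "{}" J1] by (simp add: c(3))
  have "open (Psi -` S)"
  proof (cases "ray_cone (v j1) face_of \<sigma>1")
    case True
    have "\<lfloor>m1 j \<bullet> v j1\<rfloor> \<ge> 0" for j
    proof -
      have "v j1 \<in> \<sigma>1" using face_of_imp_subset[OF True] by (auto intro: hull_inc)
      then have "m1 j \<bullet> v j1 \<ge> 0"
        unfolding c(3) cone_hull_dual[OF c(2)] by (auto dest: spec[of _ j] split: if_splits)
      then show ?thesis by simp
    qed
    then have "f = (\<lambda>y. \<chi> j. y $ Inl i0 ^ nat \<lfloor>m1 j \<bullet> v j1\<rfloor> * exp (ell (m1 j) y))"
      by (simp add: f_def power_int_def)
    then have "continuous_on UNIV f" by (simp only:) (intro continuous_intros)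
    then have "open (f -` G)" using S(3) open_vimage by blast
    moreover have "Psi -` S = f -` G"
    proof -
      have "Psi y \<in> V" for y using Psi_in z True by (simp add: c(4)) (simp add: Psi_def)
      then show ?thesis by (auto simp: S(1) \<phi>)
    qed
    ultimately show ?thesis by simp
  next
    case False
    have "continuous_on {y. y $ Inl i0 \<noteq> 0} f"
      unfolding f_def by (intro continuous_intros) auto
    moreover have "open {y :: complex ^ ('r + 'c + 'c). y $ Inl i0 \<noteq> 0}"
      by (intro open_Collect_neq continuous_intros)
    ultimately have "open ({y. y $ Inl i0 \<noteq> 0} \<inter> f -` G)"
      using S(3) by (rule continuous_open_preimage)
    moreover have "Psi -` S = {y. y $ Inl i0 \<noteq> 0} \<inter> f -` G"
    proof -
      have "Psi y \<in> V \<longleftrightarrow> y $ Inl i0 \<noteq> 0" for y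
        using Psi_in z False by (simp add: c(4)) (simp add: Psi_def)
      then show ?thesis by (auto simp: S(1) \<phi>)
    qed
    ultimately show ?thesis by simp
  qed
  then show "openin euclidean (Psi -` S \<inter> topspace euclidean)" by simp
next
  show "Psi ` topspace euclidean \<subseteq> \<Union> {{p \<in> V. \<phi> p \<in> G} | V \<phi> G. (V, \<phi>) \<in> toric_charts Fan \<and> open G}"
    using Psi_in topspace_TX unfolding atlas_topology_def topology_generated_by_topspace by blast
qed

text \<open>The parametrization in the chart of the ray.\<close>

definition Psic :: "complex ^ ('r + 'c + 'c) \<Rightarrow> complex ^ ('r + 'c + 'c)" where
  "Psic y = (\<chi> j. (if j = j1 then y $ Inl i0 else 1) * exp (ell (m j) y))"

lemma Psic_eq: "Psic y = (\<chi> j. snd (Psi y) (m j))"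
  by (simp add: Psic_def Psi_def vec_eq_iff dual_rules echar_hat)

lemma continuous_Psic: "continuous_on S Psic"
proof -
  have "continuous_on S (\<lambda>y. (if j = j1 then y $ Inl i0 else 1) * exp (ell (m j) y))" for j
    by (cases "j = j1") (auto intro!: continuous_intros)
  then show ?thesis unfolding Psic_def by (intro continuous_on_vec_lambda)
qed

lemma ray_chart_eq:
  assumes "p \<in> toric_points Fan" "fst p face_of ray_cone (v j1)" "(\<chi> j. snd p (m j)) = Psic y"
  shows "p = Psi y"
  using assms Psi_in Psi_face
  by (intro ray_chart_inj[OF dual, where F = Fan]) (auto simp: Psic_eq vec_eq_iff intro: Fan_convex_cone)

text \<open>In the chart of the ray the parametrization is continuous and locally injective, hence open by
  invariance of domain.\<close>

lemma open_Psi: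
  assumes "open G"
  shows "openin TX (Psi ` G)"
proof -
  obtain \<delta> where \<delta>: "\<delta> > 0"
    "\<And>y y'. Psi y = Psi y' \<Longrightarrow> norm (drop_conj y - drop_conj y') < \<delta> \<Longrightarrow> y = y'"
    using Psi_inj by blast
  have "\<exists>S. openin TX S \<and> p \<in> S \<and> S \<subseteq> Psi ` G" if p: "p \<in> Psi ` G" for p
  proof -
    obtain y where y: "y \<in> G" "p = Psi y" using p by blast
    obtain B where B: "B > 0" "\<And>z. norm (drop_conj z) \<le> B * norm z"
      using linear_bounded_pos[OF linear_drop_conj] by blast
    obtain e where e: "e > 0" "ball y e \<subseteq> G" using assms y(1) open_contains_ball by blast
    define r where "r = min e (\<delta> / (2 * B))"
    have r: "r > 0" using e B \<delta> by (simp add: r_def)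
    have inj: "inj_on Psic (ball y r)"
    proof (rule inj_onI)
      fix x x' assume x: "x \<in> ball y r" "x' \<in> ball y r" "Psic x = Psic x'"
      then have "Psi x = Psi x'"
        using Psi_in Psi_face by (intro ray_chart_eq) (auto simp: Psic_eq)
      moreover have "norm (drop_conj x - drop_conj x') < \<delta>"
      proof -
        have "norm (x - x') < 2 * r"
          using x dist_triangle2[of x x' y] by (auto simp: dist_norm norm_minus_commute)
        also have "\<dots> \<le> \<delta> / B" using B(1) by (simp add: r_def min_def field_simps)
        finally have "B * norm (x - x') < \<delta>" using B(1) by (simp add: field_simps)
        then show ?thesis using B(2)[of "x - x'"] by (simp add: drop_conj_diff)
      qed
      ultimately show "x = x'" by (rule \<delta>(2))
    qed
    have "open (Psic ` ball y r)"
      by (rule invariance_of_domain[OF continuous_Psic open_ball inj])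
    moreover have "({p \<in> toric_points Fan. fst p face_of ray_cone (v j1)}, \<lambda>p. \<chi> j. snd p (m j)) \<in> toric_charts Fan"
      using toric_chartI[OF ray dual, of "{j1}"] by simp
    ultimately have "openin TX {p \<in> {p \<in> toric_points Fan. fst p face_of ray_cone (v j1)}. (\<chi> j. snd p (m j)) \<in> Psic ` ball y r}"
      by (intro openin_chart)
    moreover have "{p \<in> {p \<in> toric_points Fan. fst p face_of ray_cone (v j1)}. (\<chi> j. snd p (m j)) \<in> Psic ` ball y r} = Psi ` ball y r"
      using ray_chart_eq Psi_in Psi_face by (auto simp: Psic_eq[symmetric])
    ultimately have "openin TX (Psi ` ball y r)" by simp
    moreover have "p \<in> Psi ` ball y r" using y r by simp
    moreover have "Psi ` ball y r \<subseteq> Psi ` G" using e(2) by (auto simp: r_def)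
    ultimately show ?thesis by blast
  qed
  then show ?thesis by (subst openin_subopen) blast
qed

end

lemma vec_linear_iff:
  "Vector_Spaces.linear (*s) (*s) f \<longleftrightarrow> (\<forall>x y. f (x + y) = f x + f y) \<and> (\<forall>c x. f (c *s x) = c *s f x)"
  for f :: "'a::field ^ 'n \<Rightarrow> 'a ^ 'm"
  by (simp add: Vector_Spaces.linear_iff vec.vector_space_axioms)

lemma vec_functional_linear_iff:
  "Vector_Spaces.linear (*s) (*) f \<longleftrightarrow> (\<forall>x y. f (x + y) = f x + f y) \<and> (\<forall>c x. f (c *s x) = c * f x)"
  for f :: "'a::field ^ 'n \<Rightarrow> 'a"
  by (simp add: Vector_Spaces.linear_iff vec.vector_space_axioms vector_space_over_itself.vector_space_axioms)

section \<open>Charts of the quotient manifold\<close>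

context unit_fan_data
begin

abbreviation U :: "('r + 'c + 'c) tpoint set set" where "U \<equiv> U_set \<beta> \<Delta> b"
abbreviation TQ :: "('r + 'c + 'c) tpoint set topology" where "TQ \<equiv> fst (X_quot \<beta> \<Delta>)"
abbreviation TU :: "('r + 'c + 'c) tpoint set topology" where "TU \<equiv> subtopology TQ U"
abbreviation Wo :: "('r + 'c + 'c) tpoint set \<Rightarrow> ('r + 'c + 'c) tpoint set set" where
  "Wo \<equiv> W_orbit \<sigma> \<beta> W"
abbreviation act :: "'k \<Rightarrow> ('r + 'c + 'c) tpoint set \<Rightarrow> ('r + 'c + 'c) tpoint set" where
  "act u P \<equiv> toric_map (um u) ` P"
abbreviation Y :: "(('r + 'c + 'c) tpoint set set, 'r + 'c) cmfd" where "Y \<equiv> Y_manifold \<sigma> \<beta> \<Delta> b W"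

lemma TQ_eq: "TQ = quotient_topology TX (H_orbit \<beta>)"
  by (simp add: X_quot_def quotient_cmfd_def X_Delta_def toric_manifold_def)

lemma openin_TQ:
  "openin TQ V \<longleftrightarrow> V \<subseteq> H_orbit \<beta> ` toric_points Fan \<and> openin TX {p \<in> toric_points Fan. H_orbit \<beta> p \<in> V}"
  unfolding TQ_eq openin_quotient_topology topspace_TX ..

lemma topspace_quotient_topology: "topspace (quotient_topology T q) = q ` topspace T"
proof
  show "topspace (quotient_topology T q) \<subseteq> q ` topspace T"
    using openin_topspace openin_quotient_topology by metis
  have "{p \<in> topspace T. q p \<in> q ` topspace T} = topspace T" by blast
  then have "openin (quotient_topology T q) (q ` topspace T)"
    unfolding openin_quotient_topology by simp
  then show "q ` topspace T \<subseteq> topspace (quotient_topology T q)" by (rule openin_subset)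
qed

lemma topspace_TQ: "topspace TQ = H_orbit \<beta> ` toric_points Fan"
  unfolding TQ_eq topspace_quotient_topology topspace_TX ..

lemma topspace_TU: "topspace TU = H_orbit \<beta> ` toric_points Fan \<inter> U"
  by (simp add: topspace_TQ)

lemma fst_Y: "fst Y = quotient_topology TU Wo"
  by (simp add: Y_manifold_def quotient_cmfd_def open_subcmfd_def)

lemma openin_Y:
  "openin (fst Y) V \<longleftrightarrow> V \<subseteq> Wo ` topspace TU \<and> openin TU {P \<in> topspace TU. Wo P \<in> V}"
  unfolding fst_Y openin_quotient_topology ..

lemma fan_point_torus:
  assumes "p \<in> toric_points Fan" "fst p = {0}"
  obtains z where "p = tor z"
proof -
  obtain z0 e where "e \<in> fst p" "e = 0 \<Longrightarrow> p = tor z0" using torus_approach[OF assms(1)] by metis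
  then show ?thesis using assms(2) that by simp
qed

lemma U_iff_torus: "H_orbit \<beta> (tor z) \<in> U \<longleftrightarrow> (\<chi> i. Im (z $ Inl i)) \<in> Omega TYPE('c) b"
proof -
  have "H_orbit \<beta> (tor z) \<in> C0_set \<beta>" unfolding C0_eq by blast
  then show ?thesis unfolding U_set_def using U0_iff by blast
qed

lemma U_boundary:
  assumes "p \<in> toric_points Fan" "fst p \<noteq> {0}"
  shows "H_orbit \<beta> p \<in> U"
  unfolding U_set_def topspace_TQ using H_orbit_not_C0[OF assms] assms(1) by blast

lemma act_H_orbit: "u \<in> W \<Longrightarrow> p \<in> toric_points Fan \<Longrightarrow> act u (H_orbit \<beta> p) = H_orbit \<beta> (toric_map (um u) p)"
  by (rule toric_map_H_orbit)

lemma act_act: "u \<in> W \<Longrightarrow> u' \<in> W \<Longrightarrow> act u (act u' P) = act (u * u') P"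
  by (simp add: image_image toric_map_mult)

lemma act_1: "act 1 P = P"
  by (simp add: toric_map_1)

lemma Im_unit_act: "Im (unit_act \<sigma> u z $ Inl i) = Re (\<sigma> (Inl i) u) * Im (z $ Inl i)"
  by (simp add: unit_act_def)

lemma Omega_unit_act: "u \<in> W \<Longrightarrow> real_unit_act \<sigma> u x \<in> Omega TYPE('c) b \<longleftrightarrow> x \<in> Omega TYPE('c) b"
  by (simp add: Omega_def real_unit_act_def zero_less_mult_iff W_pos less_not_sym[OF W_pos])

lemma act_U:
  assumes u: "u \<in> W" and P: "P \<in> topspace TU"
  shows "act u P \<in> topspace TU"
proof -
  obtain p where p: "p \<in> toric_points Fan" "P = H_orbit \<beta> p" "P \<in> U"
    using P unfolding topspace_TU by blast
  have act: "act u P = H_orbit \<beta> (toric_map (um u) p)" using act_H_orbit[OF u p(1)] p(2) by simp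
  have in': "toric_map (um u) p \<in> toric_points Fan" by (rule toric_map_in[OF u p(1)])
  have "act u P \<in> U"
  proof (cases "fst p = {0}")
    case True
    then obtain z where z: "p = tor z" using fan_point_torus[OF p(1)] by blast
    have "(\<chi> i. Im (unit_act \<sigma> u z $ Inl i)) = real_unit_act \<sigma> u (\<chi> i. Im (z $ Inl i))"
      by (simp add: vec_eq_iff real_unit_act_def Im_unit_act)
    then show ?thesis
      using p(3) Omega_unit_act[OF u] unfolding act unfolding p(2) z toric_map_tor[OF u] U_iff_torus by simp
  next
    case False
    have "0 \<in> fst p" using Fan_convex_cone p(1) by (auto simp: toric_points_def convex_cone_contains_0)
    then obtain x where x: "x \<in> fst p" "x \<noteq> 0" using False by blast
    then have "um u *v x \<in> fst (toric_map (um u) p)" by (cases p) (simp add: toric_map_def)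
    moreover have "um u *v x \<noteq> 0" using x(2) um_um_inverse(2)[OF u, of x] by (metis matrix_vector_mult_0_right)
    ultimately have "fst (toric_map (um u) p) \<noteq> {0}" by blast
    then show ?thesis unfolding act by (rule U_boundary[OF in'])
  qed
  then show ?thesis unfolding topspace_TU using act in' by blast
qed

lemma Wo_self: "P \<in> Wo P"
  unfolding W_orbit_def using W_1 act_1 by blast

lemma Wo_act: "u \<in> W \<Longrightarrow> Wo (act u P) = Wo P"
proof -
  assume u: "u \<in> W"
  have "{act w (act u P) | w. w \<in> W} = {act w P | w. w \<in> W}"
  proof (intro equalityI subsetI)
    fix Q assume "Q \<in> {act w (act u P) | w. w \<in> W}"
    then obtain w where "w \<in> W" "Q = act (w * u) P" using act_act u by blast
    then show "Q \<in> {act w P | w. w \<in> W}" using W_mult u by blast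
  next
    fix Q assume "Q \<in> {act w P | w. w \<in> W}"
    then obtain w where w: "w \<in> W" "Q = act w P" by blast
    have wu: "w * inverse u \<in> W" using W_mult W_inv w u by blast
    have "act (w * inverse u) (act u P) = Q"
      using act_act[OF wu u, of P] W_nz[OF u] w(2) by (simp add: mult.assoc)
    then show "Q \<in> {act w (act u P) | w. w \<in> W}" using wu by blast
  qed
  then show ?thesis unfolding W_orbit_def .
qed

lemma Wo_eq_iff: "Wo P = Wo Q \<longleftrightarrow> (\<exists>u\<in>W. Q = act u P)"
proof
  assume "Wo P = Wo Q"
  then have "Q \<in> Wo P" using Wo_self[of Q] by simp
  then show "\<exists>u\<in>W. Q = act u P" unfolding W_orbit_def by blast
qed (use Wo_act in auto)

end

context unit_fan_ray
begin

text \<open>The imaginary parts of the real coordinates of the logarithm \<open>\<zeta> V1 + hat y\<close>, that is, the image of the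
  point under \<open>ord\<close> up to the factor \<open>2 \<pi>\<close>.\<close>

definition ord_im :: "complex ^ ('r + 'c) \<Rightarrow> real ^ 'r::{finite,linorder}" where
  "ord_im y = (\<chi> i. - ln (cmod (y $ Inl i0)) / (2 * pi) * Re (V1 $ Inl i) + (if i = i0 then 0 else Im (y $ Inl i)))"

lemma Im_Ln_2pi: "w \<noteq> 0 \<Longrightarrow> Im (Ln w / (2 * \<i> * complex_of_real pi)) = - ln (cmod w) / (2 * pi)"
proof -
  assume "w \<noteq> 0"
  then have "Ln w / (2 * \<i> * complex_of_real pi) = - \<i> * Ln w / of_real (2 * pi)" by (simp add: field_simps)
  then show ?thesis using \<open>w \<noteq> 0\<close> by (simp only: Im_divide_of_real) simp
qed

lemma V1_real: "Im (V1 $ Inl i) = 0"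
  by (simp add: V1_def real_point_real)

lemma ord_im_torus:
  assumes "z $ Inl i0 \<noteq> 0"
  shows "Im (((Ln (z $ Inl i0) / (2 * \<i> * complex_of_real pi)) *s V1 + hat z) $ Inl i) = ord_im (drop_conj z) $ i"
proof -
  define \<kappa> where "\<kappa> = Ln (z $ Inl i0) / (2 * \<i> * complex_of_real pi)"
  have "Im \<kappa> = - ln (cmod (z $ Inl i0)) / (2 * pi)" unfolding \<kappa>_def by (rule Im_Ln_2pi[OF assms])
  then show ?thesis unfolding \<kappa>_def[symmetric] by (simp add: ord_im_def V1_real hat_def)
qed

lemma Psi_torus_ord_im:
  assumes "z $ Inl i0 \<noteq> 0"
  obtains z' where "Psi z = tor z'" "\<And>i. Im (z' $ Inl i) = ord_im (drop_conj z) $ i"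
  using Psi_torus_ex[OF assms] ord_im_torus[OF assms] by metis

lemma v1_nz: "v j1 \<noteq> 0"
  using dual_rules(1)[of j1 j1] by auto

lemma ray_nz: "ray_cone (v j1) \<noteq> {0}"
  using v1_nz hull_inc[of "v j1" "{v j1}" convex_cone] by auto

lemma fst_Psi: "fst (Psi z) = {0} \<longleftrightarrow> z $ Inl i0 \<noteq> 0"
  using ray_nz by (simp add: Psi_def)

lemma X_param_in: "X_param y \<in> topspace TQ"
  unfolding X_param_def topspace_TQ using Psi_in by blast

lemma X_param_U_torus: "y $ Inl i0 \<noteq> 0 \<Longrightarrow> X_param y \<in> U \<longleftrightarrow> ord_im y \<in> Omega TYPE('c) b"
proof -
  assume y: "y $ Inl i0 \<noteq> 0"
  obtain z' where z': "Psi (pad y) = tor z'" "\<And>i. Im (z' $ Inl i) = ord_im y $ i"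
    using Psi_torus_ord_im[of "pad y"] y by auto
  have "(\<chi> i. Im (z' $ Inl i)) = ord_im y" by (simp add: z' vec_eq_iff)
  then show ?thesis unfolding X_param_def z'(1) U_iff_torus by simp
qed

lemma X_param_U_boundary: "y $ Inl i0 = 0 \<Longrightarrow> X_param y \<in> U"
  unfolding X_param_def by (rule U_boundary[OF Psi_in]) (simp add: fst_Psi)

lemma X_param_eqD: "X_param y = X_param y' \<Longrightarrow> \<exists>z. drop_conj z = y' \<and> Psi z = Psi (pad y)"
proof -
  assume "X_param y = X_param y'"
  moreover have "Psi (pad y) \<in> X_param y" unfolding X_param_eq by (metis (mono_tags, lifting) drop_conj_pad mem_Collect_eq)
  ultimately show ?thesis unfolding X_param_eq by auto
qed

definition Y_param :: "complex ^ ('r + 'c) \<Rightarrow> ('r + 'c + 'c) tpoint set set" where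
  "Y_param y = Wo (X_param y)"

text \<open>The sets on which the parametrization of \<open>Y\<close> is the inverse of a chart.\<close>

definition chart_dom :: "(complex ^ ('r + 'c)) set \<Rightarrow> bool" where
  "chart_dom G \<longleftrightarrow> open G \<and> X_param ` G \<subseteq> U \<and> inj_on Y_param G"

lemma open_drop_vimage: "open G \<Longrightarrow> open {z. drop_conj z \<in> G}"
  using open_vimage[OF _ linear_continuous_on[OF linear_drop_conj[unfolded linear_conv_bounded_linear]], of G]
  by (simp add: vimage_def)

lemma open_pad_vimage: "open G \<Longrightarrow> open {z. pad z \<in> G}"
  using open_vimage[OF _ linear_continuous_on[OF linear_pad[unfolded linear_conv_bounded_linear]], of G]
  by (simp add: vimage_def)

lemma open_Psi_vimage: "openin TX S \<Longrightarrow> open {z. Psi z \<in> S}"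
  using openin_continuous_map_preimage[OF continuous_Psi, of S] by simp

lemma nonzero_coordinate_dense:
  fixes S :: "(complex ^ 'n) set"
  assumes "open S" "z \<in> S"
  shows "\<exists>z'\<in>S. z' $ i \<noteq> 0"
proof (cases "z $ i = 0")
  case True
  obtain e where e: "e > 0" "ball z e \<subseteq> S" using assms open_contains_ball by blast
  define z' where "z' = z + (e / 2) *\<^sub>R axis i 1"
  have "dist z z' < e" using e(1) by (simp add: z'_def dist_norm)
  moreover have "z' $ i \<noteq> 0" using True e(1) by (simp add: z'_def axis_def)
  ultimately show ?thesis using e(2) by auto
qed (use assms in blast)

text \<open>If a unit \<open>u\<close> identifies two points of the set, then by openness it identifies nearby points of the
  torus, where \<open>N\<close> forces \<open>u = 1\<close>. In this way only the torus has to be considered, although the set may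
  meet the boundary.\<close>

lemma chart_domI:
  assumes \<delta>: "\<And>y y'. Psi y = Psi y' \<Longrightarrow> norm (drop_conj y - drop_conj y') < \<delta> \<Longrightarrow> y = y'"
    and G: "open G" and small: "\<And>y y'. y \<in> G \<Longrightarrow> y' \<in> G \<Longrightarrow> norm (y - y') < \<delta>"
    and N: "N \<subseteq> Omega TYPE('c) b" "\<And>u. u \<in> W \<Longrightarrow> u \<noteq> 1 \<Longrightarrow> real_unit_act \<sigma> u ` N \<inter> N = {}"
    and GN: "\<And>y. y \<in> G \<Longrightarrow> y $ Inl i0 \<noteq> 0 \<Longrightarrow> ord_im y \<in> N"
  shows "chart_dom G"
  unfolding chart_dom_def
proof (intro conjI)
  show "X_param ` G \<subseteq> U"
    using GN N(1) X_param_U_torus X_param_U_boundary by blast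
  show "inj_on Y_param G"
  proof (rule inj_onI)
    fix y y' assume y: "y \<in> G" "y' \<in> G" "Y_param y = Y_param y'"
    then obtain u where u: "u \<in> W" "X_param y' = act u (X_param y)" unfolding Y_param_def Wo_eq_iff by blast
    show "y = y'"
    proof (cases "u = 1")
      case True
      then have "X_param y = X_param y'" using u(2) act_1 by simp
      then obtain z where z: "drop_conj z = y'" "Psi z = Psi (pad y)" using X_param_eqD by blast
      then have "z = pad y" using small[OF y(2,1)] by (intro \<delta>) simp_all
      then show ?thesis using z(1) by simp
    next
      case False
      define S where "S = {z. drop_conj z \<in> G}"
      have S: "open S" unfolding S_def by (rule open_drop_vimage[OF G])
      \<comment> \<open>Parameters of the points that \<open>u\<close> moves into the image of \<open>S\<close>.\<close>
      define S2 where "S2 = {z. Psi z \<in> {p \<in> topspace TX. toric_map (um u) p \<in> Psi ` S}}"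
      have "open S2" unfolding S2_def
        by (intro open_Psi_vimage openin_continuous_map_preimage[OF continuous_toric_map[OF u(1)]] open_Psi S)
      moreover have "pad y \<in> S2"
      proof -
        have "Psi (pad y) \<in> X_param y" unfolding X_param_def by (rule H_orbit_self[OF Psi_in])
        then have "toric_map (um u) (Psi (pad y)) \<in> X_param y'" using u(2) by blast
        then have "toric_map (um u) (Psi (pad y)) \<in> Psi ` S"
          unfolding X_param_eq S_def using y(2) by blast
        then show ?thesis unfolding S2_def topspace_TX using Psi_in by blast
      qed
      moreover have "pad y \<in> S" using y(1) by (simp add: S_def)
      ultimately obtain z2 where z2: "z2 \<in> S" "z2 \<in> S2" "z2 $ Inl i0 \<noteq> 0"
        using nonzero_coordinate_dense[OF open_Int[OF S, of S2]] by blast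
      then obtain z3 where z3: "z3 \<in> S" "toric_map (um u) (Psi z2) = Psi z3" unfolding S2_def by blast
      obtain w2 where w2: "Psi z2 = tor w2" "\<And>i. Im (w2 $ Inl i) = ord_im (drop_conj z2) $ i"
        using Psi_torus_ord_im[OF z2(3)] by blast
      have z3': "Psi z3 = tor (unit_act \<sigma> u w2)" using z3(2) w2(1) toric_map_tor[OF u(1)] by simp
      then have z30: "z3 $ Inl i0 \<noteq> 0" using fst_Psi[of z3] by (simp add: tor_eq)
      then obtain w3 where w3: "Psi z3 = tor w3" "\<And>i. Im (w3 $ Inl i) = ord_im (drop_conj z3) $ i"
        using Psi_torus_ord_im by blast
      have "ord_im (drop_conj z3) = real_unit_act \<sigma> u (ord_im (drop_conj z2))"
        using tor_eqD[of w3 "unit_act \<sigma> u w2"] w3 z3' w2(2)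
        by (simp add: vec_eq_iff real_unit_act_def Im_unit_act)
      moreover have "ord_im (drop_conj z2) \<in> N" "ord_im (drop_conj z3) \<in> N"
        using GN z2 z3(1) z30 by (simp_all add: S_def)
      ultimately show ?thesis using N(2)[OF u(1) False] by blast
    qed
  qed
qed fact

lemma openin_Y_Y_param:
  assumes G: "open G" "X_param ` G \<subseteq> U"
  shows "openin (fst Y) (Y_param ` G)"
  unfolding openin_Y
proof
  have R0U: "X_param y \<in> topspace TU" if "y \<in> G" for y using that G(2) X_param_in by auto
  show "Y_param ` G \<subseteq> Wo ` topspace TU" unfolding Y_param_def using R0U by blast
  define S where "S = (\<Union>u\<in>W. toric_map (um u) ` Psi ` {z. drop_conj z \<in> G})"
  have "openin TX S" unfolding S_def
    by (intro openin_Union ballI) (auto intro!: open_toric_map open_Psi open_drop_vimage G)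
  have S: "p \<in> S \<longleftrightarrow> (\<exists>u\<in>W. \<exists>y\<in>G. H_orbit \<beta> p = act u (X_param y))" if p: "p \<in> toric_points Fan" for p
  proof
    assume "p \<in> S"
    then obtain u z where uz: "u \<in> W" "drop_conj z \<in> G" "p = toric_map (um u) (Psi z)"
      unfolding S_def by blast
    then have "H_orbit \<beta> p = act u (X_param (drop_conj z))"
      using act_H_orbit[OF uz(1) Psi_in] H_orbit_Psi_X_param by simp
    then show "\<exists>u\<in>W. \<exists>y\<in>G. H_orbit \<beta> p = act u (X_param y)" using uz by blast
  next
    assume "\<exists>u\<in>W. \<exists>y\<in>G. H_orbit \<beta> p = act u (X_param y)"
    then obtain u y where uy: "u \<in> W" "y \<in> G" "H_orbit \<beta> p = act u (X_param y)" by blast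
    then have "p \<in> act u (X_param y)" using H_orbit_self[OF p] by simp
    then show "p \<in> S" unfolding S_def X_param_eq using uy by blast
  qed
  define Q where "Q = H_orbit \<beta> ` (S \<inter> toric_points Fan)"
  have "{p \<in> toric_points Fan. H_orbit \<beta> p \<in> Q} = S \<inter> toric_points Fan"
  proof (intro equalityI subsetI)
    fix p assume "p \<in> {p \<in> toric_points Fan. H_orbit \<beta> p \<in> Q}"
    then obtain q where q: "p \<in> toric_points Fan" "q \<in> S" "q \<in> toric_points Fan" "H_orbit \<beta> p = H_orbit \<beta> q"
      unfolding Q_def by blast
    then have "p \<in> S" using S[OF q(1)] S[OF q(3)] by simp
    then show "p \<in> S \<inter> toric_points Fan" using q(1) by blast
  qed (simp add: Q_def)
  moreover have "S \<inter> toric_points Fan = S"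
    using openin_subset[OF \<open>openin TX S\<close>] unfolding topspace_TX by (rule Int_absorb2)
  moreover have "Q \<subseteq> H_orbit \<beta> ` toric_points Fan" unfolding Q_def by (rule image_mono) simp
  ultimately have "openin TQ Q"
    unfolding openin_TQ using \<open>openin TX S\<close> by simp
  moreover have "{P \<in> topspace TU. Wo P \<in> Y_param ` G} = Q \<inter> U"
  proof (intro equalityI subsetI)
    fix P assume "P \<in> {P \<in> topspace TU. Wo P \<in> Y_param ` G}"
    then obtain y p where yp: "y \<in> G" "Wo (X_param y) = Wo P" "P = H_orbit \<beta> p" "p \<in> toric_points Fan" "P \<in> U"
      unfolding Y_param_def topspace_TU by auto
    then have "p \<in> S" unfolding S[OF yp(4)] Wo_eq_iff by blast
    then show "P \<in> Q \<inter> U" unfolding Q_def using yp by blast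
  next
    fix P assume P: "P \<in> Q \<inter> U"
    then obtain p where p: "P = H_orbit \<beta> p" "p \<in> S" "p \<in> toric_points Fan" unfolding Q_def by blast
    then obtain u y where "u \<in> W" "y \<in> G" "P = act u (X_param y)" using S[OF p(3)] by blast
    then have "Wo P \<in> Y_param ` G" unfolding Y_param_def using Wo_act by blast
    then show "P \<in> {P \<in> topspace TU. Wo P \<in> Y_param ` G}" using P p unfolding topspace_TU by blast
  qed
  ultimately show "openin TU {P \<in> topspace TU. Wo P \<in> Y_param ` G}"
    unfolding openin_subtopology by blast
qed

lemma open_act_X_param_vimage:
  assumes u: "u \<in> W" and V: "openin TQ V"
  shows "open {y. act u (X_param y) \<in> V}"
proof -
  have "openin TX {p \<in> toric_points Fan. H_orbit \<beta> p \<in> V}" using V unfolding openin_TQ by blast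
  then have "openin TX {p \<in> topspace TX. toric_map (um u) p \<in> {p \<in> toric_points Fan. H_orbit \<beta> p \<in> V}}"
    by (rule openin_continuous_map_preimage[OF continuous_toric_map[OF u]])
  then have "open {y. pad y \<in> {z. Psi z \<in> {p \<in> topspace TX. toric_map (um u) p \<in> {p \<in> toric_points Fan. H_orbit \<beta> p \<in> V}}}}"
    by (intro open_pad_vimage open_Psi_vimage)
  moreover have "act u (X_param y) = H_orbit \<beta> (toric_map (um u) (Psi (pad y)))" for y
    unfolding X_param_def by (rule act_H_orbit[OF u Psi_in])
  ultimately show ?thesis using Psi_in toric_map_in[OF u] by (simp add: topspace_TX)
qed

lemma open_Y_param_vimage:
  assumes G: "open G" "X_param ` G \<subseteq> U" and V: "openin (fst Y) V"
  shows "open {y \<in> G. Y_param y \<in> V}"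
proof -
  obtain Q where Q: "openin TQ Q" "{P \<in> topspace TU. Wo P \<in> V} = Q \<inter> U"
    using V unfolding openin_Y openin_subtopology by blast
  have "Y_param y \<in> V \<longleftrightarrow> act 1 (X_param y) \<in> Q" if "y \<in> G" for y
  proof -
    have "X_param y \<in> topspace TU" using that G(2) X_param_in by auto
    then have "Y_param y \<in> V \<longleftrightarrow> X_param y \<in> Q \<inter> U" using Q(2) unfolding Y_param_def by blast
    then show ?thesis using that G(2) act_1 by auto
  qed
  then have "{y \<in> G. Y_param y \<in> V} = G \<inter> {y. act 1 (X_param y) \<in> Q}" by blast
  then show ?thesis using open_Int[OF G(1) open_act_X_param_vimage[OF W_1 Q(1)]] by simp
qed

lemma Y_param_homeomorphism:
  assumes "chart_dom G"
  shows "homeomorphic_map (subtopology (fst Y) (Y_param ` G)) (top_of_set G) (inv_into G Y_param)"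
proof -
  have G: "open G" "X_param ` G \<subseteq> U" "inj_on Y_param G" using assms by (auto simp: chart_dom_def)
  have VY: "Y_param ` G \<subseteq> topspace (fst Y)" using openin_Y_Y_param[OF G(1,2)] by (rule openin_subset)
  have "homeomorphic_maps (subtopology (fst Y) (Y_param ` G)) (top_of_set G) (inv_into G Y_param) Y_param"
    unfolding homeomorphic_maps_def
  proof (intro conjI ballI)
    show "continuous_map (subtopology (fst Y) (Y_param ` G)) (top_of_set G) (inv_into G Y_param)"
      unfolding continuous_map_def
    proof (intro conjI allI impI)
      show "inv_into G Y_param \<in> topspace (subtopology (fst Y) (Y_param ` G)) \<rightarrow> topspace (top_of_set G)"
        by (auto simp: inv_into_into)
      fix S assume "openin (top_of_set G) S"
      then obtain T where T: "open T" "S = G \<inter> T" unfolding openin_open by blast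
      have eq: "{P \<in> topspace (subtopology (fst Y) (Y_param ` G)). inv_into G Y_param P \<in> S} = Y_param ` (G \<inter> T)"
        using VY G(3) T(2) by auto
      have "openin (fst Y) (Y_param ` (G \<inter> T))"
        using G T(1) by (intro openin_Y_Y_param) auto
      moreover have "Y_param ` (G \<inter> T) = Y_param ` (G \<inter> T) \<inter> Y_param ` G" by blast
      ultimately show "openin (subtopology (fst Y) (Y_param ` G))
          {P \<in> topspace (subtopology (fst Y) (Y_param ` G)). inv_into G Y_param P \<in> S}"
        unfolding eq openin_subtopology by metis
    qed
    show "continuous_map (top_of_set G) (subtopology (fst Y) (Y_param ` G)) Y_param"
      unfolding continuous_map_def
    proof (intro conjI allI impI)
      show "Y_param \<in> topspace (top_of_set G) \<rightarrow> topspace (subtopology (fst Y) (Y_param ` G))"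
        using VY by auto
      fix S assume "openin (subtopology (fst Y) (Y_param ` G)) S"
      then obtain T where T: "openin (fst Y) T" "S = T \<inter> Y_param ` G" unfolding openin_subtopology by blast
      have "{y \<in> topspace (top_of_set G). Y_param y \<in> S} = {y \<in> G. Y_param y \<in> T}" using T(2) by auto
      then show "openin (top_of_set G) {y \<in> topspace (top_of_set G). Y_param y \<in> S}"
        using open_Y_param_vimage[OF G(1,2) T(1)] by (auto intro: openin_open_eq[OF G(1), THEN iffD2])
    qed
  qed (use G(3) VY in auto)
  then show ?thesis by (rule homeomorphic_maps_imp_map)
qed

end

lemma has_derivative_vec_lambda:
  fixes f :: "'a::real_normed_vector \<Rightarrow> 'i::finite \<Rightarrow> complex"
  assumes "\<And>i. ((\<lambda>x. f x i) has_derivative (\<lambda>h. f' h i)) (at x)"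
  shows "((\<lambda>x. \<chi> i. f x i) has_derivative (\<lambda>h. \<chi> i. f' h i)) (at x)"
proof (subst has_derivative_componentwise_within, intro ballI)
  fix e :: "complex ^ 'i" assume "e \<in> Basis"
  then obtain i c where e: "e = axis i c" by (auto simp: Basis_vec_def)
  show "((\<lambda>x. (\<chi> i. f x i) \<bullet> e) has_derivative (\<lambda>h. (\<chi> i. f' h i) \<bullet> e)) (at x)"
    using has_derivative_inner_left[OF assms[of i], of c] by (simp add: e inner_axis)
qed

context unit_fan_ray
begin

definition DPsic :: "complex ^ ('r + 'c + 'c) \<Rightarrow> complex ^ ('r + 'c + 'c) \<Rightarrow> complex ^ ('r + 'c + 'c)" where
  "DPsic z h = (\<chi> j. ((if j = j1 then h $ Inl i0 else 0) +
      (if j = j1 then z $ Inl i0 else 1) * ell (m j) h) * exp (ell (m j) z))"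

lemma has_derivative_ell: "(ell q has_derivative ell q) F"
  by (rule bounded_linear_imp_has_derivative[OF bounded_linear_ell])

lemma has_derivative_exp_ell: "((\<lambda>z. exp (ell q z)) has_derivative (\<lambda>h. ell q h * exp (ell q z))) (at z)"
proof -
  have "(exp has_derivative (*) (exp (ell q z))) (at (ell q z))"
    using DERIV_exp[of "ell q z"] by (simp add: has_field_derivative_def)
  from has_derivative_compose[OF has_derivative_ell this] show ?thesis by (simp add: mult.commute)
qed

lemma has_derivative_Psic: "(Psic has_derivative DPsic z) (at z)"
  unfolding Psic_def[abs_def] DPsic_def[abs_def]
proof (rule has_derivative_vec_lambda)
  fix j
  have c: "((\<lambda>z. if j = j1 then z $ Inl i0 else 1) has_derivative (\<lambda>h. if j = j1 then h $ Inl i0 else 0)) (at z)"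
    by (cases "j = j1") (auto intro!: bounded_linear_imp_has_derivative bounded_linear_vec_nth)
  show "((\<lambda>z. (if j = j1 then z $ Inl i0 else 1) * exp (ell (m j) z)) has_derivative
      (\<lambda>h. ((if j = j1 then h $ Inl i0 else 0) + (if j = j1 then z $ Inl i0 else 1) * ell (m j) h) * exp (ell (m j) z))) (at z)"
    using has_derivative_mult[OF c has_derivative_exp_ell[of "m j" z]] by (rule has_derivative_eq_rhs)
      (auto simp: fun_eq_iff algebra_simps)
qed

lemma DPsic_linear: "DPsic z (h + h') = DPsic z h + DPsic z h'" "DPsic z (a *s h) = a *s DPsic z h"
  by (simp_all add: DPsic_def vec_eq_iff ell_simps algebra_simps)

lemma surj_DPsic: "surj (DPsic z)"
proof -
  have lin: "linear (DPsic z)"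
    by (intro linearI) (simp_all add: DPsic_linear scaleR_eq_scalar)
  have "h = 0" if "DPsic z h = 0" for h
  proof -
    have comp: "((if j = j1 then h $ Inl i0 else 0) + (if j = j1 then z $ Inl i0 else 1) * ell (m j) h) = 0" for j
    proof -
      have "DPsic z h $ j = 0" using that by simp
      then show ?thesis by (simp add: DPsic_def)
    qed
    have ell0: "pairing (m j) (basis_coords \<beta> (hat h)) = 0" if "j \<noteq> j1" for j
      using comp[of j] that by (simp add: ell_def)
    define \<kappa> where "\<kappa> = pairing (m j1) (basis_coords \<beta> (hat h))"
    have "basis_coords \<beta> (hat h) = \<kappa> *s cvec (v j1)"
    proof -
      have "(\<Sum>j\<in>UNIV. pairing (m j) (basis_coords \<beta> (hat h)) *s cvec (v j)) =
          (\<Sum>j\<in>UNIV. if j = j1 then \<kappa> *s cvec (v j1) else 0)"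
        by (intro sum.cong refl) (auto simp: ell0 \<kappa>_def)
      then show ?thesis using cvec_expand[of "basis_coords \<beta> (hat h)"] by simp
    qed
    then have "from_coords (basis_coords \<beta> (hat h)) = from_coords (\<kappa> *s cvec (v j1))" by simp
    then have hat: "hat h = \<kappa> *s V1" by (simp add: V1_def real_point_def from_coords_scale)
    have "hat h $ Inl i0 = \<kappa> * a0" by (simp add: hat a0_def)
    then have "\<kappa> = 0" using a0(1) by (simp add: hat_simps)
    then have hat0: "hat h = 0" by (simp add: hat)
    then have "ell (m j1) h = 0"
      using linear_0[OF linear_basis_coords] by (simp add: ell_def pairing_simps)
    then have "h $ Inl i0 = 0" using comp[of j1] by simp
    moreover have "h $ i = 0" if "i \<noteq> Inl i0" for i
      using hat0 hat_simps(2)[OF that, of h] by simp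
    ultimately show "h = 0" unfolding vec_eq_iff zero_index by metis
  qed
  then have "inj (DPsic z)" using linear_injective_0[OF lin] by blast
  then show ?thesis using lin by (intro linear_inj_imp_surj)
qed

text \<open>In the chart of the ray, moved by \<open>u\<close>, the chart \<open>\<psi>\<close> of \<open>X\<close> is a submersion. Composed with the
  parametrization, whose differential is invertible, it depends only on the first \<open>s + t\<close> coordinates.\<close>

lemma X_chart_derivative:
  assumes X: "(V, \<psi>) \<in> snd (X_quot \<beta> \<Delta>)" and u: "u \<in> W" and y0: "act u (X_param y0) \<in> V"
  shows "\<exists>k'. ((\<lambda>y. \<psi> (act u (X_param y))) has_derivative k') (at y0) \<and>
            Vector_Spaces.linear (*s) (*s) k' \<and> surj k'"
proof -
  let ?k = "\<lambda>y. \<psi> (act u (X_param y))"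
  define m' where "m' j = transpose (um (inverse u)) *v m j" for j
  define v' where "v' j = um u *v v j" for j
  have dual': "dual_bases v' m'" unfolding v'_def m'_def by (rule dual_bases_um[OF u dual])
  have ray': "ray_cone (v' j1) = (*v) (um u) ` ray_cone (v j1)"
    using cone_hull_um[of u v "{j1}"] by (simp add: v'_def)
  then have rayF: "ray_cone (v' j1) \<in> Fan" using Fan_um[OF u ray] by simp
  define P where "P = {p \<in> toric_points Fan. fst p face_of ray_cone (v' j1)}"
  define \<phi> where "\<phi> = (\<lambda>p :: ('r + 'c + 'c) tpoint. \<chi> j. snd p (m' j))"
  have chart: "(P, \<phi>) \<in> toric_charts Fan"
    unfolding P_def \<phi>_def using toric_chartI[OF rayF dual', of "{j1}"] by simp
  have inj: "inj_on \<phi> P"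
  proof (rule inj_onI)
    fix p q assume "p \<in> P" "q \<in> P" "\<phi> p = \<phi> q"
    then show "p = q" unfolding P_def \<phi>_def
      by (intro ray_chart_inj[OF dual', where F = Fan and ?j1.0 = j1])
         (auto simp: vec_eq_iff intro: Fan_convex_cone)
  qed
  have Psi_P: "toric_map (um u) (Psi z) \<in> P" for z
  proof -
    have "fst (toric_map (um u) (Psi z)) = (*v) (um u) ` fst (Psi z)"
      by (cases "Psi z") (simp add: toric_map_def)
    then show ?thesis
      using toric_map_in[OF u Psi_in] face_um_iff[OF u] Psi_face unfolding P_def ray' by simp
  qed
  have \<phi>_Psi: "\<phi> (toric_map (um u) (Psi z)) = Psic z" for z
    by (cases "Psi z") (simp add: \<phi>_def m'_def toric_map_def Psic_eq transpose_um_inverse(2)[OF u])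
  define g where "g = \<psi> \<circ> H_orbit \<beta> \<circ> inv_into P \<phi>"
  have gk: "g (Psic z) = ?k (drop_conj z)" for z
  proof -
    have "inv_into P \<phi> (Psic z) = toric_map (um u) (Psi z)"
      using inv_into_f_f[OF inj Psi_P] \<phi>_Psi by metis
    then have "g (Psic z) = \<psi> (act u (H_orbit \<beta> (Psi z)))"
      by (simp add: g_def act_H_orbit[OF u Psi_in])
    then show ?thesis by (simp add: H_orbit_Psi_X_param)
  qed
  have "holomorphic_submersion (\<psi> \<circ> H_orbit \<beta> \<circ> inv_into P \<phi>) (\<phi> ` (P \<inter> {p \<in> topspace TX. H_orbit \<beta> p \<in> V}))"
    using X chart unfolding X_quot_def quotient_cmfd_def X_Delta_def toric_manifold_def by auto
  moreover have "Psic (pad y0) \<in> \<phi> ` (P \<inter> {p \<in> topspace TX. H_orbit \<beta> p \<in> V})"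
  proof (rule image_eqI)
    show "Psic (pad y0) = \<phi> (toric_map (um u) (Psi (pad y0)))" by (simp add: \<phi>_Psi)
    have "H_orbit \<beta> (toric_map (um u) (Psi (pad y0))) \<in> V"
      using y0 unfolding X_param_def act_H_orbit[OF u Psi_in] .
    then show "toric_map (um u) (Psi (pad y0)) \<in> P \<inter> {p \<in> topspace TX. H_orbit \<beta> p \<in> V}"
      using Psi_P toric_map_in[OF u Psi_in] by (simp add: topspace_TX)
  qed
  ultimately obtain g' where g': "(g has_derivative g') (at (Psic (pad y0)))" "Vector_Spaces.linear (*s) (*s) g'"
    and surj: "surj (frechet_derivative g (at (Psic (pad y0))))"
    unfolding holomorphic_submersion_def holomorphic_map_def g_def by blast
  have surj_g: "surj g'" using surj frechet_derivative_at[OF g'(1)] by simp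
  have pad': "(pad has_derivative pad) (at y0)"
    using linear_pad by (intro bounded_linear_imp_has_derivative) (simp add: linear_conv_bounded_linear)
  have drop': "(drop_conj has_derivative drop_conj) (at (pad y0))"
    using linear_drop_conj by (intro bounded_linear_imp_has_derivative) (simp add: linear_conv_bounded_linear)
  define k' where "k' h = g' (DPsic (pad y0) (pad h))" for h
  have gP: "((\<lambda>z. g (Psic z)) has_derivative (\<lambda>h. g' (DPsic (pad y0) h))) (at (pad y0))"
    by (rule has_derivative_compose[OF has_derivative_Psic g'(1)])
  have k: "(?k has_derivative k') (at y0)"
    using has_derivative_compose[OF pad' gP] unfolding k'_def[abs_def] by (simp add: gk)
  have "(?k has_derivative k') (at (drop_conj (pad y0)))" using k by simp
  from has_derivative_compose[OF drop' this]
  have "((\<lambda>z. g (Psic z)) has_derivative (\<lambda>h. k' (drop_conj h))) (at (pad y0))" by (simp add: gk)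
  then have "(\<lambda>h. k' (drop_conj h)) = (\<lambda>h. g' (DPsic (pad y0) h))"
    using gP by (rule has_derivative_unique)
  then have eq: "k' (drop_conj h) = g' (DPsic (pad y0) h)" for h by (rule fun_cong)
  have "surj k'"
    unfolding surj_def
  proof
    fix w
    obtain w1 where "w = g' w1" using surj_g by blast
    moreover obtain h where "w1 = DPsic (pad y0) h" using surj_DPsic by blast
    ultimately show "\<exists>x. w = k' x" using eq by metis
  qed
  moreover have "Vector_Spaces.linear (*s) (*s) k'"
    using g'(2) unfolding vec_linear_iff k'_def by (simp add: pad_add pad_scale DPsic_linear)
  ultimately show ?thesis using k by blast
qed

lemma snd_Y:
  "(V, \<phi>) \<in> snd Y \<longleftrightarrow> openin (fst Y) V \<and> open (\<phi> ` V) \<and>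
     homeomorphic_map (subtopology (fst Y) V) (top_of_set (\<phi> ` V)) \<phi> \<and>
     (\<forall>(V1, \<psi>) \<in> snd (X_quot \<beta> \<Delta>).
        holomorphic_submersion (\<phi> \<circ> Wo \<circ> inv_into (V1 \<inter> U) \<psi>)
          (\<psi> ` (V1 \<inter> U \<inter> {P \<in> topspace TU. Wo P \<in> V})))"
  unfolding fst_Y by (simp add: Y_manifold_def quotient_cmfd_def open_subcmfd_def split_beta)

text \<open>A chart \<open>\<psi>\<close> of \<open>X\<close> turns the parametrization into a map \<open>k\<close> between open sets of the same dimension with
  invertible differential. The transition to \<open>\<psi>\<close> is the inverse of \<open>k\<close>, hence holomorphic.\<close>

theorem parametrization_chart:
  assumes "chart_dom G"
  shows "(Y_param ` G, inv_into G Y_param) \<in> snd Y"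
  unfolding snd_Y
proof (intro conjI ballI)
  have G: "open G" "X_param ` G \<subseteq> U" "inj_on Y_param G" using assms by (auto simp: chart_dom_def)
  have im: "inv_into G Y_param ` Y_param ` G = G" using G(3) by (simp add: inv_into_image_cancel)
  show "openin (fst Y) (Y_param ` G)" by (rule openin_Y_Y_param[OF G(1,2)])
  show "open (inv_into G Y_param ` Y_param ` G)" using im G(1) by simp
  show "homeomorphic_map (subtopology (fst Y) (Y_param ` G)) (top_of_set (inv_into G Y_param ` Y_param ` G)) (inv_into G Y_param)"
    using Y_param_homeomorphism[OF assms] im by simp
  fix c assume c: "c \<in> snd (X_quot \<beta> \<Delta>)"
  obtain V1 \<psi> where c_eq: "c = (V1, \<psi>)" by (cases c)
  have X: "(V1, \<psi>) \<in> snd (X_quot \<beta> \<Delta>)" using c c_eq by simp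
  have V1: "openin TQ V1" "homeomorphic_map (subtopology TQ V1) (top_of_set (\<psi> ` V1)) \<psi>"
    using X unfolding TQ_eq by (auto simp: X_quot_def quotient_cmfd_def X_Delta_def toric_manifold_def)
  have inj_\<psi>: "inj_on \<psi> V1"
    using homeomorphic_imp_injective_map[OF V1(2)] openin_subset[OF V1(1)] by (simp add: Int_absorb1)
  define \<theta> where "\<theta> = inv_into G Y_param \<circ> Wo \<circ> inv_into (V1 \<inter> U) \<psi>"
  have point: "\<exists>g'. (\<theta> has_derivative g') (at x) \<and> Vector_Spaces.linear (*s) (*s) g' \<and> surj g'"
    if x: "x \<in> \<psi> ` (V1 \<inter> U \<inter> {P \<in> topspace TU. Wo P \<in> Y_param ` G})" for x
  proof -
    obtain P y0 where P: "x = \<psi> P" "P \<in> V1" "P \<in> topspace TU" "y0 \<in> G" "Wo (X_param y0) = Wo P"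
      using x unfolding Y_param_def by auto
    then obtain u where u: "u \<in> W" "P = act u (X_param y0)" unfolding Wo_eq_iff by blast
    define k where "k = (\<lambda>y. \<psi> (act u (X_param y)))"
    define G1 where "G1 = G \<inter> {y. act u (X_param y) \<in> V1}"
    have G1: "open G1" "y0 \<in> G1"
      unfolding G1_def using open_act_X_param_vimage[OF u(1) V1(1)] G(1) P(2,4) u(2) by auto
    have der: "\<exists>k'. (k has_derivative k') (at y) \<and> Vector_Spaces.linear (*s) (*s) k' \<and> surj k'" if "y \<in> G1" for y
      using X_chart_derivative[OF X u(1)] that unfolding k_def G1_def by blast
    have cont: "continuous_on G1 k"
      using der by (meson continuous_at_imp_continuous_on has_derivative_continuous)
    have \<theta>k: "\<theta> (k y) = y" if "y \<in> G1" for y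
    proof -
      have y: "y \<in> G" "act u (X_param y) \<in> V1" using that by (auto simp: G1_def)
      have "X_param y \<in> topspace TU" using y(1) G(2) X_param_in by auto
      then have "act u (X_param y) \<in> topspace TU" by (rule act_U[OF u(1)])
      then have "act u (X_param y) \<in> V1 \<inter> U" using y(2) by simp
      then have "inv_into (V1 \<inter> U) \<psi> (k y) = act u (X_param y)"
        unfolding k_def using inj_on_subset[OF inj_\<psi>, of "V1 \<inter> U"] by (intro inv_into_f_f) auto
      then have "\<theta> (k y) = inv_into G Y_param (Y_param y)" by (simp add: \<theta>_def Wo_act[OF u(1)] Y_param_def)
      then show ?thesis using G(3) y(1) by simp
    qed
    obtain k' where k': "(k has_derivative k') (at y0)" "Vector_Spaces.linear (*s) (*s) k'" "surj k'"
      using der[OF G1(2)] by blast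
    have lin: "linear k'" using k'(1) by (rule has_derivative_linear)
    have inj: "inj k'" using lin k'(3) by (rule linear_surj_imp_inj)
    define g' where "g' = inv k'"
    have kg: "k' (g' w) = w" and gk: "g' (k' w) = w" for w
      using k'(3) inj by (simp_all add: g'_def surj_f_inv_f)
    have "(\<theta> has_derivative g') (at (k y0))"
      using has_derivative_inverse_strong[OF G1 cont \<theta>k k'(1), of g'] kg by (simp add: fun_eq_iff)
    moreover have "Vector_Spaces.linear (*s) (*s) g'"
      using k'(2) kg gk unfolding vec_linear_iff by metis
    moreover have "surj g'" using gk by (metis surjI)
    moreover have "x = k y0" using P(1) u(2) by (simp add: k_def)
    ultimately show ?thesis by blast
  qed
  have "holomorphic_submersion \<theta> (\<psi> ` (V1 \<inter> U \<inter> {P \<in> topspace TU. Wo P \<in> Y_param ` G}))"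
    unfolding holomorphic_submersion_def holomorphic_map_def
  proof (intro conjI ballI)
    fix x assume x: "x \<in> \<psi> ` (V1 \<inter> U \<inter> {P \<in> topspace TU. Wo P \<in> Y_param ` G})"
    obtain g' where g': "(\<theta> has_derivative g') (at x)" "Vector_Spaces.linear (*s) (*s) g'" "surj g'"
      using point[OF x] by blast
    show "\<exists>f'. (\<theta> has_derivative f') (at x) \<and> Vector_Spaces.linear (*s) (*s) f'" using g' by blast
    show "surj (frechet_derivative \<theta> (at x))" using g' frechet_derivative_at[OF g'(1)] by simp
  qed
  then show "case c of (V1, \<psi>) \<Rightarrow> holomorphic_submersion (inv_into G Y_param \<circ> Wo \<circ> inv_into (V1 \<inter> U) \<psi>)
      (\<psi> ` (V1 \<inter> U \<inter> {P \<in> topspace TU. Wo P \<in> Y_param ` G}))"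
    unfolding c_eq \<theta>_def by simp
qed

subsection \<open>Existence of charts\<close>

lemma continuous_on_ord_im: "continuous_on {y. y $ Inl i0 \<noteq> 0} ord_im"
proof -
  have "continuous_on {y. y $ Inl i0 \<noteq> 0} (\<lambda>y :: complex ^ ('r + 'c). - ln (cmod (y $ Inl i0)) / (2 * pi) * Re (V1 $ Inl i) +
      (if i = i0 then 0 else Im (y $ Inl i)))" for i
    by (cases "i = i0") (auto intro!: continuous_intros)
  then show ?thesis unfolding ord_im_def[abs_def] by (intro continuous_on_vec_lambda)
qed

lemma chart_dom_torus:
  assumes y: "y $ Inl i0 \<noteq> 0" "ord_im y \<in> Omega TYPE('c) b"
  shows "\<exists>G. chart_dom G \<and> y \<in> G"
proof -
  obtain N where N: "open N" "ord_im y \<in> N" "N \<subseteq> Omega TYPE('c) b"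
    "\<forall>u\<in>W. u \<noteq> 1 \<longrightarrow> real_unit_act \<sigma> u ` N \<inter> N = {}"
    using wandering_neighbourhood[OF y(2)] by blast
  obtain \<delta> where \<delta>: "\<delta> > 0"
    "\<And>y y'. Psi y = Psi y' \<Longrightarrow> norm (drop_conj y - drop_conj y') < \<delta> \<Longrightarrow> y = y'"
    using Psi_inj by blast
  define G where "G = ({y. y $ Inl i0 \<noteq> 0} \<inter> ord_im -` N) \<inter> ball y (\<delta> / 2)"
  have "open ({y :: complex ^ ('r + 'c). y $ Inl i0 \<noteq> 0} \<inter> ord_im -` N)"
    by (intro continuous_open_preimage continuous_on_ord_im N(1) open_Collect_neq continuous_intros)
  then have "open G" unfolding G_def by (rule open_Int[OF _ open_ball])
  moreover have "norm (x - x') < \<delta>" if "x \<in> G" "x' \<in> G" for x x'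
    using that dist_triangle2[of x x' y] by (auto simp: G_def dist_norm norm_minus_commute)
  ultimately have "chart_dom G"
    using N \<delta>(2) by (intro chart_domI[of \<delta> G N]) (auto simp: G_def)
  moreover have "y \<in> G" using y N \<delta>(1) by (simp add: G_def)
  ultimately show ?thesis by blast
qed

text \<open>Interior points of a cone stay interior when they move along a ray of the cone. Hence if one point
  over the interior of a full-dimensional cone is moved along the ray towards the divisor, a whole
  neighbourhood of its limit lies over the interior, which the units move off itself.\<close>

lemma chart_dom_boundary:
  assumes J: "convex_cone hull (v ` J) \<in> Fan" "j1 \<in> J"
    and int: "interior (proj_real ` real_point ` (convex_cone hull (v ` J))) \<noteq> {}"
  shows "\<exists>G y. chart_dom G \<and> y \<in> G \<and> y $ Inl i0 = 0"
proof -
  let ?T = "proj_real ` real_point ` (convex_cone hull (v ` J)) :: (real ^ 'r::{finite,linorder}) set"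
  define N where "N = interior ?T"
  have T: "?T \<in> \<Delta>'" by (rule Fan_proj[OF J(1)])
  have cone: "convex_cone ?T"
    by (intro convex_cone_linear_image conjI linear_proj_real linear_real_point convex_cone_convex_cone_hull)
  define p1 :: "real ^ 'r::{finite,linorder}" where "p1 = proj_real V1"
  have p1: "p1 $ i = Re (V1 $ Inl i)" for i by (simp add: p1_def proj_real_def)
  have "v j1 \<in> convex_cone hull (v ` J)" using J(2) by (intro hull_inc) auto
  then have p1T: "p1 \<in> ?T" unfolding p1_def V1_def by blast
  have NT: "x + t *\<^sub>R p1 \<in> N" if x: "x \<in> N" and t: "t \<ge> 0" for x t
  proof -
    obtain e where e: "e > 0" "ball x e \<subseteq> ?T" using x unfolding N_def mem_interior by blast
    have tp: "t *\<^sub>R p1 \<in> ?T" using cone p1T t unfolding convex_cone_def conic_def by blast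
    have "ball (x + t *\<^sub>R p1) e \<subseteq> ?T"
    proof
      fix w assume "w \<in> ball (x + t *\<^sub>R p1) e"
      then have "w - t *\<^sub>R p1 \<in> ball x e" by (simp add: dist_norm algebra_simps)
      then have "w - t *\<^sub>R p1 \<in> ?T" using e(2) by blast
      then have "(w - t *\<^sub>R p1) + t *\<^sub>R p1 \<in> ?T" using convex_cone_add[OF cone _ tp] by blast
      then show "w \<in> ?T" by simp
    qed
    then show ?thesis unfolding N_def mem_interior using e(1) by blast
  qed
  obtain x0 where x0: "x0 \<in> N" using int unfolding N_def by blast
  have p1i0: "p1 $ i0 \<noteq> 0" using a0 by (simp add: p1 a0_def complex_eq_iff)
  \<comment> \<open>Decompose \<open>x0 = r0 p1 + \<mu>\<close> with \<open>\<mu>\<^sub>i\<^sub>0 = 0\<close>. The points over \<open>x0 + \<real>\<^sub>\<ge>\<^sub>0 p1\<close> with parameters \<open>\<i> \<mu>\<close>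
    converge to \<open>q\<close>, and \<open>ord_im y = g y + (t - r0) p1\<close> with \<open>g q = x0\<close>.\<close>
  define r0 where "r0 = x0 $ i0 / p1 $ i0"
  define g :: "complex ^ ('r + 'c) \<Rightarrow> real ^ 'r::{finite,linorder}"
    where "g y = (\<chi> i. r0 * p1 $ i + (if i = i0 then 0 else Im (y $ Inl i)))" for y
  have cont: "continuous_on UNIV g"
  proof -
    have "continuous_on UNIV (\<lambda>y :: complex ^ ('r + 'c). r0 * p1 $ i + (if i = i0 then 0 else Im (y $ Inl i)))" for i
      by (cases "i = i0") (auto intro!: continuous_intros)
    then show ?thesis unfolding g_def[abs_def] by (intro continuous_on_vec_lambda)
  qed
  define q :: "complex ^ ('r + 'c)"
    where "q = (\<chi> i. case i of Inl i \<Rightarrow> if i = i0 then 0 else \<i> * of_real (x0 $ i - r0 * p1 $ i) | Inr _ \<Rightarrow> 0)"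
  have gq: "g q = x0" using p1i0 by (simp add: g_def q_def r0_def vec_eq_iff)
  obtain \<delta> where \<delta>: "\<delta> > 0"
    "\<And>y y'. Psi y = Psi y' \<Longrightarrow> norm (drop_conj y - drop_conj y') < \<delta> \<Longrightarrow> y = y'"
    using Psi_inj by blast
  define G where "G = g -` N \<inter> {y. cmod (y $ Inl i0) < exp (- 2 * pi * r0)} \<inter> ball q (\<delta> / 2)"
  have "open G" unfolding G_def N_def
    by (intro open_Int open_vimage cont open_interior open_ball open_Collect_less continuous_intros)
  moreover have "norm (x - x') < \<delta>" if "x \<in> G" "x' \<in> G" for x x'
    using that dist_triangle2[of x x' q] by (auto simp: G_def dist_norm norm_minus_commute)
  moreover have "ord_im y \<in> N" if y: "y \<in> G" "y $ Inl i0 \<noteq> 0" for y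
  proof -
    define t where "t = - ln (cmod (y $ Inl i0)) / (2 * pi)"
    have "ln (cmod (y $ Inl i0)) < ln (exp (- 2 * pi * r0))"
      using y by (subst ln_less_cancel_iff) (auto simp: G_def)
    then have "t - r0 \<ge> 0" by (simp add: t_def field_simps)
    moreover have "ord_im y = g y + (t - r0) *\<^sub>R p1"
      unfolding ord_im_def t_def[symmetric] by (simp add: vec_eq_iff g_def p1 algebra_simps)
    moreover have "g y \<in> N" using y(1) by (simp add: G_def)
    ultimately show ?thesis using NT by simp
  qed
  ultimately have "chart_dom G"
    using Delta'_interior_Omega[OF T] Delta'_interior_wandering[OF T] \<delta>(2)
    by (intro chart_domI[of \<delta> G N]) (simp_all add: N_def)
  moreover have "q \<in> G" using gq x0 \<delta>(1) by (simp add: G_def) (simp add: q_def)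
  moreover have "q $ Inl i0 = 0" by (simp add: q_def)
  ultimately show ?thesis by blast
qed

end

section \<open>Pluricanonical sections\<close>

context unit_fan_data
begin

text \<open>Swapping conjugate coordinates and conjugating is an antilinear map that fixes the lattice basis, so a
  vector that is fixed has real coordinates in this basis.\<close>

lemma in_range_real_point:
  assumes "\<And>i. Im (z $ Inl i) = 0" "\<And>k. z $ Inr (Inl k) = cnj (z $ Inr (Inr k))"
  shows "z \<in> range real_point"
proof -
  define sw where "sw w = (\<chi> i. case i of Inl i \<Rightarrow> cnj (w $ Inl i) | Inr k \<Rightarrow>
    (case k of Inl k \<Rightarrow> cnj (w $ Inr (Inr k)) | Inr k \<Rightarrow> cnj (w $ Inr (Inl k))))"
    for w :: "complex ^ ('r + 'c + 'c)"
  have sw_iff: "sw w = w \<longleftrightarrow> (\<forall>i. Im (w $ Inl i) = 0) \<and> (\<forall>k. w $ Inr (Inl k) = cnj (w $ Inr (Inr k)))" for w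
    unfolding vec_sum_eq_iff by (auto simp: sw_def complex_eq_iff vec_eq_iff split: sum.splits)
  have sw_sum: "sw (\<Sum>j\<in>S. a j *s w j) = (\<Sum>j\<in>S. cnj (a j) *s sw (w j))" for S a w
    by (induction S rule: infinite_finite_induct) (auto simp: sw_def vec_eq_iff split: sum.splits)
  have "sw (\<beta> j) = \<beta> j" for j
    unfolding sw_iff using lat_real[OF basis_in_lat] lat_conj[OF basis_in_lat] by blast
  then have sw_from: "sw (from_coords c) = from_coords (\<chi> j. cnj (c $ j))" for c
    by (simp add: from_coords_def sw_sum)
  define c where "c = basis_coords \<beta> z"
  have "sw (from_coords c) = from_coords c" unfolding c_def using assms by (simp add: sw_iff)
  then have "from_coords (\<chi> j. cnj (c $ j)) = from_coords c" by (simp add: sw_from)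
  then have "basis_coords \<beta> (from_coords (\<chi> j. cnj (c $ j))) = basis_coords \<beta> (from_coords c)" by simp
  then have "(\<chi> j. cnj (c $ j)) = c" by simp
  then have "cnj (c $ j) = c $ j" for j by (simp add: vec_eq_iff)
  then have "Im (c $ j) = 0" for j using complex_is_Real_iff Reals_cnj_iff by metis
  then have "c = cvec (\<chi> j. Re (c $ j))" by (simp add: cvec_def vec_eq_iff complex_eq_iff)
  then have "z = real_point (\<chi> j. Re (c $ j))"
    unfolding real_point_def using from_coords_basis_coords[of z] by (simp add: c_def)
  then show ?thesis by blast
qed

lemma tor_lat: "l \<in> lat \<Longrightarrow> tor (z + l) = tor z"
  by (auto simp: tor_eq echar_simps echar_lat fun_eq_iff)

lemma H_orbit_tor_eq: "drop_conj z = drop_conj z' \<Longrightarrow> H_orbit \<beta> (tor z) = H_orbit \<beta> (tor z')"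
proof -
  assume "drop_conj z = drop_conj z'"
  then have h: "z' - z \<in> H_space" by (simp add: H_space_iff drop_conj_diff)
  then have "tor z' \<in> H_orbit \<beta> (tor z)" unfolding H_orbit_tor by (intro CollectI exI[of _ "z' - z"]) simp
  then show ?thesis using H_orbit_eq[OF tor_in] by blast
qed

lemma convex_Omega: "convex (Omega TYPE('c) b :: (real ^ 'r::{finite,linorder}) set)"
proof (rule convexI)
  fix x y :: "real ^ 'r::{finite,linorder}" and s t :: real
  assume "x \<in> Omega TYPE('c) b" "y \<in> Omega TYPE('c) b" and st: "0 \<le> s" "0 \<le> t" "s + t = 1"
  then have pos: "x $ i > 0 \<and> y $ i > 0" if "emb_index (Inl i :: 'r + 'c) \<le> b" for i
    using that by (simp add: Omega_def)
  have "s * x $ i + t * y $ i > 0" if "emb_index (Inl i :: 'r + 'c) \<le> b" for i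
  proof (cases "s = 0")
    case True
    then show ?thesis using pos[OF that] st by simp
  next
    case False
    then have "s * x $ i > 0" "t * y $ i \<ge> 0" using pos[OF that] st by auto
    then show ?thesis by simp
  qed
  then show "s *\<^sub>R x + t *\<^sub>R y \<in> Omega TYPE('c) b" by (simp add: Omega_def)
qed

definition im_part :: "complex ^ ('r + 'c) \<Rightarrow> real ^ 'r::{finite,linorder}" where
  "im_part z = (\<chi> i. Im (z $ Inl i))"

text \<open>The preimage of \<open>U\<^sub>0\<close> in its universal cover.\<close>

definition log_dom :: "(complex ^ ('r + 'c)) set" where
  "log_dom = {z. im_part z \<in> Omega TYPE('c) b}"

lemma linear_im_part: "linear im_part"
  by (intro linearI) (simp_all add: im_part_def vec_eq_iff)

lemma open_log_dom: "open log_dom" and convex_log_dom: "convex log_dom"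
proof -
  have "log_dom = im_part -` Omega TYPE('c) b" by (auto simp: log_dom_def)
  moreover have "continuous_on UNIV im_part"
    using linear_im_part by (intro linear_continuous_on) (simp add: linear_conv_bounded_linear)
  ultimately show "open log_dom" using open_Omega by (simp add: open_vimage)
  show "convex log_dom" using \<open>log_dom = _\<close> convex_linear_vimage[OF linear_im_part convex_Omega] by simp
qed

text \<open>Modulo the lattice, translations by \<open>\<real>\<^sup>s \<times> \<complex>\<^sup>t\<close> stay in a compact set. So \<open>F\<close> is bounded, hence constant,
  along \<open>\<complex>\<^sup>t\<close>. Then the projections of lattice vectors to \<open>\<real>\<^sup>s\<close> are periods; as these are dense, \<open>F\<close> is
  invariant under \<open>\<real>\<^sup>s\<close>, and its differential, being complex linear, is zero.\<close>

lemma periodic_constant: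
  assumes hol: "\<And>z. z \<in> log_dom \<Longrightarrow> \<exists>F'. (F has_derivative F') (at z) \<and> Vector_Spaces.linear (*s) (*) F'"
    and per: "\<And>z l. z \<in> log_dom \<Longrightarrow> l \<in> lat \<Longrightarrow> F (z + drop_conj l) = F z"
  shows "\<exists>a. \<forall>z\<in>log_dom. F z = a"
proof -
  have log_dom_shift: "z + w \<in> log_dom" if "z \<in> log_dom" "\<And>i. Im (w $ Inl i) = 0" for z w
    using that by (simp add: log_dom_def im_part_def)
  have cont: "continuous_on log_dom F"
    using hol by (meson continuous_at_imp_continuous_on has_derivative_continuous)
  define cx where "cx k c = (axis (Inr k) c :: complex ^ ('r + 'c))" for k :: 'c and c
  have cx_Inl: "cx k c $ Inl i = 0" for k c i by (simp add: cx_def axis_def)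
  have liouville: "F (z + cx k c) = F z" if z: "z \<in> log_dom" for z k c
  proof -
    define g where "g c = F (z + cx k c)" for c
    have in_log_dom: "z + cx k c \<in> log_dom" for c using log_dom_shift[OF z] cx_Inl by simp
    have "\<exists>d. (g has_field_derivative d) (at c)" for c
    proof -
      obtain F' where F': "(F has_derivative F') (at (z + cx k c))" "Vector_Spaces.linear (*s) (*) F'"
        using hol[OF in_log_dom] by blast
      have ax: "cx k c = c *s cx k 1" for c by (simp add: cx_def axis_def vec_eq_iff)
      have "linear (cx k)" by (intro linearI) (auto simp: cx_def axis_def vec_eq_iff)
      then have "((\<lambda>c. z + cx k c) has_derivative (cx k)) (at c)"
        using has_derivative_add[OF has_derivative_const bounded_linear_imp_has_derivative, of "cx k" z "at c"]
        by (simp add: linear_conv_bounded_linear)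
      then have "(g has_derivative (\<lambda>h. F' (cx k h))) (at c)"
        unfolding g_def[abs_def] using F'(1) by (rule has_derivative_compose)
      moreover have "F' (cx k h) = F' (cx k 1) * h" for h
        using F'(2) ax[of h] unfolding vec_functional_linear_iff by simp
      then have "(\<lambda>h. F' (cx k h)) = (*) (F' (cx k 1))" by (rule ext)
      ultimately show ?thesis unfolding has_field_derivative_def by (intro exI[of _ "F' (cx k 1)"]) simp
    qed
    then have "g holomorphic_on UNIV"
      by (simp add: holomorphic_on_open)
    moreover have "bounded (range g)"
    proof -
      define K where "K = (\<lambda>x. z + drop_conj (real_point x)) ` cbox 0 1"
      have lin: "linear (\<lambda>x. drop_conj (real_point x))"
        using linear_compose[OF linear_real_point linear_drop_conj] by (simp add: o_def)
      have "compact K" unfolding K_def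
        using lin by (intro compact_continuous_image continuous_intros linear_continuous_on)
          (auto simp: linear_conv_bounded_linear)
      moreover have KD: "K \<subseteq> log_dom"
        unfolding K_def using log_dom_shift[OF z] by (auto simp: real_point_real)
      ultimately have "bounded (F ` K)"
        using compact_continuous_image[OF continuous_on_subset[OF cont]] compact_imp_bounded by blast
      moreover have "g c \<in> F ` K" for c
      proof -
        define e :: "complex ^ ('r + 'c + 'c)" where "e = (\<chi> i. case i of Inl i \<Rightarrow> 0 | Inr k' \<Rightarrow>
          (case k' of Inl l \<Rightarrow> if l = k then c else 0 | Inr l \<Rightarrow> if l = k then cnj c else 0))"
        have "e \<in> range real_point" by (rule in_range_real_point) (simp_all add: e_def)
        then obtain x where x: "e = real_point x" by blast
        have de: "drop_conj e = cx k c"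
          by (simp add: vec_sum_eq_iff e_def cx_def axis_def)
        define fl fr where "fl = (\<chi> i. of_int \<lfloor>x $ i\<rfloor>)" and "fr = x - fl"
        have l: "real_point fl \<in> lat" by (simp add: lat_eq fl_def int_lattice_def)
        have "0 \<le> fr $ i \<and> fr $ i \<le> 1" for i
          using floor_correct[of "x $ i"] by (simp add: fr_def fl_def) linarith
        then have fr: "fr \<in> cbox 0 1" by (simp add: mem_box_cart)
        have "cx k c = drop_conj (real_point fr) + drop_conj (real_point fl)"
          by (simp add: de[symmetric] x drop_conj_add[symmetric] linear_add[OF linear_real_point, symmetric] fr_def)
        then have "g c = F ((z + drop_conj (real_point fr)) + drop_conj (real_point fl))"
          by (simp add: g_def add.assoc)
        also have "\<dots> = F (z + drop_conj (real_point fr))"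
          using KD fr by (intro per l) (auto simp: K_def)
        finally show ?thesis using fr by (auto simp: K_def)
      qed
      ultimately show ?thesis by (meson bounded_subset image_subset_iff)
    qed
    ultimately have "g constant_on UNIV" by (rule Liouville_theorem)
    then have "g c = g 0" unfolding constant_on_def by (metis UNIV_I)
    moreover have "cx k 0 = 0" by (simp add: cx_def axis_def vec_eq_iff)
    ultimately show ?thesis by (simp add: g_def)
  qed
  have complex_invariant: "F (z + w) = F z" if z: "z \<in> log_dom" and w: "\<And>i. w $ Inl i = 0" for z w
  proof -
    have "F (z + (\<Sum>k\<in>S. cx k (w $ Inr k))) = F z" for S
    proof (induction S rule: infinite_finite_induct)
      case (insert k S)
      have "z + (\<Sum>k\<in>S. cx k (w $ Inr k)) \<in> log_dom" by (rule log_dom_shift[OF z]) (simp add: cx_Inl)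
      then show ?case using insert liouville[of "z + (\<Sum>k\<in>S. cx k (w $ Inr k))" k "w $ Inr k"]
        by (simp add: add_ac)
    qed simp_all
    moreover have "(\<Sum>k\<in>UNIV. cx k (w $ Inr k)) = w"
      using w by (simp add: vec_sum_eq_iff cx_Inl) (simp add: cx_def axis_def)
    ultimately show ?thesis by metis
  qed
  \<comment> \<open>A lattice vector whose projection is close to \<open>w\<close> differs from the real vector with this projection
    only in the complex coordinates.\<close>
  have real_invariant: "F (z + w) = F z"
    if z: "z \<in> log_dom" and w: "\<And>i. Im (w $ Inl i) = 0" "\<And>k. w $ Inr k = 0" for z w
  proof (rule ccontr)
    assume ne: "F (z + w) \<noteq> F z"
    have zw: "z + w \<in> log_dom" by (rule log_dom_shift[OF z w(1)])
    have "open (log_dom \<inter> F -` (- {F z}))"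
      by (intro continuous_open_preimage[OF cont open_log_dom]) (simp add: open_Compl)
    then obtain e where e: "e > 0" "ball (z + w) e \<subseteq> log_dom \<inter> F -` (- {F z})"
      using zw ne by (metis ComplI Int_iff open_contains_ball singletonD vimageI2)
    define r :: "real ^ 'r::{finite,linorder}" where "r = (\<chi> i. Re (w $ Inl i))"
    obtain l where l: "l \<in> lat" "norm (proj_real l - r) < e"
      using proj_real_lattice_dense[OF e(1)] by blast
    define w' :: "complex ^ ('r + 'c)" where "w' = (\<chi> i. case i of Inl i \<Rightarrow> l $ Inl i | Inr k \<Rightarrow> 0)"
    have "F (z + w') = F z"
    proof -
      have "F ((z + drop_conj l) + (w' - drop_conj l)) = F (z + drop_conj l)"
        using lat_real[OF l(1)] by (intro complex_invariant log_dom_shift[OF z]) (simp_all add: w'_def)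
      then show ?thesis using per[OF z l(1)] by simp
    qed
    moreover have "norm (w' - w) < e"
    proof -
      have "w' - w = (\<chi> i. case i of Inl i \<Rightarrow> of_real ((proj_real l - r) $ i) | Inr k \<Rightarrow> 0)"
        using lat_real[OF l(1)] w
        by (simp add: vec_sum_eq_iff w'_def r_def proj_real_def complex_eq_iff)
      moreover have "norm ((\<chi> i. case i of Inl i \<Rightarrow> of_real (x $ i) | Inr k \<Rightarrow> 0) :: complex ^ ('r + 'c)) = norm x"
        for x :: "real ^ 'r::{finite,linorder}"
      proof -
        have "(\<Sum>i\<in>(UNIV :: ('r + 'c) set). (cmod (case i of Inl i \<Rightarrow> of_real (x $ i) | Inr (k::'c) \<Rightarrow> 0))\<^sup>2) = (\<Sum>i\<in>UNIV. (norm (x $ i))\<^sup>2)"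
          unfolding UNIV_Plus_UNIV[symmetric] by (subst sum.Plus) simp_all
        then show ?thesis by (simp add: norm_vec_def L2_set_def)
      qed
      ultimately show ?thesis using l(2) by simp
    qed
    then have "z + w' \<in> ball (z + w) e" by (simp add: dist_norm norm_minus_commute)
    ultimately show False using e(2) by blast
  qed
  have "(F has_derivative (\<lambda>h. 0)) (at z)" if z: "z \<in> log_dom" for z
  proof -
    obtain F' where F': "(F has_derivative F') (at z)" "Vector_Spaces.linear (*s) (*) F'"
      using hol[OF z] by blast
    have dir: "F' h = 0" if "\<And>t::real. F (z + t *\<^sub>R h) = F z" for h
    proof -
      have "((\<lambda>t::real. z + t *\<^sub>R h) has_derivative (\<lambda>t. t *\<^sub>R h)) (at 0)"
        by (auto intro!: derivative_eq_intros)
      moreover have "(F has_derivative F') (at (z + 0 *\<^sub>R h))" using F'(1) by simp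
      ultimately have "((\<lambda>t::real. F (z + t *\<^sub>R h)) has_derivative (\<lambda>t. F' (t *\<^sub>R h))) (at 0)"
        by (rule has_derivative_compose)
      moreover have "((\<lambda>t::real. F (z + t *\<^sub>R h)) has_derivative (\<lambda>t. 0)) (at 0)" using that by simp
      ultimately have "(\<lambda>t::real. F' (t *\<^sub>R h)) = (\<lambda>t. 0)" by (rule has_derivative_unique)
      then have "F' (1 *\<^sub>R h) = 0" by (rule fun_cong)
      then show ?thesis by simp
    qed
    have ax: "F' (axis i 1) = 0" for i
    proof (rule dir)
      fix t :: real
      show "F (z + t *\<^sub>R axis i 1) = F z"
      proof (cases i)
        case (Inl a)
        then show ?thesis by (intro real_invariant[OF z]) (auto simp: axis_def)
      next
        case (Inr a)
        then show ?thesis by (intro complex_invariant[OF z]) (auto simp: axis_def)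
      qed
    qed
    have F'_sum: "F' (\<Sum>i\<in>S. c i *s axis i 1) = 0" for S c
      using F'(2) ax unfolding vec_functional_linear_iff
      by (induction S rule: infinite_finite_induct) (simp_all, (metis mult_zero_left vector_smult_lzero)+)
    have "F' h = 0" for h
      using F'_sum[of "\<lambda>i. h $ i" UNIV] by (simp add: basis_expansion)
    then have "F' = (\<lambda>h. 0)" by blast
    then show ?thesis using F'(1) by simp
  qed
  then show ?thesis
    using has_derivative_zero_constant[OF convex_log_dom, of F] has_derivative_at_withinI by blast
qed

end

context unit_fan_ray
begin

abbreviation tpi :: complex where "tpi \<equiv> 2 * \<i> * complex_of_real pi"

text \<open>From logarithmic coordinates to those of \<open>Psi\<close>, modulo \<open>H\<close>.\<close>

definition of_log :: "complex ^ ('r + 'c) \<Rightarrow> complex ^ ('r + 'c)" where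
  "of_log z = (\<chi> i. if i = Inl i0 then exp (tpi * (z $ Inl i0 / a0))
     else z $ i - z $ Inl i0 / a0 * drop_conj V1 $ i)"

lemma of_log_nz: "of_log z $ Inl i0 \<noteq> 0"
  by (simp add: of_log_def)

lemma Psi_of_log:
  obtains x where "Psi (pad (of_log z)) = tor x" "drop_conj x = z"
proof -
  define \<zeta> where "\<zeta> = z $ Inl i0 / a0"
  have "Psi (pad (of_log z)) = tor (\<zeta> *s V1 + hat (pad (of_log z)))"
    by (rule Psi_torus) (simp add: of_log_def \<zeta>_def)
  moreover have "drop_conj (\<zeta> *s V1 + hat (pad (of_log z))) = z"
    using a0(1) by (simp add: vec_sum_eq_iff hat_def of_log_def \<zeta>_def a0_def)
  ultimately show ?thesis using that by blast
qed

lemma X_param_of_log: "X_param (of_log z) = H_orbit \<beta> (tor (pad z))"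
proof -
  obtain x where "Psi (pad (of_log z)) = tor x" "drop_conj x = z" using Psi_of_log .
  then show ?thesis unfolding X_param_def using H_orbit_tor_eq[of x "pad z"] by simp
qed

lemma ord_im_of_log: "ord_im (of_log z) = im_part z"
proof -
  obtain x where x: "Psi (pad (of_log z)) = tor x" "drop_conj x = z" using Psi_of_log .
  have "pad (of_log z) $ Inl i0 \<noteq> 0" using of_log_nz by simp
  then obtain x' where x': "Psi (pad (of_log z)) = tor x'" "\<And>i. Im (x' $ Inl i) = ord_im (drop_conj (pad (of_log z))) $ i"
    using Psi_torus_ord_im by blast
  have "ord_im (of_log z) $ i = Im (x $ Inl i)" for i
    using tor_eqD[of x' x i] x(1) x' by simp
  moreover have "x $ Inl i = z $ Inl i" for i using x(2) by (metis drop_conj_simps(1))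
  ultimately show ?thesis by (simp add: vec_eq_iff im_part_def)
qed

lemma of_log_surj:
  assumes "y $ Inl i0 \<noteq> 0"
  obtains z where "of_log z = y"
proof -
  define \<zeta> where "\<zeta> = Ln (y $ Inl i0) / tpi"
  define z where "z = (\<chi> i. if i = Inl i0 then \<zeta> * a0 else y $ i + \<zeta> * drop_conj V1 $ i)"
  have "z $ Inl i0 / a0 = \<zeta>" using a0(1) by (simp add: z_def)
  moreover have "exp (tpi * \<zeta>) = y $ Inl i0" using assms by (simp add: \<zeta>_def)
  ultimately have "of_log z = y" by (simp add: of_log_def vec_eq_iff) (simp add: z_def)
  then show ?thesis using that by blast
qed

lemma Y_param_of_log_lat:
  assumes "l \<in> lat"
  shows "Y_param (of_log (z + drop_conj l)) = Y_param (of_log z)"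
proof -
  have "X_param (of_log (z + drop_conj l)) = H_orbit \<beta> (tor (pad z + l))"
    unfolding X_param_of_log by (rule H_orbit_tor_eq) (simp add: drop_conj_add)
  then show ?thesis unfolding Y_param_def X_param_of_log using tor_lat[OF assms] by simp
qed

definition D_of_log :: "complex ^ ('r + 'c) \<Rightarrow> complex ^ ('r + 'c) \<Rightarrow> complex ^ ('r + 'c)" where
  "D_of_log z h = (\<chi> i. if i = Inl i0 then tpi * (h $ Inl i0 / a0) * exp (tpi * (z $ Inl i0 / a0))
     else h $ i - h $ Inl i0 / a0 * drop_conj V1 $ i)"

lemma has_derivative_exp_coordinate:
  "((\<lambda>z. exp (tpi * (z $ Inl i0 / a0))) has_derivative
    (\<lambda>h. tpi * (h $ Inl i0 / a0) * exp (tpi * (z $ Inl i0 / a0)))) (at z)"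
  for z :: "complex ^ ('r + 'c)"
proof -
  have "bounded_linear (\<lambda>z :: complex ^ ('r + 'c). tpi * (z $ Inl i0 / a0))"
    by (intro bounded_linear_mult_right[THEN bounded_linear_compose] bounded_linear_divide[THEN bounded_linear_compose] bounded_linear_vec_nth)
  then have "((\<lambda>z :: complex ^ ('r + 'c). tpi * (z $ Inl i0 / a0)) has_derivative (\<lambda>h. tpi * (h $ Inl i0 / a0))) (at z)"
    by (rule bounded_linear_imp_has_derivative)
  moreover have "(exp has_derivative (*) (exp (tpi * (z $ Inl i0 / a0)))) (at (tpi * (z $ Inl i0 / a0)))"
    using DERIV_exp[of "tpi * (z $ Inl i0 / a0)"] by (simp add: has_field_derivative_def)
  ultimately show ?thesis
    by (rule has_derivative_compose[THEN has_derivative_eq_rhs]) (simp add: mult_ac)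
qed

lemma has_derivative_of_log: "(of_log has_derivative D_of_log z) (at z)"
  unfolding of_log_def[abs_def] D_of_log_def[abs_def]
proof (rule has_derivative_vec_lambda)
  fix i
  have "bounded_linear (\<lambda>z :: complex ^ ('r + 'c). z $ i - z $ Inl i0 / a0 * drop_conj V1 $ i)"
    by (intro bounded_linear_sub bounded_linear_vec_nth bounded_linear_mult_left[THEN bounded_linear_compose]
        bounded_linear_divide[THEN bounded_linear_compose])
  then show "((\<lambda>x. if i = Inl i0 then exp (tpi * (x $ Inl i0 / a0)) else x $ i - x $ Inl i0 / a0 * drop_conj V1 $ i)
      has_derivative (\<lambda>h. if i = Inl i0 then tpi * (h $ Inl i0 / a0) * exp (tpi * (z $ Inl i0 / a0))
         else h $ i - h $ Inl i0 / a0 * drop_conj V1 $ i)) (at z)"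
    using has_derivative_exp_coordinate by (cases "i = Inl i0") (auto intro: bounded_linear_imp_has_derivative)
qed

lemma D_of_log_linear: "D_of_log z (h + h') = D_of_log z h + D_of_log z h'" "D_of_log z (a *s h) = a *s D_of_log z h"
  by (simp_all add: D_of_log_def vec_eq_iff algebra_simps add_divide_distrib)

lemma section_holomorphic:
  assumes "s \<in> pluricanonical_sections Y n" "(V, \<phi>) \<in> snd Y"
  shows "holomorphic_fun (s (V, \<phi>) \<circ> inv_into V \<phi>) (\<phi> ` V)"
  using assms unfolding pluricanonical_sections_def by blast

lemma section_transition:
  assumes "s \<in> pluricanonical_sections Y n" "(V, \<phi>) \<in> snd Y" "(V', \<phi>') \<in> snd Y" "p \<in> V" "p \<in> V'"
  shows "s (V, \<phi>) p = s (V', \<phi>') p *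
    det (matrix (frechet_derivative (\<phi>' \<circ> inv_into V \<phi>) (at (\<phi> p)))) ^ n"
  using assms unfolding pluricanonical_sections_def by blast

lemma section_support:
  assumes "s \<in> pluricanonical_sections Y n" "c \<notin> snd Y \<or> p \<notin> fst c"
  shows "s c p = 0"
  using assms unfolding pluricanonical_sections_def by blast

lemma chart_dom_chart_inverse:
  assumes "chart_dom G" "x \<in> G"
  shows "inv_into (Y_param ` G) (inv_into G Y_param) x = Y_param x"
proof -
  have G: "inj_on Y_param G" using assms by (simp add: chart_dom_def)
  have "inv_into (Y_param ` G) (inv_into G Y_param) (inv_into G Y_param (Y_param x)) = Y_param x"
    using assms(2) by (intro inv_into_f_f inj_on_inv_into) auto
  then show ?thesis using G assms(2) by simp
qed

definition dom_chart :: "(complex ^ ('r + 'c)) set \<Rightarrow> (('r + 'c + 'c) tpoint set set, 'r + 'c) chart" where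
  "dom_chart G = (Y_param ` G, inv_into G Y_param)"

text \<open>A local symmetry \<open>\<theta>\<close> of the parametrization is the transition map between the charts at both ends.\<close>

lemma section_change:
  assumes s: "s \<in> pluricanonical_sections Y n" and G: "chart_dom G" "y \<in> G" and G': "chart_dom G'"
    and \<theta>: "(\<theta> has_derivative \<theta>') (at y)" "\<theta> y \<in> G'"
    and near: "open N" "y \<in> N" "\<And>x. x \<in> N \<Longrightarrow> Y_param (\<theta> x) = Y_param x"
  shows "s (dom_chart G) (Y_param y) = s (dom_chart G') (Y_param (\<theta> y)) * det (matrix \<theta>') ^ n"
proof -
  let ?t = "inv_into G' Y_param \<circ> inv_into (Y_param ` G) (inv_into G Y_param)"
  have oG: "open G" "open G'" "inj_on Y_param G" "inj_on Y_param G'" using G(1) G' by (auto simp: chart_dom_def)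
  obtain e' where e': "e' > 0" "ball (\<theta> y) e' \<subseteq> G'"
    using oG(2) \<theta>(2) open_contains_ball by blast
  obtain e where e: "e > 0" "\<And>x. dist x y < e \<Longrightarrow> dist (\<theta> x) (\<theta> y) < e'"
    using has_derivative_continuous[OF \<theta>(1)] e'(1) unfolding continuous_within_eps_delta by blast
  have \<theta>G: "\<theta> x \<in> G'" if "dist x y < e" for x
    using e(2)[OF that] e'(2) by (auto simp: dist_commute)
  have N: "open (N \<inter> G \<inter> ball y e)" "y \<in> N \<inter> G \<inter> ball y e"
    using near oG(1) G(2) e(1) by auto
  have "?t x = \<theta> x" if "x \<in> N \<inter> G \<inter> ball y e" for x
  proof -
    have "?t x = inv_into G' Y_param (Y_param (\<theta> x))" using that chart_dom_chart_inverse[OF G(1)] near(3) by simp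
    then show ?thesis using oG(4) \<theta>G[of x] that by (simp add: dist_commute)
  qed
  then have "(?t has_derivative \<theta>') (at y)"
    by (intro has_derivative_transform_within_open[OF \<theta>(1) N]) simp
  then have "frechet_derivative ?t (at y) = \<theta>'" by (rule frechet_derivative_at[symmetric])
  moreover have "inv_into G Y_param (Y_param y) = y" using oG(3) G(2) by simp
  moreover have "Y_param (\<theta> y) = Y_param y" using near by blast
  moreover have "Y_param y \<in> Y_param ` G" "Y_param y \<in> Y_param ` G'" using G(2) \<theta>(2) \<open>Y_param (\<theta> y) = Y_param y\<close> by (metis imageI)+
  ultimately show ?thesis
    using section_transition[OF s parametrization_chart[OF G(1)] parametrization_chart[OF G'], of "Y_param y"]
    by (simp add: dom_chart_def)
qed

text \<open>The coefficient of a section with respect to the coordinates of \<open>Psi\<close>, which by \<open>section_change\<close> with the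
  identity does not depend on the chart.\<close>

definition loc_coef :: "((('r + 'c + 'c) tpoint set set, 'r + 'c) chart \<Rightarrow> ('r + 'c + 'c) tpoint set set \<Rightarrow> complex) \<Rightarrow>
    complex ^ ('r + 'c) \<Rightarrow> complex" where
  "loc_coef s y = s (dom_chart (SOME G. chart_dom G \<and> y \<in> G)) (Y_param y)"

lemma loc_coef_eq:
  assumes s: "s \<in> pluricanonical_sections Y n" and G: "chart_dom G" "y \<in> G"
  shows "s (dom_chart G) (Y_param y) = loc_coef s y"
proof -
  define G' where "G' = (SOME G. chart_dom G \<and> y \<in> G)"
  have "chart_dom G' \<and> y \<in> G'" unfolding G'_def by (rule someI[of _ G]) (use G in blast)
  then have "s (dom_chart G) (Y_param y) = s (dom_chart G') (Y_param y) * det (matrix (\<lambda>h :: complex ^ ('r + 'c). h)) ^ n"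
    using section_change[OF s G, of G' "\<lambda>x. x" "\<lambda>h. h" UNIV] by simp
  moreover have "det (matrix (\<lambda>h :: complex ^ ('r + 'c). h)) = 1"
  proof -
    have "matrix (\<lambda>h :: complex ^ ('r + 'c). h) = mat 1"
      by (auto simp: matrix_def mat_def axis_def vec_eq_iff)
    then show ?thesis by simp
  qed
  ultimately show ?thesis by (simp add: loc_coef_def G'_def)
qed

lemma loc_coef_holomorphic:
  assumes s: "s \<in> pluricanonical_sections Y n" and G: "chart_dom G" "y \<in> G"
  shows "\<exists>f'. (loc_coef s has_derivative f') (at y) \<and> Vector_Spaces.linear (*s) (*) f'"
proof -
  have oG: "open G" "inj_on Y_param G" using G(1) by (auto simp: chart_dom_def)
  have "inv_into G Y_param ` Y_param ` G = G" using oG(2) by (simp add: inv_into_image_cancel)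
  then obtain f' where f': "(s (dom_chart G) \<circ> inv_into (Y_param ` G) (inv_into G Y_param) has_derivative f') (at y)"
    "Vector_Spaces.linear (*s) (*) f'"
    using section_holomorphic[OF s parametrization_chart[OF G(1)]] G(2) unfolding holomorphic_fun_def dom_chart_def by metis
  have "(s (dom_chart G) \<circ> inv_into (Y_param ` G) (inv_into G Y_param)) x = loc_coef s x" if "x \<in> G" for x
    using chart_dom_chart_inverse[OF G(1) that] loc_coef_eq[OF s G(1) that] by simp
  then have "(loc_coef s has_derivative f') (at y)"
    using has_derivative_transform_within_open[OF f'(1) oG(1) G(2)] by blast
  then show ?thesis using f'(2) by blast
qed

lemma chart_dom_of_log: "z \<in> log_dom \<Longrightarrow> \<exists>G. chart_dom G \<and> of_log z \<in> G"
  using chart_dom_torus[OF of_log_nz] by (simp add: ord_im_of_log log_dom_def)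

text \<open>The coefficient with respect to logarithmic coordinates, up to a constant factor: the differential of
  \<open>y\<^sub>i\<^sub>0 = exp (2 \<pi> i z\<^sub>i\<^sub>0 / a0)\<close> is \<open>y\<^sub>i\<^sub>0\<close> times a constant multiple of the differential of \<open>z\<^sub>i\<^sub>0\<close>.\<close>

definition log_coef :: "((('r + 'c + 'c) tpoint set set, 'r + 'c) chart \<Rightarrow> ('r + 'c + 'c) tpoint set set \<Rightarrow> complex) \<Rightarrow>
    nat \<Rightarrow> complex ^ ('r + 'c) \<Rightarrow> complex" where
  "log_coef s n z = loc_coef s (of_log z) * exp (tpi * (z $ Inl i0 / a0)) ^ n"

lemma log_coef_holomorphic:
  assumes s: "s \<in> pluricanonical_sections Y n" and z: "z \<in> log_dom"
  shows "\<exists>F'. (log_coef s n has_derivative F') (at z) \<and> Vector_Spaces.linear (*s) (*) F'"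
proof -
  obtain G where "chart_dom G" "of_log z \<in> G" using chart_dom_of_log[OF z] by blast
  then obtain f' where f': "(loc_coef s has_derivative f') (at (of_log z))" "Vector_Spaces.linear (*s) (*) f'"
    using loc_coef_holomorphic[OF s] by blast
  let ?e = "\<lambda>z :: complex ^ ('r + 'c). exp (tpi * (z $ Inl i0 / a0))"
  have c: "((\<lambda>z. loc_coef s (of_log z)) has_derivative (\<lambda>h. f' (D_of_log z h))) (at z)"
    by (rule has_derivative_compose[OF has_derivative_of_log f'(1)])
  have e: "((\<lambda>z. ?e z ^ n) has_derivative (\<lambda>h. of_nat n * (tpi * (h $ Inl i0 / a0) * ?e z) * ?e z ^ (n - 1))) (at z)"
    using has_derivative_power[OF has_derivative_exp_coordinate[of z], of n] by simp
  define F' where "F' h = loc_coef s (of_log z) * (of_nat n * (tpi * (h $ Inl i0 / a0) * ?e z) * ?e z ^ (n - 1)) +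
      f' (D_of_log z h) * ?e z ^ n" for h
  have "(log_coef s n has_derivative F') (at z)"
    unfolding log_coef_def[abs_def] F'_def[abs_def] by (rule has_derivative_mult[OF c e])
  moreover have "Vector_Spaces.linear (*s) (*) F'"
    using f'(2) unfolding vec_functional_linear_iff F'_def
    by (simp add: D_of_log_linear algebra_simps add_divide_distrib)
  ultimately show ?thesis by blast
qed

lemma log_dom_lat: "z \<in> log_dom \<Longrightarrow> l \<in> lat \<Longrightarrow> z + drop_conj l \<in> log_dom"
  by (simp add: log_dom_def im_part_def lat_real)

text \<open>A lattice vector \<open>l\<close> translates the logarithmic coordinates. On the coordinates of \<open>Psi\<close> it acts by an
  affine map with determinant \<open>exp (2 \<pi> i l\<^sub>i\<^sub>0 / a0)\<close>, and the factor of \<open>log_coef\<close> changes by the same number.\<close>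

lemma log_coef_periodic:
  assumes s: "s \<in> pluricanonical_sections Y n" and z: "z \<in> log_dom" and l: "l \<in> lat"
  shows "log_coef s n (z + drop_conj l) = log_coef s n z"
proof -
  define \<epsilon> where "\<epsilon> = exp (tpi * (l $ Inl i0 / a0))"
  define t where "t i = drop_conj l $ i - l $ Inl i0 / a0 * drop_conj V1 $ i" for i
  define \<theta> where "\<theta> x = (\<chi> i. if i = Inl i0 then \<epsilon> * x $ i else x $ i + t i)" for x :: "complex ^ ('r + 'c)"
  define \<theta>' where "\<theta>' h = (\<chi> i. if i = Inl i0 then \<epsilon> * h $ i else h $ i)" for h :: "complex ^ ('r + 'c)"
  have \<theta>of_log: "\<theta> (of_log x) = of_log (x + drop_conj l)" for x
    by (simp add: \<theta>_def of_log_def vec_eq_iff \<epsilon>_def t_def exp_add[symmetric] algebra_simps add_divide_distrib)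
  have der: "(\<theta> has_derivative \<theta>') (at y)" for y
    unfolding \<theta>_def[abs_def] \<theta>'_def[abs_def]
  proof (rule has_derivative_vec_lambda)
    fix i
    have 1: "bounded_linear (\<lambda>x :: complex ^ ('r + 'c). \<epsilon> * x $ i)" "bounded_linear (\<lambda>x :: complex ^ ('r + 'c). x $ i)"
      by (intro bounded_linear_const_mult bounded_linear_vec_nth)+
    have 2: "((\<lambda>x. x $ i + t i) has_derivative (\<lambda>h. h $ i)) (at y)"
      by (intro has_derivative_add_const bounded_linear_imp_has_derivative 1(2))
    show "((\<lambda>x. if i = Inl i0 then \<epsilon> * x $ i else x $ i + t i) has_derivative
        (\<lambda>h. if i = Inl i0 then \<epsilon> * h $ i else h $ i)) (at y)"
      using bounded_linear_imp_has_derivative[OF 1(1), of "at y"] 2 by (cases "i = Inl i0") auto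
  qed
  have "det (matrix \<theta>') = (\<Prod>i\<in>UNIV. matrix \<theta>' $ i $ i)"
    by (rule det_diagonal) (simp add: matrix_def \<theta>'_def axis_def)
  also have "\<dots> = (\<Prod>i\<in>(UNIV :: ('r + 'c) set). if i = Inl i0 then \<epsilon> else 1)"
    by (intro prod.cong refl) (simp add: matrix_def \<theta>'_def axis_def)
  finally have det: "det (matrix \<theta>') = \<epsilon>" by simp
  obtain G where G: "chart_dom G" "of_log z \<in> G" using chart_dom_of_log[OF z] by blast
  obtain G' where G': "chart_dom G'" "of_log (z + drop_conj l) \<in> G'" using chart_dom_of_log[OF log_dom_lat[OF z l]] by blast
  have "s (dom_chart G) (Y_param (of_log z)) = s (dom_chart G') (Y_param (\<theta> (of_log z))) * det (matrix \<theta>') ^ n"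
  proof (rule section_change[OF s G G'(1) der])
    show "\<theta> (of_log z) \<in> G'" using G'(2) by (simp add: \<theta>of_log)
    show "open {x :: complex ^ ('r + 'c). x $ Inl i0 \<noteq> 0}" by (intro open_Collect_neq continuous_intros)
    show "of_log z \<in> {x. x $ Inl i0 \<noteq> 0}" using of_log_nz by simp
    fix x :: "complex ^ ('r + 'c)" assume "x \<in> {x. x $ Inl i0 \<noteq> 0}"
    then obtain w where "of_log w = x" using of_log_surj by blast
    then show "Y_param (\<theta> x) = Y_param x" using \<theta>of_log[of w] Y_param_of_log_lat[OF l, of w] by simp
  qed
  then have "loc_coef s (of_log z) = loc_coef s (of_log (z + drop_conj l)) * \<epsilon> ^ n"
    using loc_coef_eq[OF s G] loc_coef_eq[OF s G'] by (simp add: \<theta>of_log det)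
  moreover have "exp (tpi * ((z + drop_conj l) $ Inl i0 / a0)) = exp (tpi * (z $ Inl i0 / a0)) * \<epsilon>"
    by (simp add: \<epsilon>_def exp_add[symmetric] algebra_simps add_divide_distrib)
  ultimately show ?thesis by (simp add: log_coef_def power_mult_distrib)
qed

text \<open>The coefficient times \<open>y\<^sub>i\<^sub>0 ^ n\<close> is a constant on the torus. Near a point of the divisor the coefficient is
  bounded and \<open>y\<^sub>i\<^sub>0 ^ n\<close> tends to zero, as \<open>n > 0\<close>.\<close>

lemma loc_coef_torus_0:
  assumes s: "s \<in> pluricanonical_sections Y n" and n: "n > 0"
    and bd: "chart_dom Gb" "q \<in> Gb" "q $ Inl i0 = 0"
    and y: "y $ Inl i0 \<noteq> 0" "ord_im y \<in> Omega TYPE('c) b"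
  shows "loc_coef s y = 0"
proof -
  obtain a where a: "\<And>z. z \<in> log_dom \<Longrightarrow> log_coef s n z = a"
    using periodic_constant[of "log_coef s n"] log_coef_holomorphic[OF s] log_coef_periodic[OF s] by blast
  have loc_coef: "loc_coef s y * (y $ Inl i0) ^ n = a" if y: "y $ Inl i0 \<noteq> 0" "ord_im y \<in> Omega TYPE('c) b" for y
  proof -
    obtain z where z: "of_log z = y" using of_log_surj[OF y(1)] .
    then have "z \<in> log_dom" using y(2) ord_im_of_log[of z] by (simp add: log_dom_def)
    moreover have "y $ Inl i0 = exp (tpi * (z $ Inl i0 / a0))" using z by (auto simp: of_log_def)
    ultimately show ?thesis using a[of z] z by (simp add: log_coef_def)
  qed
  have "a = 0"
  proof (rule ccontr)
    assume "a \<noteq> 0"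
    let ?h = "\<lambda>y. cmod (loc_coef s y * (y $ Inl i0) ^ n)"
    have oG: "open Gb" "X_param ` Gb \<subseteq> U" using bd(1) by (auto simp: chart_dom_def)
    have "continuous_on Gb (loc_coef s)"
      using loc_coef_holomorphic[OF s bd(1)] by (meson continuous_at_imp_continuous_on has_derivative_continuous)
    then have "continuous_on Gb ?h" by (intro continuous_intros)
    then have "open (Gb \<inter> ?h -` {..<cmod a})" by (intro continuous_open_preimage oG(1)) auto
    moreover have "q \<in> Gb \<inter> ?h -` {..<cmod a}" using bd n \<open>a \<noteq> 0\<close> by (simp add: zero_power)
    ultimately obtain x where x: "x \<in> Gb \<inter> ?h -` {..<cmod a}" "x $ Inl i0 \<noteq> 0"
      using nonzero_coordinate_dense[of "Gb \<inter> ?h -` {..<cmod a}" q "Inl i0"] by blast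
    then have "ord_im x \<in> Omega TYPE('c) b" using oG(2) X_param_U_torus[OF x(2)] by blast
    then show False using loc_coef[OF x(2)] x(1) by simp
  qed
  then show ?thesis using loc_coef[OF y] y(1) by simp
qed

text \<open>Points of the boundary are approached from the torus in a direction that projects into \<open>\<Omega>\<close>, so
  eventually from within \<open>U\<close>.\<close>

lemma torus_dense:
  assumes V: "openin (fst Y) V" "V \<noteq> {}"
  shows "\<exists>z\<in>log_dom. Y_param (of_log z) \<in> V"
proof -
  obtain Q where Q: "openin TQ Q" "{P \<in> topspace TU. Wo P \<in> V} = Q \<inter> U"
    using V(1) unfolding openin_Y openin_subtopology by blast
  have "V \<subseteq> Wo ` topspace TU" using V(1) unfolding openin_Y by blast
  then obtain P where P: "P \<in> topspace TU" "Wo P \<in> V" using V(2) by blast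
  then obtain p where p: "p \<in> toric_points Fan" "P = H_orbit \<beta> p" "P \<in> U" unfolding topspace_TU by blast
  have PQ: "P \<in> Q" using P Q(2) by blast
  define S where "S = {p \<in> toric_points Fan. H_orbit \<beta> p \<in> Q}"
  have S: "openin TX S" "p \<in> S" using Q(1) p PQ unfolding openin_TQ S_def by auto
  obtain z0 e where e: "e \<in> fst p" "e = 0 \<Longrightarrow> p = tor z0"
    and ev: "\<And>S. openin TX S \<Longrightarrow> p \<in> S \<Longrightarrow>
       eventually (\<lambda>t::real. tor (z0 + (\<i> * of_real t) *s real_point e) \<in> S) at_top"
    by (rule torus_approach[OF p(1)]) (rule that; blast)
  let ?z = "\<lambda>t::real. z0 + (\<i> * of_real t) *s real_point e"
  have Im: "Im (?z t $ Inl i) = Im (z0 $ Inl i) + t * proj_real (real_point e) $ i" for t i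
    by (simp add: proj_real_def)
  have "eventually (\<lambda>t. drop_conj (?z t) \<in> log_dom) at_top"
  proof (cases "e = 0")
    case True
    then have "(\<chi> i. Im (z0 $ Inl i)) \<in> Omega TYPE('c) b"
      using p(2,3) e(2) U_iff_torus by simp
    then show ?thesis using True by (simp add: log_dom_def im_part_def linear_0[OF linear_real_point])
  next
    case False
    have "fst p \<in> Fan" using p(1) by (auto simp: toric_points_def)
    then have pos: "proj_real (real_point e) \<in> Omega TYPE('c) b" using Fan_Omega e(1) False by blast
    have "eventually (\<lambda>t. emb_index (Inl i :: 'r + 'c) \<le> b \<longrightarrow> Im (?z t $ Inl i) > 0) at_top" for i
    proof (cases "emb_index (Inl i :: 'r + 'c) \<le> b")
      case True
      then have c: "proj_real (real_point e) $ i > 0" using pos by (simp add: Omega_def)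
      have "eventually (\<lambda>t. t > - Im (z0 $ Inl i) / proj_real (real_point e) $ i) at_top"
        by (rule eventually_gt_at_top)
      then show ?thesis unfolding Im by eventually_elim (use c in \<open>simp add: field_simps\<close>)
    qed simp
    then have "eventually (\<lambda>t. \<forall>i. emb_index (Inl i :: 'r + 'c) \<le> b \<longrightarrow> Im (?z t $ Inl i) > 0) at_top"
      by (rule eventually_all_finite)
    then show ?thesis by (simp add: log_dom_def im_part_def Omega_def)
  qed
  then have both: "eventually (\<lambda>t. drop_conj (?z t) \<in> log_dom \<and> tor (?z t) \<in> S) at_top"
    using ev[OF S] by (rule eventually_conj)
  then obtain t where t: "drop_conj (?z t) \<in> log_dom" "tor (?z t) \<in> S"
    using eventually_happens'[OF trivial_limit_at_top_linorder both] by blast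
  have X_param: "X_param (of_log (drop_conj (?z t))) = H_orbit \<beta> (tor (?z t))"
    unfolding X_param_of_log by (rule H_orbit_tor_eq) simp
  have "X_param (of_log (drop_conj (?z t))) \<in> U"
    using X_param_U_torus[OF of_log_nz] t(1) by (simp add: ord_im_of_log log_dom_def)
  then have "X_param (of_log (drop_conj (?z t))) \<in> Q \<inter> U" using t(2) unfolding X_param S_def by blast
  then have "Y_param (of_log (drop_conj (?z t))) \<in> V" unfolding Y_param_def using Q(2) by blast
  then show ?thesis using t(1) by blast
qed

theorem section_eq_0:
  assumes s: "s \<in> pluricanonical_sections Y n" and n: "n > 0"
    and bd: "chart_dom Gb" "q \<in> Gb" "q $ Inl i0 = 0"
  shows "s c P = 0"
proof (rule ccontr)
  assume ne: "s c P \<noteq> 0"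
  then have cP: "c \<in> snd Y" "P \<in> fst c" using section_support[OF s] by blast+
  obtain V \<phi> where c: "c = (V, \<phi>)" by (cases c)
  have V: "openin (fst Y) V" "open (\<phi> ` V)" "homeomorphic_map (subtopology (fst Y) V) (top_of_set (\<phi> ` V)) \<phi>"
    using cP(1) unfolding c snd_Y by auto
  have top: "topspace (subtopology (fst Y) V) = V" using openin_subset[OF V(1)] by (simp add: Int_absorb1)
  have inj: "inj_on \<phi> V" using homeomorphic_imp_injective_map[OF V(3)] top by simp
  define h where "h = s (V, \<phi>) \<circ> inv_into V \<phi>"
  have "holomorphic_fun h (\<phi> ` V)" unfolding h_def using section_holomorphic[OF s] cP(1) c by blast
  then have "continuous_on (\<phi> ` V) h"
    unfolding holomorphic_fun_def by (meson continuous_at_imp_continuous_on has_derivative_continuous)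
  then have "open (\<phi> ` V \<inter> h -` (- {0}))" using V(2) by (intro continuous_open_preimage) (auto simp: open_Compl)
  then have "openin (top_of_set (\<phi> ` V)) (\<phi> ` V \<inter> h -` (- {0}))" by (intro open_openin_trans V(2)) auto
  then have preim: "openin (subtopology (fst Y) V) {x \<in> topspace (subtopology (fst Y) V). \<phi> x \<in> \<phi> ` V \<inter> h -` (- {0})}"
    by (rule openin_continuous_map_preimage[OF homeomorphic_imp_continuous_map[OF V(3)]])
  have "\<phi> x \<in> \<phi> ` V \<inter> h -` (- {0}) \<longleftrightarrow> s (V, \<phi>) x \<noteq> 0" if "x \<in> V" for x
    using that by (simp add: h_def inv_into_f_f[OF inj])
  then have eq: "{x \<in> topspace (subtopology (fst Y) V). \<phi> x \<in> \<phi> ` V \<inter> h -` (- {0})} = {x \<in> V. s (V, \<phi>) x \<noteq> 0}"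
    unfolding top by blast
  have "openin (fst Y) {x \<in> V. s (V, \<phi>) x \<noteq> 0}"
    by (rule openin_trans_full[OF preim[unfolded eq] V(1)])
  moreover have "P \<in> {x \<in> V. s (V, \<phi>) x \<noteq> 0}" using ne cP c by simp
  ultimately obtain z where z: "z \<in> log_dom" "Y_param (of_log z) \<in> V" "s (V, \<phi>) (Y_param (of_log z)) \<noteq> 0"
    using torus_dense[of "{x \<in> V. s (V, \<phi>) x \<noteq> 0}"] by blast
  obtain G where G: "chart_dom G" "of_log z \<in> G" using chart_dom_of_log[OF z(1)] by blast
  have "s (dom_chart G) (Y_param (of_log z)) = 0"
    unfolding loc_coef_eq[OF s G] using loc_coef_torus_0[OF s n bd of_log_nz] z(1) by (simp add: ord_im_of_log log_dom_def)
  moreover have "Y_param (of_log z) \<in> Y_param ` G" using G(2) by blast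
  ultimately have "s (V, \<phi>) (Y_param (of_log z)) = 0"
    using section_transition[OF s, of V \<phi> "Y_param ` G" "inv_into G Y_param" "Y_param (of_log z)"] parametrization_chart[OF G(1)] cP(1) z(2)
    by (simp add: c dom_chart_def)
  then show False using z(3) by simp
qed

end

lemma plurigenus_0I:
  assumes "\<And>s. s \<in> pluricanonical_sections M n \<Longrightarrow> s = 0"
  shows "plurigenus M n = 0"
proof -
  let ?scale = "\<lambda>(a::complex) s c p. a * s c p"
  have "B = {}" if B: "B \<subseteq> pluricanonical_sections M n" "\<not> module.dependent ?scale B" for B
  proof (rule ccontr)
    assume "B \<noteq> {}"
    then have "0 \<in> B" using B(1) assms by blast
    then have "module.dependent ?scale B"
      by (rule module.dependent_zero[rotated]) (unfold_locales, auto simp: fun_eq_iff algebra_simps)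
    then show False using B(2) by blast
  qed
  then have "plurigenus M n \<le> 0" unfolding plurigenus_def
    by (intro SUP_least) (auto simp: zero_enat_def)
  then show ?thesis by simp
qed

theorem proposition3p3:
  fixes \<sigma> :: "'r::{finite,linorder} + 'c::{finite,linorder} + 'c \<Rightarrow> 'k::field_char_0 \<Rightarrow> complex"
    and \<beta> :: "'r + 'c + 'c \<Rightarrow> complex ^ ('r + 'c + 'c)"
    and b :: nat
    and W :: "'k set"
    and \<Delta>' :: "(real ^ 'r::{finite,linorder}) set set"
    and \<Delta> :: "(complex ^ ('r + 'c + 'c)) set set"
  assumes "number_field TYPE('k)"
    and "embedding_enumeration \<sigma>"
    and "zbasis \<beta> (int_ring_lattice \<sigma>)"
    and "1 \<le> b" and "b \<le> CARD('r) - 1"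
    and "mult_subgroup W (positive_units \<sigma>)"
    and "mult_rank W = enat b"
    and "assumption_C \<sigma> b W"
    and "base_fan \<sigma> b W \<Delta>'"
    and "lifted_fan \<sigma> W \<Delta>' \<Delta>"
  shows "kodaira_dimension (Y_manifold \<sigma> \<beta> \<Delta> b W) = - \<infinity>"
proof -
  interpret unit_fan_data \<sigma> \<beta> b W \<Delta>' \<Delta>
    by unfold_locales (rule assms)+
  obtain v m J where J: "dual_bases v m" "convex_cone hull (v ` J) \<in> Fan"
    "interior (proj_real ` real_point ` (convex_cone hull (v ` J))) \<noteq> {}"
    by (rule big_cone)
  have "J \<noteq> {}"
  proof
    assume "J = {}"
    then have "proj_real ` real_point ` (convex_cone hull (v ` J)) = {0}"
      by (simp add: linear_0[OF linear_real_point] linear_0[OF linear_proj_real])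
    then show False using J(3) by simp
  qed
  then obtain j1 where j1: "j1 \<in> J" by blast
  then have ray: "ray_cone (v j1) \<in> Fan" using Fan_subface[OF J(1,2), of "{j1}"] by simp
  interpret unit_fan_ray \<sigma> \<beta> b W \<Delta>' \<Delta> v m j1 undefined
    by unfold_locales (rule J(1), rule ray)
  obtain G q where "chart_dom G" "q \<in> G" "q $ Inl undefined = 0"
    using chart_dom_boundary[OF J(2) j1 J(3)] by blast
  then have "s = 0" if "s \<in> pluricanonical_sections Y n" "n > 0" for s n
    using section_eq_0[OF that] by (simp add: fun_eq_iff zero_fun_def)
  then have "plurigenus Y n = 0" if "n > 0" for n using that by (intro plurigenus_0I) blast
  then show ?thesis by (simp add: kodaira_dimension_def)
qed

end
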